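(* Let $M$ be a compact simply-connected Calabi-Yau $2$-fold with Kähler form $\omega$, and let $A$ be an irreducible Yang-Mills connection on a bundle $E$ over $M$ with compact, semi-simple structure Lie group $G$. Then there exists a positive constant $\delta=\delta(M,A)$ with the following property: if $$\|\hat F_A\|_{L^2(M)}\le\delta,$$ then $A$ is an anti-self-dual connection.
   Context: $E$ is the Hermitian vector bundle associated to a smooth principal $G$-bundle $P\to M$ by a faithful unitary representation of $G$; $\mathfrak g_P$ is the adjoint bundle; norms are induced by the Kähler metric and the trace inner product. $A$ is a $G$-connection with covariant exterior derivative $d_A$ and curvature $F_A\in\Omega^2(\mathfrak g_P)$. $A$ is Yang-Mills if $d_A^*F_A=0$. $A$ is irreducible if $\ker\{d_A:\Omega^0(\mathfrak g_P)\to\Omega^1(\mathfrak g_P)\}=\{0\}$. $\hat F_A:=\Lambda_\omega F_A$, where $\Lambda_\omega$ is contraction with the Kähler form (the adjoint of $\omega\wedge\cdot$). $A$ is anti-self-dual if $\ast F_A=-F_A$, i.e. the self-dual part $F_A^+=F_A^{2,0}+F_A^{0,2}+\tfrac12\hat F_A\otimes\omega$ vanishes, where $F_A^{p,q}$ is the $(p,q)$-component of $F_A$. A Calabi-Yau $2$-fold here is a Kähler surface carrying a nonzero covariantly constant $(2,0)$-form $\theta$, normalized so that $\theta\wedge\bar\theta=\omega^2/2$. *)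

theory Defs
  imports "HOL-Analysis.Analysis"
begin

section \<open>Smooth functions on open subsets of a Euclidean space\<close>

abbreviation dir_deriv ::
    "('a::euclidean_space \<Rightarrow> 'b::real_normed_vector) \<Rightarrow> 'a \<Rightarrow> 'a \<Rightarrow> 'b" where
  "dir_deriv f x v \<equiv> frechet_derivative f (at x) v"

primrec Ck_on ::
    "nat \<Rightarrow> 'a set \<Rightarrow> ('a::euclidean_space \<Rightarrow> 'b::real_normed_vector) \<Rightarrow> bool" where
  "Ck_on 0 S f \<longleftrightarrow> continuous_on S f"
| "Ck_on (Suc k) S f \<longleftrightarrow>
     (\<forall>x\<in>S. f differentiable (at x)) \<and> (\<forall>v. Ck_on k S (\<lambda>x. dir_deriv f x v))"

definition smooth_on :: "'a set \<Rightarrow> ('a::euclidean_space \<Rightarrow> 'b::real_normed_vector) \<Rightarrow> bool" where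
  "smooth_on S f \<longleftrightarrow> (\<forall>k. Ck_on k S f)"


section \<open>Complex surfaces\<close>

text \<open>
  The model space is \<open>complex^2\<close>, which is also a real Euclidean space of dimension four; real
  tangent vectors in a chart are elements of \<open>complex^2\<close>, and the complex structure is
  multiplication by \<open>\<i>\<close>.  A chart is a pair \<open>(U, \<phi>)\<close>.  The manifold is the whole type \<open>'m\<close>.
\<close>

type_synonym cvec = "complex^2"
type_synonym 'm chart = "'m set \<times> ('m \<Rightarrow> cvec)"

definition Jmul :: "cvec \<Rightarrow> cvec" where
  "Jmul v = (\<chi> k. \<i> * v $ k)"

definition chart_inv :: "'m chart \<Rightarrow> cvec \<Rightarrow> 'm" where
  "chart_inv c = inv_into (fst c) (snd c)"

definition chart_change :: "'m chart \<Rightarrow> 'm chart \<Rightarrow> cvec \<Rightarrow> cvec" where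
  "chart_change c d = snd d \<circ> chart_inv c"

definition complex_surface :: "'m::t2_space chart set \<Rightarrow> bool" where
  "complex_surface Atl \<longleftrightarrow>
     (\<Union>c\<in>Atl. fst c) = UNIV \<and>
     (\<forall>c\<in>Atl. open (fst c) \<and> open (snd c ` fst c) \<and>
        homeomorphism (fst c) (snd c ` fst c) (snd c) (chart_inv c)) \<and>
     (\<forall>c\<in>Atl. \<forall>d\<in>Atl.
        smooth_on (snd c ` (fst c \<inter> fst d)) (chart_change c d) \<and>
        (\<forall>x\<in>snd c ` (fst c \<inter> fst d). \<forall>v.
           dir_deriv (chart_change c d) x (Jmul v) = Jmul (dir_deriv (chart_change c d) x v)))"

text \<open>
  A 2-form on the manifold is given by its local representatives: \<open>\<beta> c x u v\<close> is the value, at the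
  point with coordinates \<open>x\<close> in the chart \<open>c\<close>, on the tangent vectors with coordinates \<open>u\<close> and \<open>v\<close>.
  Values at \<open>x\<close> outside the image of \<open>c\<close> are irrelevant.
\<close>

definition two_form ::
    "'m chart set \<Rightarrow> ('m chart \<Rightarrow> cvec \<Rightarrow> cvec \<Rightarrow> cvec \<Rightarrow> 'w::real_normed_vector) \<Rightarrow> bool" where
  "two_form Atl \<beta> \<longleftrightarrow>
     (\<forall>c\<in>Atl.
        (\<forall>x\<in>snd c ` fst c. bilinear (\<beta> c x) \<and> (\<forall>v. \<beta> c x v v = 0)) \<and>
        (\<forall>u v. smooth_on (snd c ` fst c) (\<lambda>x. \<beta> c x u v))) \<and>
     (\<forall>c\<in>Atl. \<forall>d\<in>Atl. \<forall>x\<in>snd c ` (fst c \<inter> fst d). \<forall>u v.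
        \<beta> c x u v =
        \<beta> d (chart_change c d x)
          (dir_deriv (chart_change c d) x u) (dir_deriv (chart_change c d) x v))"


section \<open>Kaehler surfaces and Calabi-Yau 2-folds\<close>

text \<open>
  A Kaehler form is a closed, positive, real (1,1)-form; the Kaehler metric is
  \<open>g(v, w) = \<omega>(v, J w)\<close>.
\<close>

definition kahler_form ::
    "'m chart set \<Rightarrow> ('m chart \<Rightarrow> cvec \<Rightarrow> cvec \<Rightarrow> cvec \<Rightarrow> real) \<Rightarrow> bool" where
  "kahler_form Atl \<omega> \<longleftrightarrow>
     two_form Atl \<omega> \<and>
     (\<forall>c\<in>Atl. \<forall>x\<in>snd c ` fst c.
        (\<forall>v w. \<omega> c x (Jmul v) (Jmul w) = \<omega> c x v w) \<and>
        (\<forall>v. v \<noteq> 0 \<longrightarrow> \<omega> c x v (Jmul v) > 0) \<and>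
        (\<forall>u v w. dir_deriv (\<lambda>y. \<omega> c y v w) x u + dir_deriv (\<lambda>y. \<omega> c y w u) x v
                 + dir_deriv (\<lambda>y. \<omega> c y u v) x w = 0))"

definition metric :: "(cvec \<Rightarrow> cvec \<Rightarrow> cvec \<Rightarrow> real) \<Rightarrow> cvec \<Rightarrow> cvec \<Rightarrow> cvec \<Rightarrow> real" where
  "metric \<omega>c x v w = \<omega>c x v (Jmul w)"

text \<open>
  The Christoffel symbol \<open>\<Gamma>(u, v) = \<nabla>\<^sub>u v\<close> of the Levi-Civita connection, for \<open>u\<close>, \<open>v\<close> constant in
  the chart, from the Koszul formula.
\<close>

definition christoffel :: "(cvec \<Rightarrow> cvec \<Rightarrow> cvec \<Rightarrow> real) \<Rightarrow> cvec \<Rightarrow> cvec \<Rightarrow> cvec \<Rightarrow> cvec" where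
  "christoffel \<omega>c x u v =
     (THE z. \<forall>w. 2 * metric \<omega>c x z w =
        dir_deriv (\<lambda>y. metric \<omega>c y v w) x u + dir_deriv (\<lambda>y. metric \<omega>c y u w) x v
        - dir_deriv (\<lambda>y. metric \<omega>c y u v) x w)"

definition cov_deriv2 ::
    "(cvec \<Rightarrow> cvec \<Rightarrow> cvec \<Rightarrow> real) \<Rightarrow> (cvec \<Rightarrow> cvec \<Rightarrow> cvec \<Rightarrow> complex) \<Rightarrow>
     cvec \<Rightarrow> cvec \<Rightarrow> cvec \<Rightarrow> cvec \<Rightarrow> complex" where
  "cov_deriv2 \<omega>c \<theta>c x u v w =
     dir_deriv (\<lambda>y. \<theta>c y v w) x u
     - \<theta>c x (christoffel \<omega>c x u v) w - \<theta>c x v (christoffel \<omega>c x u w)"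

definition wedge22 ::
    "(cvec \<Rightarrow> cvec \<Rightarrow> 'k::comm_ring_1) \<Rightarrow> (cvec \<Rightarrow> cvec \<Rightarrow> 'k) \<Rightarrow>
     cvec \<Rightarrow> cvec \<Rightarrow> cvec \<Rightarrow> cvec \<Rightarrow> 'k" where
  "wedge22 \<alpha> \<beta> t u v w =
     \<alpha> t u * \<beta> v w - \<alpha> t v * \<beta> u w + \<alpha> t w * \<beta> u v
     + \<alpha> u v * \<beta> t w - \<alpha> u w * \<beta> t v + \<alpha> v w * \<beta> t u"

text \<open>The Riemannian volume form of a Kaehler surface is \<open>\<omega> \<and> \<omega> / 2\<close>.\<close>

definition vol_form ::
    "(cvec \<Rightarrow> cvec \<Rightarrow> cvec \<Rightarrow> real) \<Rightarrow> cvec \<Rightarrow> cvec \<Rightarrow> cvec \<Rightarrow> cvec \<Rightarrow> cvec \<Rightarrow> real" where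
  "vol_form \<omega>c x t u v w = wedge22 (\<omega>c x) (\<omega>c x) t u v w / 2"

definition calabi_yau_2fold ::
    "'m::t2_space chart set \<Rightarrow> ('m chart \<Rightarrow> cvec \<Rightarrow> cvec \<Rightarrow> cvec \<Rightarrow> real) \<Rightarrow>
     ('m chart \<Rightarrow> cvec \<Rightarrow> cvec \<Rightarrow> cvec \<Rightarrow> complex) \<Rightarrow> bool" where
  "calabi_yau_2fold Atl \<omega> \<theta> \<longleftrightarrow>
     complex_surface Atl \<and> kahler_form Atl \<omega> \<and> two_form Atl \<theta> \<and>
     (\<exists>c\<in>Atl. \<exists>x\<in>snd c ` fst c. \<exists>u v. \<theta> c x u v \<noteq> 0) \<and>
     (\<forall>c\<in>Atl. \<forall>x\<in>snd c ` fst c.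
        (\<forall>u v. \<theta> c x (Jmul u) v = \<i> * \<theta> c x u v) \<and>
        (\<forall>u v w. cov_deriv2 (\<omega> c) (\<theta> c) x u v w = 0) \<and>
        (\<forall>t u v w. wedge22 (\<theta> c x) (\<lambda>a b. cnj (\<theta> c x a b)) t u v w =
                   complex_of_real (vol_form (\<omega> c) x t u v w)))"


section \<open>Metric contractions\<close>

definition onb :: "(cvec \<Rightarrow> cvec \<Rightarrow> real) \<Rightarrow> 4 \<Rightarrow> cvec" where
  "onb h = (SOME e. \<forall>a b. h (e a) (e b) = (if a = b then 1 else 0))"

text \<open>
  The Hodge star of a \<open>k\<close>-form in dimension four is
  \<open>(\<star>\<beta>)(u, \<dots>) = 1/k! \<Sum> \<beta>(e\<^sub>a, e\<^sub>b, \<dots>) vol(e\<^sub>a, e\<^sub>b, \<dots>, u, \<dots>)\<close> for an orthonormal basis \<open>e\<close>; this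
  satisfies \<open>\<alpha> \<and> \<star>\<beta> = \<langle>\<alpha>, \<beta>\<rangle> vol\<close>, and it depends neither on the choice nor on the orientation of
  \<open>e\<close>.  Likewise for the contraction below.
\<close>

definition hodge2 ::
    "(cvec \<Rightarrow> cvec \<Rightarrow> cvec \<Rightarrow> real) \<Rightarrow> cvec \<Rightarrow> (cvec \<Rightarrow> cvec \<Rightarrow> 'w::real_vector) \<Rightarrow>
     cvec \<Rightarrow> cvec \<Rightarrow> 'w" where
  "hodge2 \<omega>c x \<beta> u v =
     (let e = onb (metric \<omega>c x)
      in (1/2) *\<^sub>R (\<Sum>a\<in>UNIV. \<Sum>b\<in>UNIV. vol_form \<omega>c x (e a) (e b) u v *\<^sub>R \<beta> (e a) (e b)))"

definition hodge3 ::
    "(cvec \<Rightarrow> cvec \<Rightarrow> cvec \<Rightarrow> real) \<Rightarrow> cvec \<Rightarrow> (cvec \<Rightarrow> cvec \<Rightarrow> cvec \<Rightarrow> 'w::real_vector) \<Rightarrow>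
     cvec \<Rightarrow> 'w" where
  "hodge3 \<omega>c x \<beta> u =
     (let e = onb (metric \<omega>c x)
      in (1/6) *\<^sub>R (\<Sum>a\<in>UNIV. \<Sum>b\<in>UNIV. \<Sum>k\<in>UNIV.
            vol_form \<omega>c x (e a) (e b) (e k) u *\<^sub>R \<beta> (e a) (e b) (e k)))"

text \<open>
  \<open>\<Lambda>\<beta> = \<langle>\<beta>, \<omega>\<rangle>\<close>, which is the adjoint of \<open>f \<mapsto> f \<omega>\<close> for the inner product
  \<open>\<langle>\<alpha>, \<beta>\<rangle> = 1/2 \<Sum> \<langle>\<alpha>(e\<^sub>a, e\<^sub>b), \<beta>(e\<^sub>a, e\<^sub>b)\<rangle>\<close> on 2-forms.
\<close>

definition Lambda2 ::
    "(cvec \<Rightarrow> cvec \<Rightarrow> cvec \<Rightarrow> real) \<Rightarrow> cvec \<Rightarrow> (cvec \<Rightarrow> cvec \<Rightarrow> 'w::real_vector) \<Rightarrow> 'w" where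
  "Lambda2 \<omega>c x \<beta> =
     (let e = onb (metric \<omega>c x)
      in (1/2) *\<^sub>R (\<Sum>a\<in>UNIV. \<Sum>b\<in>UNIV. \<omega>c x (e a) (e b) *\<^sub>R \<beta> (e a) (e b)))"


section \<open>Compact Lie groups in a faithful unitary representation\<close>

text \<open>
  A compact Lie group with a faithful unitary representation is identified with its image, a
  compact subgroup of the unitary group; conversely every such subgroup is a Lie group.
  The product on \<open>complex^'n^'n\<close> is \<open>**\<close>, not the pointwise \<open>*\<close>.
\<close>

type_synonym 'n cmat = "complex^'n^'n"

definition conj_transpose :: "'n::finite cmat \<Rightarrow> 'n cmat" where
  "conj_transpose X = (\<chi> i j. cnj (X $ j $ i))"

definition compact_unitary_group :: "'n::finite cmat set \<Rightarrow> bool" where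
  "compact_unitary_group G \<longleftrightarrow>
     compact G \<and> mat 1 \<in> G \<and>
     (\<forall>g\<in>G. \<forall>h\<in>G. g ** h \<in> G) \<and> (\<forall>g\<in>G. matrix_inv g \<in> G) \<and>
     (\<forall>g\<in>G. g ** conj_transpose g = mat 1)"

definition lie_bracket :: "'n::finite cmat \<Rightarrow> 'n cmat \<Rightarrow> 'n cmat" where
  "lie_bracket X Y = X ** Y - Y ** X"

text \<open>The Lie algebra, as the tangent space of \<open>G\<close> at the identity.\<close>

definition lie_algebra :: "'n::finite cmat set \<Rightarrow> 'n cmat set" where
  "lie_algebra G =
     {X. \<exists>\<gamma>. (\<forall>t::real. \<gamma> t \<in> G) \<and> \<gamma> 0 = mat 1 \<and> (\<gamma> has_vector_derivative X) (at 0)}"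

definition semisimple_group :: "'n::finite cmat set \<Rightarrow> bool" where
  "semisimple_group G \<longleftrightarrow>
     (\<forall>I. subspace I \<and> I \<subseteq> lie_algebra G \<and>
          (\<forall>X\<in>lie_algebra G. \<forall>Y\<in>I. lie_bracket X Y \<in> I) \<and>
          (\<forall>X\<in>I. \<forall>Y\<in>I. lie_bracket X Y = 0)
        \<longrightarrow> I = {0})"


section \<open>Principal bundles and connections\<close>

text \<open>
  A principal bundle has total space \<open>'p\<close>, a right action of \<open>G\<close> that is free and transitive on the
  fibres, and smooth local sections \<open>(V, s)\<close>, whose domains cover the base and whose transition
  functions are smooth.  The local trivialisations \<open>(x, g) \<mapsto> s x \<cdot> g\<close> endow \<open>'p\<close> with its smooth
  structure.
\<close>

type_synonym ('m, 'p) lsec = "'m set \<times> ('m \<Rightarrow> 'p)"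

record ('m, 'p, 'n) pbundle =
  proj :: "'p \<Rightarrow> 'm"
  act :: "'p \<Rightarrow> 'n cmat \<Rightarrow> 'p"
  secs :: "('m, 'p) lsec set"

definition transition ::
    "'n::finite cmat set \<Rightarrow> ('m, 'p, 'n) pbundle \<Rightarrow> ('m, 'p) lsec \<Rightarrow> ('m, 'p) lsec \<Rightarrow> 'm \<Rightarrow> 'n cmat" where
  "transition G P s t p = (THE g. g \<in> G \<and> snd t p = act P (snd s p) g)"

definition principal_bundle ::
    "'m::t2_space chart set \<Rightarrow> 'n::finite cmat set \<Rightarrow> ('m, 'p, 'n) pbundle \<Rightarrow> bool" where
  "principal_bundle Atl G P \<longleftrightarrow>
     (\<forall>q. act P q (mat 1) = q) \<and>
     (\<forall>q. \<forall>g\<in>G. \<forall>h\<in>G. act P (act P q g) h = act P q (g ** h)) \<and>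
     (\<forall>q. \<forall>g\<in>G. proj P (act P q g) = proj P q) \<and>
     (\<forall>q r. proj P q = proj P r \<longrightarrow> (\<exists>!g. g \<in> G \<and> r = act P q g)) \<and>
     (\<Union>s\<in>secs P. fst s) = UNIV \<and>
     (\<forall>s\<in>secs P. open (fst s) \<and> (\<forall>p\<in>fst s. proj P (snd s p) = p)) \<and>
     (\<forall>s\<in>secs P. \<forall>t\<in>secs P. \<forall>c\<in>Atl.
        smooth_on (snd c ` (fst c \<inter> fst s \<inter> fst t)) (transition G P s t \<circ> chart_inv c))"

text \<open>
  Coordinates, in the chart \<open>c\<close>, of the points over which the local section \<open>s\<close> is defined.
\<close>

definition cdom :: "'m chart \<Rightarrow> ('m, 'p) lsec \<Rightarrow> cvec set" where
  "cdom c s = snd c ` (fst c \<inter> fst s)"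

text \<open>
  A connection is given by its gauge potentials: \<open>A c s\<close> is the coordinate expression of the pullback
  along \<open>s\<close> of the connection form on the total space.
\<close>

type_synonym ('m, 'p, 'n) gauge_pot =
  "'m chart \<Rightarrow> ('m, 'p) lsec \<Rightarrow> cvec \<Rightarrow> cvec \<Rightarrow> 'n cmat"

definition connection ::
    "'m::t2_space chart set \<Rightarrow> 'n::finite cmat set \<Rightarrow> ('m, 'p, 'n) pbundle \<Rightarrow>
     ('m, 'p, 'n) gauge_pot \<Rightarrow> bool" where
  "connection Atl G P A \<longleftrightarrow>
     (\<forall>c\<in>Atl. \<forall>s\<in>secs P.
        (\<forall>x\<in>cdom c s. linear (A c s x) \<and> range (A c s x) \<subseteq> lie_algebra G) \<and>
        (\<forall>v. smooth_on (cdom c s) (\<lambda>x. A c s x v))) \<and>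
     (\<forall>c\<in>Atl. \<forall>d\<in>Atl. \<forall>s\<in>secs P. \<forall>x\<in>snd c ` (fst c \<inter> fst d \<inter> fst s). \<forall>v.
        A c s x v = A d s (chart_change c d x) (dir_deriv (chart_change c d) x v)) \<and>
     (\<forall>c\<in>Atl. \<forall>s\<in>secs P. \<forall>t\<in>secs P. \<forall>x\<in>snd c ` (fst c \<inter> fst s \<inter> fst t). \<forall>v.
        let g = transition G P s t \<circ> chart_inv c
        in A c t x v = matrix_inv (g x) ** A c s x v ** g x + matrix_inv (g x) ** dir_deriv g x v)"

text \<open>Sections of the adjoint bundle, as equivariant functions on the total space.\<close>

definition adjoint_section ::
    "'m::t2_space chart set \<Rightarrow> 'n::finite cmat set \<Rightarrow> ('m, 'p, 'n) pbundle \<Rightarrow>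
     ('p \<Rightarrow> 'n cmat) \<Rightarrow> bool" where
  "adjoint_section Atl G P \<sigma> \<longleftrightarrow>
     (\<forall>q. \<sigma> q \<in> lie_algebra G) \<and>
     (\<forall>q. \<forall>g\<in>G. \<sigma> (act P q g) = matrix_inv g ** \<sigma> q ** g) \<and>
     (\<forall>c\<in>Atl. \<forall>s\<in>secs P. smooth_on (cdom c s) (\<sigma> \<circ> snd s \<circ> chart_inv c))"

text \<open>The covariant exterior derivative on 0-forms and on 2-forms, in local coordinates.\<close>

definition dA0 :: "(cvec \<Rightarrow> cvec \<Rightarrow> 'n::finite cmat) \<Rightarrow> (cvec \<Rightarrow> 'n cmat) \<Rightarrow> cvec \<Rightarrow> cvec \<Rightarrow> 'n cmat" where
  "dA0 a f x v = dir_deriv f x v + lie_bracket (a x v) (f x)"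

definition dA2 ::
    "(cvec \<Rightarrow> cvec \<Rightarrow> 'n::finite cmat) \<Rightarrow> (cvec \<Rightarrow> cvec \<Rightarrow> cvec \<Rightarrow> 'n cmat) \<Rightarrow>
     cvec \<Rightarrow> cvec \<Rightarrow> cvec \<Rightarrow> cvec \<Rightarrow> 'n cmat" where
  "dA2 a \<beta> x u v w =
     dir_deriv (\<lambda>y. \<beta> y v w) x u + lie_bracket (a x u) (\<beta> x v w)
     + (dir_deriv (\<lambda>y. \<beta> y w u) x v + lie_bracket (a x v) (\<beta> x w u))
     + (dir_deriv (\<lambda>y. \<beta> y u v) x w + lie_bracket (a x w) (\<beta> x u v))"

definition curvature :: "(cvec \<Rightarrow> cvec \<Rightarrow> 'n::finite cmat) \<Rightarrow> cvec \<Rightarrow> cvec \<Rightarrow> cvec \<Rightarrow> 'n cmat" where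
  "curvature a x u v =
     dir_deriv (\<lambda>y. a y v) x u - dir_deriv (\<lambda>y. a y u) x v + lie_bracket (a x u) (a x v)"

text \<open>
  In even dimension the formal adjoint of the covariant exterior derivative is \<open>- \<star> d\<^sub>A \<star>\<close>.
\<close>

definition dA_adj2 ::
    "(cvec \<Rightarrow> cvec \<Rightarrow> cvec \<Rightarrow> real) \<Rightarrow> (cvec \<Rightarrow> cvec \<Rightarrow> 'n::finite cmat) \<Rightarrow>
     (cvec \<Rightarrow> cvec \<Rightarrow> cvec \<Rightarrow> 'n cmat) \<Rightarrow> cvec \<Rightarrow> cvec \<Rightarrow> 'n cmat" where
  "dA_adj2 \<omega>c a \<beta> x u = - hodge3 \<omega>c x (dA2 a (\<lambda>y. hodge2 \<omega>c y (\<beta> y)) x) u"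

definition irreducible_connection ::
    "'m::t2_space chart set \<Rightarrow> 'n::finite cmat set \<Rightarrow> ('m, 'p, 'n) pbundle \<Rightarrow>
     ('m, 'p, 'n) gauge_pot \<Rightarrow> bool" where
  "irreducible_connection Atl G P A \<longleftrightarrow>
     (\<forall>\<sigma>. adjoint_section Atl G P \<sigma> \<and>
          (\<forall>c\<in>Atl. \<forall>s\<in>secs P. \<forall>x\<in>cdom c s. \<forall>v. dA0 (A c s) (\<sigma> \<circ> snd s \<circ> chart_inv c) x v = 0)
        \<longrightarrow> (\<forall>q. \<sigma> q = 0))"

definition yang_mills ::
    "'m::t2_space chart set \<Rightarrow> ('m chart \<Rightarrow> cvec \<Rightarrow> cvec \<Rightarrow> cvec \<Rightarrow> real) \<Rightarrow>
     ('m, 'p, 'n::finite) pbundle \<Rightarrow> ('m, 'p, 'n) gauge_pot \<Rightarrow> bool" where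
  "yang_mills Atl \<omega> P A \<longleftrightarrow>
     (\<forall>c\<in>Atl. \<forall>s\<in>secs P. \<forall>x\<in>cdom c s. \<forall>u.
        dA_adj2 (\<omega> c) (A c s) (curvature (A c s)) x u = 0)"

definition anti_self_dual ::
    "'m::t2_space chart set \<Rightarrow> ('m chart \<Rightarrow> cvec \<Rightarrow> cvec \<Rightarrow> cvec \<Rightarrow> real) \<Rightarrow>
     ('m, 'p, 'n::finite) pbundle \<Rightarrow> ('m, 'p, 'n) gauge_pot \<Rightarrow> bool" where
  "anti_self_dual Atl \<omega> P A \<longleftrightarrow>
     (\<forall>c\<in>Atl. \<forall>s\<in>secs P. \<forall>x\<in>cdom c s. \<forall>u v.
        hodge2 (\<omega> c) x (curvature (A c s) x) u v = - curvature (A c s) x u v)"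


section \<open>The L2 norm of the contracted curvature\<close>

definition F_hat ::
    "('m chart \<Rightarrow> cvec \<Rightarrow> cvec \<Rightarrow> cvec \<Rightarrow> real) \<Rightarrow> ('m, 'p, 'n::finite) gauge_pot \<Rightarrow>
     'm chart \<Rightarrow> ('m, 'p) lsec \<Rightarrow> cvec \<Rightarrow> 'n cmat" where
  "F_hat \<omega> A c s x = Lambda2 (\<omega> c) x (curvature (A c s) x)"

text \<open>The trace inner product on skew-Hermitian matrices.\<close>

definition trace_inner :: "'n::finite cmat \<Rightarrow> 'n cmat \<Rightarrow> real" where
  "trace_inner X Y = - Re (trace (X ** Y))"

text \<open>The square of the pointwise norm, which depends neither on the chart nor on the local section.\<close>

definition F_hat_norm_sq ::
    "'m::t2_space chart set \<Rightarrow> ('m chart \<Rightarrow> cvec \<Rightarrow> cvec \<Rightarrow> cvec \<Rightarrow> real) \<Rightarrow>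
     ('m, 'p, 'n::finite) pbundle \<Rightarrow> ('m, 'p, 'n) gauge_pot \<Rightarrow> 'm \<Rightarrow> real" where
  "F_hat_norm_sq Atl \<omega> P A p =
     (THE r. \<exists>c\<in>Atl. \<exists>s\<in>secs P. p \<in> fst c \<inter> fst s \<and>
        r = trace_inner (F_hat \<omega> A c s (snd c p)) (F_hat \<omega> A c s (snd c p)))"

text \<open>
  The Riemannian volume measure.  In a chart its density with respect to Lebesgue measure is the
  value of the volume form on the standard basis \<open>\<partial>x\<^sub>1, \<partial>y\<^sub>1, \<partial>x\<^sub>2, \<partial>y\<^sub>2\<close>.  The chart measures
  (extended by zero) agree on the overlaps of chart domains, so their supremum in the lattice of
  measures is the measure that restricts to each of them.
\<close>

definition chart_measure ::
    "('m::t2_space chart \<Rightarrow> cvec \<Rightarrow> cvec \<Rightarrow> cvec \<Rightarrow> real) \<Rightarrow> 'm chart \<Rightarrow> 'm measure" where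
  "chart_measure \<omega> c =
     distr
       (density (restrict_space lborel (snd c ` fst c))
          (\<lambda>x. ennreal (vol_form (\<omega> c) x (axis 1 1) (axis 1 \<i>) (axis 2 1) (axis 2 \<i>))))
       borel (chart_inv c)"

definition vol_measure ::
    "'m::t2_space chart set \<Rightarrow> ('m chart \<Rightarrow> cvec \<Rightarrow> cvec \<Rightarrow> cvec \<Rightarrow> real) \<Rightarrow> 'm measure" where
  "vol_measure Atl \<omega> = (SUP c\<in>Atl. chart_measure \<omega> c)"

text \<open>The square root of \<open>\<integral> f\<close>, for a nonnegative function \<open>f\<close>, as an extended real number.\<close>

definition sqrt_integral :: "'m measure \<Rightarrow> ('m \<Rightarrow> real) \<Rightarrow> ennreal" where
  "sqrt_integral M f =
     (let I = (\<integral>\<^sup>+ p. ennreal (f p) \<partial>M)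
      in if I = \<infinity> then \<infinity> else ennreal (sqrt (enn2real I)))"

definition F_hat_L2 ::
    "'m::t2_space chart set \<Rightarrow> ('m chart \<Rightarrow> cvec \<Rightarrow> cvec \<Rightarrow> cvec \<Rightarrow> real) \<Rightarrow>
     ('m, 'p, 'n::finite) pbundle \<Rightarrow> ('m, 'p, 'n) gauge_pot \<Rightarrow> ennreal" where
  "F_hat_L2 Atl \<omega> P A = sqrt_integral (vol_measure Atl \<omega>) (F_hat_norm_sq Atl \<omega> P A)"

end

theory Submission
  imports Defs
begin

text \<open>
  Since \<open>\<delta>\<close> may depend on \<open>A\<close>, only the case where the contracted curvature vanishes
  identically matters.  Then the self-dual part of the curvature is \<open>Re (f \<theta>)\<close> for a
  section \<open>f\<close> of the complexified adjoint bundle; the Bianchi identity and the Yang-Mills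
  equation give \<open>d\<^sub>A F\<^sup>+ = 0\<close>, and as \<open>\<theta>\<close> is closed, \<open>f\<close> is covariantly holomorphic.
  By the Weitzenboeck formula, whose curvature term is a multiple of the contracted curvature,
  \<open>|f|\<^sup>2\<close> is subharmonic, hence constant by the strong maximum principle, and \<open>f\<close> is
  parallel.  Irreducibility forces \<open>f = 0\<close>.
\<close>

section \<open>Calculus\<close>

text \<open>The Laplacian never appears in Riemannian form. In holomorphic coordinates of a Kaehler
  surface it has no first-order part, so second derivatives along constant vectors v and Jv, summed
  over an orthonormal frame, do its work. The Cauchy-Riemann equations express D_v D_v + D_Jv D_Jv
  on f by a commutator of covariant derivatives, that is by F(v, Jv); Christoffel symbols enter only
  to show that \<theta> is closed. The maximum principle replaces integration by parts: it is local,
  so it runs in charts, and it asks only for a frame at each point with uniform bounds on compact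
  sets. This matters because \<open>onb\<close> is a choice made separately at each point and need
  not be continuous. For trace-free F the star is (star F)(u, v) = - F(Ju, Jv), so
  \<open>J_anti F\<close> is twice the self-dual part. Its coefficients for z = 1 and z = \<i> are
  two sections with values in the real Lie algebra, and irreducibility is applied to each. Passing
  from a vanishing L2 norm to pointwise vanishing needs continuity of the contracted curvature,
  hence a formula for it free of \<open>onb\<close>.\<close>

lemma dir_deriv_eqI: "(f has_derivative f') (at x) \<Longrightarrow> dir_deriv f x v = f' v"
  by (metis frechet_derivative_at)

lemma has_derivative_dir_deriv:
  "f differentiable (at x) \<Longrightarrow> (f has_derivative (\<lambda>v. dir_deriv f x v)) (at x)"
  using frechet_derivative_works by auto

lemma dir_deriv_cong:
  assumes "open S" "x \<in> S" "\<And>y. y \<in> S \<Longrightarrow> f y = g y"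
  shows "dir_deriv f x v = dir_deriv g x v"
proof (cases "f differentiable (at x)")
  case True
  then show ?thesis
    using frechet_derivative_transform_within_open[OF True assms(1,2)] assms(3) by metis
next
  case False
  \<comment> \<open>\<open>frechet_derivative\<close> chooses from the predicate
    \<open>has_derivative\<close>, which is the same for f and g; so the values agree even where no
    derivative exists.\<close>
  have eq: "(f has_derivative f') (at x) \<longleftrightarrow> (g has_derivative f') (at x)" for f'
    using has_derivative_transform_within_open[OF _ assms(1,2)] assms(3) by metis
  then show ?thesis
    by (simp add: frechet_derivative_def)
qed

lemma differentiable_cong_open:
  assumes "open S" "x \<in> S" "\<And>y. y \<in> S \<Longrightarrow> f y = g y" "f differentiable (at x)"
  shows "g differentiable (at x)"
  using assms has_derivative_transform_within_open unfolding differentiable_def by metis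

lemma
  assumes "f differentiable (at x)"
  shows dir_deriv_add_right: "dir_deriv f x (u + v) = dir_deriv f x u + dir_deriv f x v"
    and dir_deriv_scaleR_right: "dir_deriv f x (r *\<^sub>R v) = r *\<^sub>R dir_deriv f x v"
  using linear_frechet_derivative[OF assms]
  by (auto simp: linear_add linear_scale)

lemma dir_deriv_add:
  assumes "f differentiable (at x)" "g differentiable (at x)"
  shows "dir_deriv (\<lambda>y. f y + g y) x v = dir_deriv f x v + dir_deriv g x v"
  by (rule dir_deriv_eqI[OF has_derivative_add[OF has_derivative_dir_deriv[OF assms(1)] has_derivative_dir_deriv[OF assms(2)]]])

lemma dir_deriv_diff:
  assumes "f differentiable (at x)" "g differentiable (at x)"
  shows "dir_deriv (\<lambda>y. f y - g y) x v = dir_deriv f x v - dir_deriv g x v"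
  by (rule dir_deriv_eqI[OF has_derivative_diff[OF has_derivative_dir_deriv[OF assms(1)] has_derivative_dir_deriv[OF assms(2)]]])

lemma dir_deriv_minus:
  assumes "f differentiable (at x)"
  shows "dir_deriv (\<lambda>y. - f y) x v = - dir_deriv f x v"
  by (rule dir_deriv_eqI[OF has_derivative_minus[OF has_derivative_dir_deriv[OF assms(1)]]])

lemma (in bounded_linear) dir_deriv_image:
  assumes "g differentiable (at x)"
  shows "dir_deriv (\<lambda>y. f (g y)) x v = f (dir_deriv g x v)"
  by (rule dir_deriv_eqI[OF has_derivative[OF has_derivative_dir_deriv[OF assms]]])

lemma (in bounded_linear) differentiable_image:
  "g differentiable F \<Longrightarrow> (\<lambda>y. f (g y)) differentiable F"
  using has_derivative unfolding differentiable_def by blast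

lemma (in bounded_bilinear) dir_deriv_prod:
  assumes "f differentiable (at x)" "g differentiable (at x)"
  shows "dir_deriv (\<lambda>y. prod (f y) (g y)) x v =
    prod (f x) (dir_deriv g x v) + prod (dir_deriv f x v) (g x)"
  by (rule dir_deriv_eqI[OF FDERIV[OF has_derivative_dir_deriv[OF assms(1)] has_derivative_dir_deriv[OF assms(2)]]])

lemma (in bounded_bilinear) differentiable_prod:
  "f differentiable (at x) \<Longrightarrow> g differentiable (at x) \<Longrightarrow>
    (\<lambda>y. prod (f y) (g y)) differentiable (at x)"
  using FDERIV unfolding differentiable_def by blast

section \<open>Closure properties of k times continuously differentiable functions\<close>

lemma Ck_on_continuous: "Ck_on k S f \<Longrightarrow> continuous_on S f"
  by (cases k) (auto intro!: differentiable_imp_continuous_on differentiable_at_imp_differentiable_on)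

lemma Ck_on_pred: "Ck_on (Suc k) S f \<Longrightarrow> Ck_on k S f"
  by (induction k arbitrary: f)
    (auto intro!: differentiable_imp_continuous_on differentiable_at_imp_differentiable_on)

text \<open>On an open set, equality passes to derivatives. The closure lemmas below use this to
  replace a derivative by the formula of the sum, chain or product rule.\<close>

lemma Ck_on_cong:
  assumes "open S" "\<And>x. x \<in> S \<Longrightarrow> f x = g x" "Ck_on k S f"
  shows "Ck_on k S g"
  using assms(2,3)
proof (induction k arbitrary: f g)
  case 0
  then show ?case by (auto cong: continuous_on_cong)
next
  case (Suc k)
  have "g differentiable (at x)" if "x \<in> S" for x
    using differentiable_cong_open[OF assms(1) that] Suc.prems that by auto
  moreover have "Ck_on k S (\<lambda>x. dir_deriv g x v)" for v
  proof (rule Suc.IH)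
    show "Ck_on k S (\<lambda>x. dir_deriv f x v)" using Suc.prems by simp
    show "dir_deriv f x v = dir_deriv g x v" if "x \<in> S" for x
      using dir_deriv_cong[OF assms(1) that] Suc.prems by blast
  qed
  ultimately show ?case by simp
qed

lemma Ck_on_subset: "Ck_on k S f \<Longrightarrow> T \<subseteq> S \<Longrightarrow> Ck_on k T f"
  by (induction k arbitrary: f) (auto intro: continuous_on_subset)

lemma Ck_on_add:
  assumes "open S" "Ck_on k S f" "Ck_on k S g"
  shows "Ck_on k S (\<lambda>x. f x + g x)"
  using assms(2,3)
proof (induction k arbitrary: f g)
  case 0
  then show ?case by (auto intro: continuous_intros)
next
  case (Suc k)
  then have d: "f differentiable (at x)" "g differentiable (at x)" if "x \<in> S" for x
    using that by auto
  have "Ck_on k S (\<lambda>x. dir_deriv f x v + dir_deriv g x v)" for v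
    using Suc by auto
  then have "Ck_on k S (\<lambda>x. dir_deriv (\<lambda>x. f x + g x) x v)" for v
    by (rule Ck_on_cong[OF assms(1), rotated]) (simp add: dir_deriv_add d)
  then show ?case using d by simp
qed

lemma (in bounded_linear) Ck_on_image:
  assumes "open S" "Ck_on k S g"
  shows "Ck_on k S (\<lambda>x. f (g x))"
  using assms(2)
proof (induction k arbitrary: g)
  case 0
  then show ?case by (auto intro: continuous_on)
next
  case (Suc k)
  then have d: "g differentiable (at x)" if "x \<in> S" for x
    using that by auto
  have "Ck_on k S (\<lambda>x. f (dir_deriv g x v))" for v
    using Suc by auto
  then have "Ck_on k S (\<lambda>x. dir_deriv (\<lambda>x. f (g x)) x v)" for v
    by (rule Ck_on_cong[OF assms(1), rotated]) (simp add: dir_deriv_image d)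
  then show ?case using d by (auto intro: differentiable_image)
qed

lemma (in bounded_bilinear) Ck_on_prod:
  fixes f :: "'z::euclidean_space \<Rightarrow> 'a" and g :: "'z \<Rightarrow> 'b"
  assumes "open S" "Ck_on k S f" "Ck_on k S g"
  shows "Ck_on k S (\<lambda>x. prod (f x) (g x))"
  using assms(2,3)
proof (induction k arbitrary: f g)
  case 0
  then show ?case by (auto intro: continuous_on)
next
  case (Suc k)
  then have d: "f differentiable (at x)" "g differentiable (at x)" if "x \<in> S" for x
    using that by auto
  \<comment> \<open>Each Leibniz term pairs a derivative of class k with an undifferentiated factor
    of class k + 1, which \<open>Ck_on_pred\<close> lowers to k.\<close>
  have "Ck_on k S (\<lambda>x. prod (f x) (dir_deriv g x v) + prod (dir_deriv f x v) (g x))" for v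
    using Suc by (intro Ck_on_add assms(1) Suc.IH) (auto intro: Ck_on_pred simp del: Ck_on.simps(2), auto)
  then have "Ck_on k S (\<lambda>x. dir_deriv (\<lambda>x. prod (f x) (g x)) x v)" for v
    by (rule Ck_on_cong[OF assms(1), rotated]) (simp add: dir_deriv_prod d)
  then show ?case using d by (auto intro: differentiable_prod)
qed

lemma Ck_on_inverse:
  fixes f :: "'z::euclidean_space \<Rightarrow> 'a::real_normed_field"
  assumes "open S" "Ck_on k S f" "\<And>x. x \<in> S \<Longrightarrow> f x \<noteq> 0"
  shows "Ck_on k S (\<lambda>x. inverse (f x))"
  using assms(2)
proof (induction k)
  case 0
  then show ?case using assms(3) by (auto intro!: continuous_intros)
next
  case (Suc k)
  then have d: "f differentiable (at x)" if "x \<in> S" for x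
    using that by auto
  have h: "((\<lambda>x. inverse (f x)) has_derivative
      (\<lambda>v. - (inverse (f x) * dir_deriv f x v * inverse (f x)))) (at x)" if "x \<in> S" for x
    using Deriv.has_derivative_inverse[OF assms(3)[OF that] has_derivative_dir_deriv[OF d[OF that]]] .
  \<comment> \<open>The derivative of 1/f contains 1/f again; its regularity of order k is the
    induction hypothesis.\<close>
  have "Ck_on k S (\<lambda>x. inverse (f x))"
    using Suc Ck_on_pred by blast
  moreover have "Ck_on k S (\<lambda>x. dir_deriv f x v)" for v
    using Suc by simp
  ultimately have A: "Ck_on k S (\<lambda>x. - (inverse (f x) * dir_deriv f x v * inverse (f x)))" for v
    by (intro bounded_linear.Ck_on_image[OF bounded_linear_minus[OF bounded_linear_ident]]
        bounded_bilinear.Ck_on_prod[OF bounded_bilinear_mult] assms(1))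
  have "Ck_on k S (\<lambda>x. dir_deriv (\<lambda>x. inverse (f x)) x v)" for v
    by (rule Ck_on_cong[OF assms(1) _ A[of v]]) (simp add: dir_deriv_eqI[OF h])
  then show ?case using h by (auto simp: differentiable_def)
qed

lemma smooth_on_dir_deriv: "smooth_on S f \<Longrightarrow> smooth_on S (\<lambda>x. dir_deriv f x v)"
  unfolding smooth_on_def by (metis Ck_on.simps(2))

lemma smooth_on_differentiable: "smooth_on S f \<Longrightarrow> x \<in> S \<Longrightarrow> f differentiable (at x)"
  unfolding smooth_on_def by (metis Ck_on.simps(2))

lemma smooth_on_dir_deriv_differentiable:
  "smooth_on S f \<Longrightarrow> x \<in> S \<Longrightarrow> (\<lambda>x. dir_deriv f x v) differentiable (at x)"
  by (blast intro: smooth_on_differentiable smooth_on_dir_deriv)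

lemma smooth_on_imp_continuous_on: "smooth_on S f \<Longrightarrow> continuous_on S f"
  unfolding smooth_on_def by (metis Ck_on.simps(1))

lemma smooth_on_subset: "smooth_on S f \<Longrightarrow> T \<subseteq> S \<Longrightarrow> smooth_on T f"
  unfolding smooth_on_def by (metis Ck_on_subset)

lemma smooth_on_cong:
  "open S \<Longrightarrow> smooth_on S f \<Longrightarrow> (\<And>x. x \<in> S \<Longrightarrow> f x = g x) \<Longrightarrow> smooth_on S g"
  unfolding smooth_on_def by (metis Ck_on_cong)

lemma smooth_on_add:
  "open S \<Longrightarrow> smooth_on S f \<Longrightarrow> smooth_on S g \<Longrightarrow> smooth_on S (\<lambda>x. f x + g x)"
  unfolding smooth_on_def by (simp add: Ck_on_add)

lemma smooth_on_linear:
  "bounded_linear L \<Longrightarrow> open S \<Longrightarrow> smooth_on S f \<Longrightarrow> smooth_on S (\<lambda>x. L (f x))"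
  unfolding smooth_on_def by (simp add: bounded_linear.Ck_on_image)

lemma smooth_on_prod:
  "bounded_bilinear B \<Longrightarrow> open S \<Longrightarrow> smooth_on S f \<Longrightarrow> smooth_on S g \<Longrightarrow>
    smooth_on S (\<lambda>x. B (f x) (g x))"
  unfolding smooth_on_def by (simp add: bounded_bilinear.Ck_on_prod)

lemma smooth_on_minus: "open S \<Longrightarrow> smooth_on S f \<Longrightarrow> smooth_on S (\<lambda>x. - f x)"
  by (rule smooth_on_linear[OF bounded_linear_minus[OF bounded_linear_ident]])

lemma smooth_on_diff:
  "open S \<Longrightarrow> smooth_on S f \<Longrightarrow> smooth_on S g \<Longrightarrow> smooth_on S (\<lambda>x. f x - g x)"
  using smooth_on_add[OF _ _ smooth_on_minus, of S f g] by simp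

lemma smooth_on_inverse:
  fixes f :: "'z::euclidean_space \<Rightarrow> 'a::real_normed_field"
  shows "open S \<Longrightarrow> smooth_on S f \<Longrightarrow> (\<And>x. x \<in> S \<Longrightarrow> f x \<noteq> 0) \<Longrightarrow> smooth_on S (\<lambda>x. inverse (f x))"
  unfolding smooth_on_def by (simp add: Ck_on_inverse)

section \<open>Derivatives along lines and the symmetry of second derivatives\<close>

lemma has_real_derivative_along_line:
  fixes f :: "'a::euclidean_space \<Rightarrow> real"
  assumes "f differentiable (at (x + t *\<^sub>R v))"
  shows "((\<lambda>t. f (x + t *\<^sub>R v)) has_real_derivative dir_deriv f (x + t *\<^sub>R v) v) (at t)"
proof -
  have "((\<lambda>t. x + t *\<^sub>R v) has_derivative (\<lambda>h. h *\<^sub>R v)) (at t)"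
    by (auto intro!: derivative_eq_intros)
  from diff_chain_at[OF this has_derivative_dir_deriv[OF assms]]
  have "((\<lambda>t. f (x + t *\<^sub>R v)) has_derivative (\<lambda>h. dir_deriv f (x + t *\<^sub>R v) (h *\<^sub>R v))) (at t)"
    by (simp add: o_def)
  moreover have "(\<lambda>h. dir_deriv f (x + t *\<^sub>R v) (h *\<^sub>R v)) = (*) (dir_deriv f (x + t *\<^sub>R v) v)"
    by (auto simp: dir_deriv_scaleR_right[OF assms] mult.commute)
  ultimately show ?thesis
    by (simp add: has_field_derivative_def)
qed

text \<open>The mean value theorem is applied to f(x + hv + su) - f(x + su) in s, and to the
  resulting derivative in direction v. The second difference is symmetric in u and v, so both orders
  of differentiation can be compared with it.\<close>

lemma second_difference_mean_value:
  fixes f :: "'a::euclidean_space \<Rightarrow> real"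
  assumes S: "\<And>s t. 0 \<le> s \<Longrightarrow> s \<le> h \<Longrightarrow> 0 \<le> t \<Longrightarrow> t \<le> h \<Longrightarrow> x + s *\<^sub>R u + t *\<^sub>R v \<in> S"
    and f: "Ck_on 2 S f" and h: "h > 0"
  shows "\<exists>s t. 0 \<le> s \<and> s \<le> h \<and> 0 \<le> t \<and> t \<le> h \<and>
    f (x + h *\<^sub>R u + h *\<^sub>R v) - f (x + h *\<^sub>R u) - f (x + h *\<^sub>R v) + f x =
      h * h * dir_deriv (\<lambda>y. dir_deriv f y u) (x + s *\<^sub>R u + t *\<^sub>R v) v"
proof -
  have df: "f differentiable (at y)" if "y \<in> S" for y
    using f that by (simp add: numeral_2_eq_2)
  have df2: "(\<lambda>y. dir_deriv f y u) differentiable (at y)" if "y \<in> S" for y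
    using f that by (simp add: numeral_2_eq_2)
  have "((\<lambda>s. f (x + h *\<^sub>R v + s *\<^sub>R u) - f (x + s *\<^sub>R u)) has_real_derivative
      dir_deriv f (x + h *\<^sub>R v + s *\<^sub>R u) u - dir_deriv f (x + s *\<^sub>R u) u) (at s)"
    if "0 \<le> s" "s \<le> h" for s
    using S[of s h] S[of s 0] that h
    by (intro DERIV_diff has_real_derivative_along_line df) (auto simp: algebra_simps)
  from MVT2[OF h this] obtain s where s: "0 < s" "s < h"
    "(f (x + h *\<^sub>R v + h *\<^sub>R u) - f (x + h *\<^sub>R u)) - (f (x + h *\<^sub>R v + 0 *\<^sub>R u) - f (x + 0 *\<^sub>R u)) =
      h * (dir_deriv f (x + h *\<^sub>R v + s *\<^sub>R u) u - dir_deriv f (x + s *\<^sub>R u) u)"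
    by auto
  have "((\<lambda>t. dir_deriv f (x + s *\<^sub>R u + t *\<^sub>R v) u) has_real_derivative
      dir_deriv (\<lambda>y. dir_deriv f y u) (x + s *\<^sub>R u + t *\<^sub>R v) v) (at t)"
    if "0 \<le> t" "t \<le> h" for t
    using S[of s t] that h s
    by (intro has_real_derivative_along_line[where f="\<lambda>y. dir_deriv f y u"] df2) (auto simp: algebra_simps)
  from MVT2[OF h this] obtain t where t: "0 < t" "t < h"
    "dir_deriv f (x + s *\<^sub>R u + h *\<^sub>R v) u - dir_deriv f (x + s *\<^sub>R u + 0 *\<^sub>R v) u =
      h * dir_deriv (\<lambda>y. dir_deriv f y u) (x + s *\<^sub>R u + t *\<^sub>R v) v"
    by auto
  show ?thesis
  proof (intro exI conjI)
    show "f (x + h *\<^sub>R u + h *\<^sub>R v) - f (x + h *\<^sub>R u) - f (x + h *\<^sub>R v) + f x =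
      h * h * dir_deriv (\<lambda>y. dir_deriv f y u) (x + s *\<^sub>R u + t *\<^sub>R v) v"
      using s(3) t(3) by (simp add: algebra_simps)
  qed (use s t in auto)
qed

lemma second_deriv_symmetric_real:
  fixes f :: "'a::euclidean_space \<Rightarrow> real"
  assumes "open S" "x \<in> S" and f: "Ck_on 2 S f"
  shows "dir_deriv (\<lambda>y. dir_deriv f y u) x v = dir_deriv (\<lambda>y. dir_deriv f y v) x u"
proof (rule ccontr)
  define P where "P = (\<lambda>z. dir_deriv (\<lambda>y. dir_deriv f y u) z v)"
  define Q where "Q = (\<lambda>z. dir_deriv (\<lambda>y. dir_deriv f y v) z u)"
  assume "\<not> ?thesis"
  then have "P x \<noteq> Q x" by (simp add: P_def Q_def)
  \<comment> \<open>Half of the gap: a number within e of \<open>P x\<close> cannot also be within e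
    of \<open>Q x\<close>.\<close>
  define e where "e = \<bar>P x - Q x\<bar> / 2"
  have "e > 0" using \<open>P x \<noteq> Q x\<close> by (simp add: e_def)
  have "continuous_on S P" "continuous_on S Q"
    using f by (auto simp: P_def Q_def numeral_2_eq_2)
  then have "isCont P x" "isCont Q x"
    using assms by (auto simp: continuous_on_eq_continuous_at)
  then obtain d1 d2 where d: "d1 > 0" "\<And>y. dist y x < d1 \<Longrightarrow> dist (P y) (P x) < e"
      "d2 > 0" "\<And>y. dist y x < d2 \<Longrightarrow> dist (Q y) (Q x) < e"
    using \<open>e > 0\<close> unfolding continuous_at_eps_delta by metis
  obtain d3 where d3: "d3 > 0" "ball x d3 \<subseteq> S"
    using assms open_contains_ball by blast
  define r where "r = min d3 (min d1 d2)"
  \<comment> \<open>Any point of the parallelogram lies within h (|u| + |v|) < r of x; the summand 1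
    covers u = v = 0.\<close>
  define h where "h = r / (2 * (norm u + norm v + 1))"
  have r: "r > 0" using d d3 by (simp add: r_def)
  have pos: "norm u + norm v + 1 > 0" by (smt (verit) norm_ge_zero)
  have h: "h > 0" using r pos by (simp add: h_def)
  have near: "dist (x + s *\<^sub>R u' + t *\<^sub>R v') x < r"
    if "0 \<le> s" "s \<le> h" "0 \<le> t" "t \<le> h" "u' = u \<and> v' = v \<or> u' = v \<and> v' = u" for s t u' v'
  proof -
    have "dist (x + s *\<^sub>R u' + t *\<^sub>R v') x = norm (s *\<^sub>R u' + t *\<^sub>R v')"
      by (simp add: dist_norm algebra_simps)
    also have "\<dots> \<le> s * norm u' + t * norm v'"
      using norm_triangle_ineq[of "s *\<^sub>R u'" "t *\<^sub>R v'"] that by simp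
    also have "\<dots> \<le> h * norm u' + h * norm v'"
      using that by (intro add_mono mult_right_mono) auto
    also have "\<dots> < h * (2 * (norm u + norm v + 1))"
    proof -
      have "h * norm u' + h * norm v' = h * (norm u + norm v)"
        using that(5) by (auto simp: algebra_simps)
      moreover have "norm u + norm v < 2 * (norm u + norm v + 1)"
        using pos by simp
      ultimately show ?thesis using h by simp
    qed
    also have "\<dots> = r" using pos by (simp add: h_def)
    finally show ?thesis .
  qed
  have inS: "x + s *\<^sub>R u' + t *\<^sub>R v' \<in> S"
    if "0 \<le> s" "s \<le> h" "0 \<le> t" "t \<le> h" "u' = u \<and> v' = v \<or> u' = v \<and> v' = u" for s t u' v'
    using near[OF that] d3 by (auto simp: r_def dist_commute)
  obtain s t where 1: "0 \<le> s" "s \<le> h" "0 \<le> t" "t \<le> h"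
    "f (x + h *\<^sub>R u + h *\<^sub>R v) - f (x + h *\<^sub>R u) - f (x + h *\<^sub>R v) + f x =
      h * h * P (x + s *\<^sub>R u + t *\<^sub>R v)"
    using second_difference_mean_value[OF inS f h] unfolding P_def by blast
  obtain s' t' where 2: "0 \<le> s'" "s' \<le> h" "0 \<le> t'" "t' \<le> h"
    "f (x + h *\<^sub>R v + h *\<^sub>R u) - f (x + h *\<^sub>R v) - f (x + h *\<^sub>R u) + f x =
      h * h * Q (x + s' *\<^sub>R v + t' *\<^sub>R u)"
    using second_difference_mean_value[OF inS f h, where u=v and v=u] unfolding Q_def by blast
  have "h * h * P (x + s *\<^sub>R u + t *\<^sub>R v) = h * h * Q (x + s' *\<^sub>R v + t' *\<^sub>R u)"
    using 1(5) 2(5) by (simp add: algebra_simps)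
  then have "P (x + s *\<^sub>R u + t *\<^sub>R v) = Q (x + s' *\<^sub>R v + t' *\<^sub>R u)"
    using h by simp
  moreover have "dist (P (x + s *\<^sub>R u + t *\<^sub>R v)) (P x) < e"
    using near[OF 1(1-4)] d by (simp add: r_def)
  moreover have "dist (Q (x + s' *\<^sub>R v + t' *\<^sub>R u)) (Q x) < e"
    using near[OF 2(1-4)] d by (simp add: r_def)
  ultimately show False
    by (simp add: e_def dist_real_def field_simps abs_if split: if_splits)
qed

lemma second_deriv_symmetric:
  fixes f :: "'a::euclidean_space \<Rightarrow> 'b::euclidean_space"
  assumes S: "open S" "x \<in> S" and f: "smooth_on S f"
  shows "dir_deriv (\<lambda>y. dir_deriv f y u) x v = dir_deriv (\<lambda>y. dir_deriv f y v) x u"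
proof (rule euclidean_eqI)
  fix b :: 'b assume "b \<in> Basis"
  have bl: "bounded_linear (\<lambda>z::'b. z \<bullet> b)" by (rule bounded_linear_inner_left)
  have 1: "dir_deriv (\<lambda>y. dir_deriv f y u) x v \<bullet> b =
      dir_deriv (\<lambda>y. dir_deriv (\<lambda>z. f z \<bullet> b) y u) x v" for u v
  proof -
    have "dir_deriv (\<lambda>y. dir_deriv f y u \<bullet> b) x v = dir_deriv (\<lambda>y. dir_deriv f y u) x v \<bullet> b"
      by (rule bounded_linear.dir_deriv_image[OF bl])
        (rule smooth_on_dir_deriv_differentiable[OF f S(2)])
    moreover have "dir_deriv (\<lambda>y. dir_deriv f y u \<bullet> b) x v =
        dir_deriv (\<lambda>y. dir_deriv (\<lambda>z. f z \<bullet> b) y u) x v"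
      by (rule dir_deriv_cong[OF S])
        (rule bounded_linear.dir_deriv_image[OF bl smooth_on_differentiable[OF f], symmetric])
    ultimately show ?thesis by simp
  qed
  have "Ck_on 2 S (\<lambda>z. f z \<bullet> b)"
    using smooth_on_linear[OF bl S(1) f] by (simp add: smooth_on_def)
  from second_deriv_symmetric_real[OF S this] show
    "dir_deriv (\<lambda>y. dir_deriv f y u) x v \<bullet> b = dir_deriv (\<lambda>y. dir_deriv f y v) x u \<bullet> b"
    unfolding 1 .
qed

section \<open>The strong maximum principle\<close>

text \<open>Along the line h(t) = W(z + tv) one has h'(0) = 0. A positive second derivative would
  make h' positive just to the right of 0, and h would rise above its maximum.\<close>

lemma second_deriv_nonpos_at_max:
  fixes W :: "'a::euclidean_space \<Rightarrow> real"
  assumes S: "open S" "z \<in> S" and dW: "\<And>y. y \<in> S \<Longrightarrow> W differentiable (at y)"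
    and d2W: "(\<lambda>y. dir_deriv W y v) differentiable (at z)"
    and max: "\<And>y. y \<in> S \<Longrightarrow> W y \<le> W z"
  shows "dir_deriv (\<lambda>y. dir_deriv W y v) z v \<le> 0"
proof (rule ccontr)
  assume "\<not> ?thesis"
  then have pos: "dir_deriv (\<lambda>y. dir_deriv W y v) z v > 0" by simp
  obtain r where r: "r > 0" "ball z r \<subseteq> S"
    using S open_contains_ball by blast
  define d where "d = r / (norm v + 1)"
  have nv: "norm v + 1 > 0" by (smt (verit) norm_ge_zero)
  have d: "d > 0" using r nv by (simp add: d_def)
  have inS: "z + t *\<^sub>R v \<in> S" if "\<bar>t\<bar> < d" for t
  proof -
    have "\<bar>t\<bar> * norm v \<le> \<bar>t\<bar> * (norm v + 1)" by (simp add: algebra_simps)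
    also have "\<dots> < r" using that nv by (simp add: d_def field_simps)
    finally have "z + t *\<^sub>R v \<in> ball z r" by (simp add: dist_norm)
    then show ?thesis using r by blast
  qed
  define h where "h = (\<lambda>t. W (z + t *\<^sub>R v))"
  define h' where "h' = (\<lambda>t. dir_deriv W (z + t *\<^sub>R v) v)"
  have h: "(h has_real_derivative h' t) (at t)" if "\<bar>t\<bar> < d" for t
    unfolding h_def h'_def by (rule has_real_derivative_along_line) (rule dW[OF inS[OF that]])
  have "h' 0 = 0"
    by (rule DERIV_local_max[OF h d]) (use d max inS in \<open>auto simp: h_def\<close>)
  have "(h' has_real_derivative dir_deriv (\<lambda>y. dir_deriv W y v) z v) (at 0)"
    unfolding h'_def using has_real_derivative_along_line[of "\<lambda>y. dir_deriv W y v" z 0 v] d2W by simp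
  from DERIV_pos_inc_right[OF this pos] obtain d' where
    d': "d' > 0" "\<And>k. 0 < k \<Longrightarrow> k < d' \<Longrightarrow> h' 0 < h' k"
    by auto
  define k where "k = min d d' / 2"
  have k: "0 < k" "k < d" "k < d'" using d d' by (auto simp: k_def)
  have "\<exists>\<xi>>0. \<xi> < k \<and> h k - h 0 = (k - 0) * h' \<xi>"
    by (rule MVT2[OF k(1)]) (use h k in auto)
  then obtain \<xi> where \<xi>: "0 < \<xi>" "\<xi> < k" "h k - h 0 = k * h' \<xi>" by auto
  have "h' \<xi> > 0" using d'(2)[of \<xi>] \<xi> k \<open>h' 0 = 0\<close> by auto
  then have "h k > h 0" using \<xi> k by (smt (verit) mult_pos_pos)
  moreover have "h k \<le> h 0" using max[OF inS[of k]] k by (simp add: h_def)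
  ultimately show False by simp
qed

lemma gaussian_dir_deriv:
  fixes c :: "'a::euclidean_space" and \<alpha> :: real
  assumes \<beta>_def: "\<beta> = (\<lambda>x. exp (- \<alpha> * ((x - c) \<bullet> (x - c))))"
  shows "\<beta> differentiable (at x)"
    and "dir_deriv \<beta> x v = - 2 * \<alpha> * ((x - c) \<bullet> v) * \<beta> x"
    and "(\<lambda>y. dir_deriv \<beta> y v) differentiable (at x)"
    and "dir_deriv (\<lambda>y. dir_deriv \<beta> y v) x v =
      (4 * \<alpha>\<^sup>2 * ((x - c) \<bullet> v)\<^sup>2 - 2 * \<alpha> * (v \<bullet> v)) * \<beta> x"
proof -
  have 1: "(\<beta> has_derivative (\<lambda>v. - 2 * \<alpha> * ((x - c) \<bullet> v) * \<beta> x)) (at x)" for x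
    unfolding \<beta>_def
    by (auto intro!: derivative_eq_intros simp: inner_commute algebra_simps)
  then show "\<beta> differentiable (at x)" by (auto simp: differentiable_def)
  have 2: "dir_deriv \<beta> x v = - 2 * \<alpha> * ((x - c) \<bullet> v) * \<beta> x" for x
    by (rule dir_deriv_eqI[OF 1])
  then show "dir_deriv \<beta> x v = - 2 * \<alpha> * ((x - c) \<bullet> v) * \<beta> x" .
  have 3: "((\<lambda>y. dir_deriv \<beta> y v) has_derivative
      (\<lambda>w. - 2 * \<alpha> * ((x - c) \<bullet> v) * (- 2 * \<alpha> * ((x - c) \<bullet> w) * \<beta> x) + (- 2 * \<alpha> * (w \<bullet> v)) * \<beta> x)) (at x)"
    unfolding 2
    by (rule has_derivative_mult[OF _ 1]) (auto intro!: derivative_eq_intros)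
  then show "(\<lambda>y. dir_deriv \<beta> y v) differentiable (at x)" by (auto simp: differentiable_def)
  show "dir_deriv (\<lambda>y. dir_deriv \<beta> y v) x v =
      (4 * \<alpha>\<^sup>2 * ((x - c) \<bullet> v)\<^sup>2 - 2 * \<alpha> * (v \<bullet> v)) * \<beta> x"
    unfolding dir_deriv_eqI[OF 3] by (simp add: power2_eq_square algebra_simps)
qed

text \<open>
  The barrier is \<open>exp (- \<alpha> |x - y'|\<^sup>2)\<close>, centred in a ball that touches the set where the
  maximum is attained at the single point \<open>z\<close>: added to \<open>w\<close>, it would produce an interior maximum
  at which the elliptic operator is positive.
\<close>

lemma strong_maximum_principle:
  fixes w :: "'a::euclidean_space \<Rightarrow> real" and e :: "'a \<Rightarrow> 'i \<Rightarrow> 'a"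
  assumes S: "open S" and w: "Ck_on 2 S w" and x0: "x0 \<in> S"
    and subharmonic: "\<And>x. x \<in> S \<Longrightarrow> 0 \<le> (\<Sum>i\<in>I. dir_deriv (\<lambda>y. dir_deriv w y (e x i)) x (e x i))"
    and elliptic: "\<And>K. compact K \<Longrightarrow> K \<subseteq> S \<Longrightarrow> \<exists>m>0. \<exists>B. \<forall>x\<in>K.
        (\<forall>\<xi>. m * (\<xi> \<bullet> \<xi>) \<le> (\<Sum>i\<in>I. (\<xi> \<bullet> e x i)\<^sup>2)) \<and> (\<Sum>i\<in>I. e x i \<bullet> e x i) \<le> B"
    and max: "\<And>x. x \<in> S \<Longrightarrow> w x \<le> w x0"
  shows "\<exists>r>0. \<forall>x\<in>ball x0 r. w x = w x0"
proof -
  define M where "M = w x0"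
  obtain R where "R > 0" "cball x0 R \<subseteq> S"
    using S x0 open_contains_cball by blast
  \<comment> \<open>The quarter leaves room: y is within r of x0, the contact set K within 2r, and
    the small ball D around a point of K still lies within 4r.\<close>
  define r where "r = R / 4"
  have r: "r > 0" "cball x0 (4 * r) \<subseteq> S" using \<open>R > 0\<close> \<open>cball x0 R \<subseteq> S\<close> by (auto simp: r_def)
  have dw: "w differentiable (at x)" "(\<lambda>y. dir_deriv w y v) differentiable (at x)" if "x \<in> S" for x v
    using w that by (auto simp: numeral_2_eq_2)
  have cw: "continuous_on S w" using w Ck_on_continuous by blast
  have False if y: "y \<in> ball x0 r" and wy: "w y \<noteq> M" for y
  proof -
    define K where "K = {x \<in> cball x0 (2 * r). w x = M}"
    have K: "compact K"
    proof -
      have "continuous_on (cball x0 (2 * r)) w"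
        using r by (intro continuous_on_subset[OF cw]) auto
      then have "closed (cball x0 (2 * r) \<inter> w -` {M})"
        by (intro continuous_closed_preimage) auto
      moreover have "K = cball x0 (2 * r) \<inter> w -` {M}" by (auto simp: K_def)
      ultimately show ?thesis
        by (metis bounded_Int bounded_cball compact_eq_bounded_closed)
    qed
    have "x0 \<in> K" using r by (simp add: K_def M_def)
    \<comment> \<open>z is a point of the maximum set nearest to y, so the open ball around y
      through z contains no maximum point.\<close>
    then obtain z where z: "z \<in> K" "\<And>x. x \<in> K \<Longrightarrow> dist y z \<le> dist y x"
      using distance_attains_inf[OF compact_imp_closed[OF K], of y] by auto
    define \<rho> where "\<rho> = dist y z / 2"
    have \<rho>: "\<rho> > 0" using z(1) wy by (auto simp: \<rho>_def K_def)
    have \<rho>r: "2 * \<rho> < r" using z(2)[OF \<open>x0 \<in> K\<close>] y by (auto simp: \<rho>_def dist_commute)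
    have inside: "w x < M" if "dist y x < 2 * \<rho>" for x
    proof -
      have "dist x0 x < 2 * r"
        using that y \<rho>r dist_triangle[of x0 x y] by auto
      then have "x \<in> cball x0 (2 * r)" by simp
      moreover have "x \<notin> K" using z(2)[of x] that by (auto simp: \<rho>_def)
      ultimately have "w x \<noteq> M" by (simp add: K_def)
      moreover have "x \<in> S" using \<open>x \<in> cball x0 (2 * r)\<close> r by auto
      ultimately show ?thesis using max[of x] by (simp add: M_def)
    qed
    \<comment> \<open>The ball of half the size, centred at the midpoint, touches the larger sphere
      only at z. Hence w < M on this closed ball except at z.\<close>
    define y' where "y' = midpoint y z"
    define b where "b = z - y'"
    have yb: "y' - y = b" by (simp add: b_def y'_def midpoint_def algebra_simps flip: scaleR_2)
    have nb: "norm b = \<rho>"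
      by (simp add: b_def y'_def \<rho>_def dist_commute dist_midpoint flip: dist_norm)
    have touch: "w x < M" if "dist x y' \<le> \<rho>" "x \<noteq> z" for x
    proof -
      define a where "a = x - y'"
      have "norm a \<le> \<rho>" using that by (simp add: a_def dist_norm)
      then have aa: "a \<bullet> a \<le> \<rho>\<^sup>2" by (simp add: power_mono flip: power2_norm_eq_inner)
      have bb: "b \<bullet> b = \<rho>\<^sup>2" using nb by (simp flip: power2_norm_eq_inner)
      have "a - b \<noteq> 0" using that by (simp add: a_def b_def)
      then have "(a - b) \<bullet> (a - b) > 0" by simp
      \<comment> \<open>Parallelogram law: a and b are distinct vectors of length at most \<rho>, so
        their sum is shorter than 2\<rho>.\<close>
      moreover have "(a + b) \<bullet> (a + b) + (a - b) \<bullet> (a - b) = 2 * (a \<bullet> a) + 2 * (b \<bullet> b)"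
        by (simp add: algebra_simps inner_commute)
      ultimately have "(a + b) \<bullet> (a + b) < 4 * \<rho>\<^sup>2"
        using aa bb by linarith
      then have "(norm (a + b))\<^sup>2 < (2 * \<rho>)\<^sup>2"
        by (simp add: power2_norm_eq_inner power_mult_distrib)
      then have "norm (a + b) < 2 * \<rho>"
        by (rule power2_less_imp_less) (use \<rho> in simp)
      moreover have "a + b = x - y" by (simp add: a_def flip: yb)
      ultimately show ?thesis using inside[of x] by (simp add: dist_norm norm_minus_commute)
    qed
    \<comment> \<open>The radius \<rho>/2 keeps D at distance at least \<rho>/2 from the centre y',
      where the second derivatives of the Gaussian would have the wrong sign.\<close>
    define D where "D = cball z (\<rho> / 2)"
    have DS: "D \<subseteq> S"
    proof
      fix x assume "x \<in> D"
      then have "dist x0 x \<le> 2 * r + \<rho> / 2"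
        using z(1) dist_triangle[of x0 x z] by (auto simp: D_def K_def)
      then show "x \<in> S" using r \<rho>r \<rho> by auto
    qed
    have "compact D" by (simp add: D_def)
    obtain m B where m: "m > 0" and
        ell: "\<And>x \<xi>. x \<in> D \<Longrightarrow> m * (\<xi> \<bullet> \<xi>) \<le> (\<Sum>i\<in>I. (\<xi> \<bullet> e x i)\<^sup>2)"
             "\<And>x. x \<in> D \<Longrightarrow> (\<Sum>i\<in>I. e x i \<bullet> e x i) \<le> B"
      using elliptic[OF \<open>compact D\<close> DS] by blast
    define \<alpha> where "\<alpha> = (2 * \<bar>B\<bar> + 1) / (m * \<rho>\<^sup>2)"
    have \<alpha>: "\<alpha> > 0" using m \<rho> by (auto simp: \<alpha>_def intro!: divide_pos_pos)
    define \<beta> where "\<beta> = (\<lambda>x. exp (- \<alpha> * ((x - y') \<bullet> (x - y'))))"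
    have \<beta>pos: "\<beta> x > 0" for x by (simp add: \<beta>_def)
    have "\<beta> x \<le> 1" for x using \<alpha> by (simp add: \<beta>_def)
    note \<beta> = gaussian_dir_deriv[OF \<beta>_def]
    have barrier: "(\<Sum>i\<in>I. dir_deriv (\<lambda>y. dir_deriv \<beta> y (e x i)) x (e x i)) > 0" if "x \<in> D" for x
    proof -
      have "\<rho> \<le> dist z x + norm (x - y')"
        using dist_triangle[of z y' x] nb by (simp add: b_def dist_norm)
      then have "\<rho> / 2 \<le> norm (x - y')" using that by (simp add: D_def)
      then have "(\<rho> / 2)\<^sup>2 \<le> (norm (x - y'))\<^sup>2" using \<rho> by (intro power_mono) auto
      then have 1: "\<rho>\<^sup>2 / 4 \<le> (x - y') \<bullet> (x - y')" by (simp add: power2_norm_eq_inner power_divide)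
      have "4 * \<alpha>\<^sup>2 * (m * (\<rho>\<^sup>2 / 4)) \<le> 4 * \<alpha>\<^sup>2 * (m * ((x - y') \<bullet> (x - y')))"
        using 1 m by (intro mult_left_mono) auto
      also have "\<dots> \<le> 4 * \<alpha>\<^sup>2 * (\<Sum>i\<in>I. ((x - y') \<bullet> e x i)\<^sup>2)"
        using ell(1)[OF that, of "x - y'"] by (intro mult_left_mono) auto
      finally have "4 * \<alpha>\<^sup>2 * (m * (\<rho>\<^sup>2 / 4)) \<le> 4 * \<alpha>\<^sup>2 * (\<Sum>i\<in>I. ((x - y') \<bullet> e x i)\<^sup>2)" .
      moreover have "4 * \<alpha>\<^sup>2 * (m * (\<rho>\<^sup>2 / 4)) = \<alpha> * (\<alpha> * (m * \<rho>\<^sup>2))"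
        by (simp add: power2_eq_square)
      moreover have "\<alpha> * (m * \<rho>\<^sup>2) = 2 * \<bar>B\<bar> + 1" using m \<rho> by (simp add: \<alpha>_def)
      ultimately have 2: "2 * \<alpha> * \<bar>B\<bar> + \<alpha> \<le> 4 * \<alpha>\<^sup>2 * (\<Sum>i\<in>I. ((x - y') \<bullet> e x i)\<^sup>2)"
        by (simp only: distrib_left)
      have "2 * \<alpha> * (\<Sum>i\<in>I. e x i \<bullet> e x i) \<le> 2 * \<alpha> * \<bar>B\<bar>"
        using ell(2)[OF that] \<alpha> by (intro mult_left_mono) auto
      then have "4 * \<alpha>\<^sup>2 * (\<Sum>i\<in>I. ((x - y') \<bullet> e x i)\<^sup>2) - 2 * \<alpha> * (\<Sum>i\<in>I. e x i \<bullet> e x i) > 0"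
        using 2 \<alpha> by linarith
      moreover have "(\<Sum>i\<in>I. dir_deriv (\<lambda>y. dir_deriv \<beta> y (e x i)) x (e x i)) =
          (4 * \<alpha>\<^sup>2 * (\<Sum>i\<in>I. ((x - y') \<bullet> e x i)\<^sup>2) - 2 * \<alpha> * (\<Sum>i\<in>I. e x i \<bullet> e x i)) * \<beta> x"
        unfolding \<beta>(4)
        by (simp add: sum_distrib_left sum_distrib_right sum_subtractf left_diff_distrib mult.assoc)
      ultimately show ?thesis using \<beta>pos[of x] by simp
    qed
    \<comment> \<open>T is the part of the boundary of D where the barrier may exceed its value at
      z. It is compact and avoids z, so w stays below M there by a fixed margin.\<close>
    define T where "T = sphere z (\<rho> / 2) \<inter> cball y' \<rho>"
    have TD: "T \<subseteq> D" by (auto simp: T_def D_def)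
    have "\<exists>\<epsilon>>0. \<forall>x\<in>T. w x + \<epsilon> < M"
    proof (cases "T = {}")
      case True
      then show ?thesis by (auto intro: exI[of _ 1])
    next
      case False
      have "compact T" by (simp add: T_def compact_Int)
      moreover have "continuous_on T w" using cw TD DS continuous_on_subset by blast
      ultimately obtain q where q: "q \<in> T" "\<And>x. x \<in> T \<Longrightarrow> w x \<le> w q"
        using continuous_attains_sup[OF _ False] by blast
      have "w q < M" using q \<rho> by (intro touch) (auto simp: T_def dist_commute)
      then show ?thesis using q by (intro exI[of _ "(M - w q) / 2"]) (force simp: field_simps)
    qed
    then obtain \<epsilon> where \<epsilon>: "\<epsilon> > 0" "\<And>x. x \<in> T \<Longrightarrow> w x + \<epsilon> < M" by blast
    \<comment> \<open>Normalised so that W z = M, which makes the maximum of W over D at least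
      M.\<close>
    define W where "W = (\<lambda>x. w x + (\<epsilon> * \<beta> x - \<epsilon> * \<beta> z))"
    have d\<beta>: "(\<lambda>x. \<epsilon> * \<beta> x - \<epsilon> * \<beta> z) differentiable (at x)" for x
      by (intro differentiable_diff differentiable_mult differentiable_const \<beta>)
    have dd\<beta>: "dir_deriv (\<lambda>x. \<epsilon> * \<beta> x - \<epsilon> * \<beta> z) x v = \<epsilon> * dir_deriv \<beta> x v" for x v
      by (rule dir_deriv_eqI)
        (auto intro!: derivative_eq_intros has_derivative_dir_deriv \<beta>)
    have dW: "W differentiable (at x)" "dir_deriv W x v = dir_deriv w x v + \<epsilon> * dir_deriv \<beta> x v"
      if "x \<in> S" for x v
      unfolding W_def
      by (auto intro!: differentiable_add dw that d\<beta> simp: dir_deriv_add[OF dw(1)[OF that] d\<beta>] dd\<beta>)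
    have d2\<beta>: "(\<lambda>x. \<epsilon> * dir_deriv \<beta> x v) differentiable (at x)"
      "dir_deriv (\<lambda>x. \<epsilon> * dir_deriv \<beta> x v) x v = \<epsilon> * dir_deriv (\<lambda>x. dir_deriv \<beta> x v) x v" for x v
      using \<beta>(3) by (auto intro!: bounded_linear.differentiable_image[OF bounded_linear_mult_right]
          bounded_linear.dir_deriv_image[OF bounded_linear_mult_right])
    have d2W: "(\<lambda>y. dir_deriv W y v) differentiable (at x)"
      "dir_deriv (\<lambda>y. dir_deriv W y v) x v =
        dir_deriv (\<lambda>y. dir_deriv w y v) x v + \<epsilon> * dir_deriv (\<lambda>y. dir_deriv \<beta> y v) x v"
      if "x \<in> S" for x v
    proof -
      have "(\<lambda>y. dir_deriv w y v + \<epsilon> * dir_deriv \<beta> y v) differentiable (at x)"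
        by (intro differentiable_add dw that d2\<beta>)
      then show "(\<lambda>y. dir_deriv W y v) differentiable (at x)"
        by (rule differentiable_cong_open[OF S that, rotated]) (simp add: dW)
      have "dir_deriv (\<lambda>y. dir_deriv W y v) x v =
          dir_deriv (\<lambda>y. dir_deriv w y v + \<epsilon> * dir_deriv \<beta> y v) x v"
        by (rule dir_deriv_cong[OF S that]) (simp add: dW)
      then show "dir_deriv (\<lambda>y. dir_deriv W y v) x v =
        dir_deriv (\<lambda>y. dir_deriv w y v) x v + \<epsilon> * dir_deriv (\<lambda>y. dir_deriv \<beta> y v) x v"
        by (simp add: dir_deriv_add[OF dw(2)[OF that] d2\<beta>(1)] d2\<beta>(2))
    qed
    have "continuous_on D W"
      using dW DS by (auto intro!: differentiable_imp_continuous_on differentiable_at_imp_differentiable_on)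
    then obtain z1 where z1: "z1 \<in> D" "\<And>x. x \<in> D \<Longrightarrow> W x \<le> W z1"
      using continuous_attains_sup[OF \<open>compact D\<close>, of W] \<rho> by (auto simp: D_def)
    have "W z = M" using z(1) by (simp add: W_def K_def)
    then have "W z1 \<ge> M" using z1(2)[of z] \<rho> by (auto simp: D_def)
    \<comment> \<open>The maximum is interior: on T the barrier adds at most \<epsilon>, which the
      margin absorbs, and on the rest of the sphere the barrier is below its value at z, so W <
      w.\<close>
    have "dist z z1 \<noteq> \<rho> / 2"
    proof
      assume a: "dist z z1 = \<rho> / 2"
      show False
      proof (cases "dist y' z1 \<le> \<rho>")
        case True
        then have "z1 \<in> T" using a by (simp add: T_def)
        have "W z1 \<le> w z1 + \<epsilon> * 1"
          using \<epsilon>(1) \<beta>pos[of z] \<open>\<beta> z1 \<le> 1\<close> mult_left_mono[OF \<open>\<beta> z1 \<le> 1\<close>, of \<epsilon>]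
            mult_pos_pos[OF \<epsilon>(1) \<beta>pos[of z]] unfolding W_def by linarith
        then show False using \<epsilon>(2)[OF \<open>z1 \<in> T\<close>] \<open>W z1 \<ge> M\<close> by simp
      next
        case False
        then have "\<rho> < norm (z1 - y')" by (simp add: dist_norm norm_minus_commute)
        then have "\<rho>\<^sup>2 < (norm (z1 - y'))\<^sup>2" using \<rho> by (intro power_strict_mono) auto
        then have "b \<bullet> b < (z1 - y') \<bullet> (z1 - y')" using nb by (simp flip: power2_norm_eq_inner)
        then have "\<beta> z1 < \<beta> z" using \<alpha> by (simp add: \<beta>_def b_def)
        then have "W z1 < w z1" using \<epsilon>(1) by (simp add: W_def)
        then show False using \<open>W z1 \<ge> M\<close> max[of z1] z1(1) DS by (auto simp: M_def)
      qed
    qed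
    then have z1b: "z1 \<in> ball z (\<rho> / 2)" using z1(1) by (auto simp: D_def)
    have bS: "ball z (\<rho> / 2) \<subseteq> D" by (auto simp: D_def)
    have z1S: "z1 \<in> S" using z1(1) DS by blast
    have "dir_deriv (\<lambda>y. dir_deriv W y v) z1 v \<le> 0" for v
    proof (rule second_deriv_nonpos_at_max[OF open_ball z1b _ d2W(1)[OF z1S]])
      fix y assume "y \<in> ball z (\<rho> / 2)"
      then have "y \<in> D" using bS by blast
      then show "W differentiable (at y)" "W y \<le> W z1" using dW(1) DS z1(2) by auto
    qed
    then have "(\<Sum>i\<in>I. dir_deriv (\<lambda>y. dir_deriv W y (e z1 i)) z1 (e z1 i)) \<le> 0"
      by (intro sum_nonpos) auto
    then have "(\<Sum>i\<in>I. dir_deriv (\<lambda>y. dir_deriv w y (e z1 i)) z1 (e z1 i)) +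
        \<epsilon> * (\<Sum>i\<in>I. dir_deriv (\<lambda>y. dir_deriv \<beta> y (e z1 i)) z1 (e z1 i)) \<le> 0"
      by (simp add: d2W(2)[OF z1S] sum.distrib sum_distrib_left)
    moreover have "\<epsilon> * (\<Sum>i\<in>I. dir_deriv (\<lambda>y. dir_deriv \<beta> y (e z1 i)) z1 (e z1 i)) > 0"
      using barrier[OF z1(1)] \<epsilon>(1) by simp
    ultimately show False using subharmonic[OF z1S] by simp
  qed
  then have "\<forall>x\<in>ball x0 r. w x = w x0" unfolding M_def by blast
  then show ?thesis using r(1) by blast
qed

section \<open>Hermitian linear algebra on the model space\<close>

lemma linear_Jmul: "linear Jmul"
  by (rule linearI) (simp_all add: Jmul_def vec_eq_iff algebra_simps scaleR_conv_of_real)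

lemmas Jmul_simps =
  linear_add[OF linear_Jmul] linear_diff[OF linear_Jmul] linear_scale[OF linear_Jmul]
  linear_neg[OF linear_Jmul] linear_0[OF linear_Jmul]

lemma Jmul_Jmul [simp]: "Jmul (Jmul v) = - v"
  by (simp add: Jmul_def vec_eq_iff mult.assoc[symmetric])

lemma Jmul_eq_0_iff [simp]: "Jmul v = 0 \<longleftrightarrow> v = 0"
  by (simp add: Jmul_def vec_eq_iff)

lemma inner_Jmul [simp]: "Jmul v \<bullet> Jmul w = v \<bullet> w"
  by (simp add: Jmul_def inner_vec_def inner_complex_def algebra_simps)

lemma Jmul_axis: "Jmul (axis k 1) = axis k \<i>"
  by (simp add: Jmul_def axis_def vec_eq_iff)

lemma axis_independent: "axis 2 1 \<noteq> a *\<^sub>R axis 1 1 + b *\<^sub>R Jmul (axis 1 1)"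
  by (simp add: vec_eq_iff forall_2 axis_def Jmul_def)

text \<open>Complex scalar multiplication on \<open>cvec\<close>, in real operations, so that real
  bilinear forms expand along it.\<close>

definition cscale :: "complex \<Rightarrow> cvec \<Rightarrow> cvec" where
  "cscale z v = Re z *\<^sub>R v + Im z *\<^sub>R Jmul v"

lemma cvec_decompose: "v = cscale (v $ 1) (axis 1 1) + cscale (v $ 2) (axis 2 1)"
  by (simp add: cscale_def Jmul_def vec_eq_iff forall_2 axis_def complex_eq_iff)

lemma bilinear_simps:
  assumes "bilinear B"
  shows "B (u + v) w = B u w + B v w" "B w (u + v) = B w u + B w v"
    "B (u - v) w = B u w - B v w" "B w (u - v) = B w u - B w v"
    "B (r *\<^sub>R u) w = r *\<^sub>R B u w" "B w (r *\<^sub>R u) = r *\<^sub>R B w u"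
    "B (- u) w = - B u w" "B w (- u) = - B w u"
    "B 0 w = 0" "B w 0 = 0"
    "B (sum f A) w = (\<Sum>a\<in>A. B (f a) w)" "B w (sum f A) = (\<Sum>a\<in>A. B w (f a))"
proof -
  have l: "linear (\<lambda>u. B u w)" and r: "linear (B w)"
    using assms by (auto simp: bilinear_def)
  show "B (u + v) w = B u w + B v w" "B w (u + v) = B w u + B w v"
    "B (u - v) w = B u w - B v w" "B w (u - v) = B w u - B w v"
    "B (r *\<^sub>R u) w = r *\<^sub>R B u w" "B w (r *\<^sub>R u) = r *\<^sub>R B w u"
    "B (- u) w = - B u w" "B w (- u) = - B w u"
    "B 0 w = 0" "B w 0 = 0"
    "B (sum f A) w = (\<Sum>a\<in>A. B (f a) w)" "B w (sum f A) = (\<Sum>a\<in>A. B w (f a))"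
    using linear_add[OF l] linear_add[OF r] linear_diff[OF l] linear_diff[OF r]
      linear_scale[OF l] linear_scale[OF r] linear_neg[OF l] linear_neg[OF r]
      linear_0[OF l] linear_0[OF r] linear_sum[OF l] linear_sum[OF r]
    by auto
qed

lemma eq_minus_self_iff: "x = - x \<longleftrightarrow> x = 0" for x :: "'a::real_vector"
proof
  assume "x = - x"
  then have "2 *\<^sub>R x = 0" by (metis add.right_inverse scaleR_2)
  then show "x = 0" by simp
qed simp

lemma alternating_swap:
  assumes "bilinear B" "\<And>v. B v v = 0"
  shows "B u v = - B v u"
proof -
  have "B (u + v) (u + v) = 0" by (rule assms)
  then have "B u v + B v u = 0"
    unfolding bilinear_simps[OF assms(1)] by (simp add: assms(2) add.commute)
  then show ?thesis by (simp add: eq_neg_iff_add_eq_0)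
qed

lemma vol_form_expand:
  "vol_form \<omega>c x t u v w =
    \<omega>c x t u * \<omega>c x v w - \<omega>c x t v * \<omega>c x u w + \<omega>c x t w * \<omega>c x u v"
  by (simp add: vol_form_def wedge22_def field_simps)

text \<open>\<open>g\<close> is a parameter with a defining equation, so that
  \<open>hermitian_point\<close> can instantiate it with \<open>metric \<omega>c x\<close>, the very
  term to which \<open>onb\<close> is applied.\<close>

locale hermitian_form =
  fixes \<omega> :: "cvec \<Rightarrow> cvec \<Rightarrow> real" and g :: "cvec \<Rightarrow> cvec \<Rightarrow> real"
  assumes bilinear_\<omega>: "bilinear \<omega>"
    and alternating: "\<omega> v v = 0"
    and J_invariant: "\<omega> (Jmul v) (Jmul w) = \<omega> v w"
    and positive: "v \<noteq> 0 \<Longrightarrow> \<omega> v (Jmul v) > 0"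
    and g_def: "g = (\<lambda>v w. \<omega> v (Jmul w))"
begin

definition orthonormal :: "(4 \<Rightarrow> cvec) \<Rightarrow> bool" where
  "orthonormal e \<longleftrightarrow> (\<forall>a b. g (e a) (e b) = (if a = b then 1 else 0))"

lemma swap: "\<omega> v w = - \<omega> w v"
  by (rule alternating_swap[OF bilinear_\<omega> alternating])

lemma bilinear_g: "bilinear g"
  unfolding g_def bilinear_def
  by (auto intro!: linearI simp: Jmul_simps bilinear_simps[OF bilinear_\<omega>])

lemmas \<omega>_simps = bilinear_simps[OF bilinear_\<omega>]
lemmas g_simps = bilinear_simps[OF bilinear_g]

lemma g_sym: "g v w = g w v"
proof -
  have "\<omega> v (Jmul w) = \<omega> (Jmul v) (Jmul (Jmul w))" by (simp only: J_invariant)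
  also have "\<dots> = \<omega> w (Jmul v)" using swap[of "Jmul v" w] by (simp add: \<omega>_simps)
  finally show ?thesis by (simp add: g_def)
qed

lemma g_pos: "v \<noteq> 0 \<Longrightarrow> g v v > 0"
  using positive by (simp add: g_def)

lemma g_J_right: "g v (Jmul w) = - \<omega> v w"
  by (simp add: g_def \<omega>_simps)

lemma \<omega>_eq_g: "\<omega> u v = - g (Jmul v) u"
  using g_J_right[of u v] g_sym by simp

lemma g_J_J: "g (Jmul v) (Jmul w) = g v w"
  by (simp add: g_def J_invariant)

lemma g_J_self: "g v (Jmul v) = 0" "g (Jmul v) v = 0"
  using g_J_right[of v v] g_sym alternating by auto

lemma orthonormalD: "orthonormal e \<Longrightarrow> g (e a) (e b) = (if a = b then 1 else 0)"
  by (simp add: orthonormal_def)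

text \<open>Pairing with each e_a shows that the four vectors are independent; the real dimension is
  four, so they span.\<close>

lemma orthonormal_expand:
  assumes "orthonormal e"
  shows "v = (\<Sum>a\<in>UNIV. g v (e a) *\<^sub>R e a)"
proof -
  have inj: "inj e"
    by (rule injI) (metis assms orthonormalD zero_neq_one)
  have "independent (range e)"
  proof
    assume "dependent (range e)"
    then obtain u a where u: "u (e a) \<noteq> 0" "(\<Sum>v\<in>range e. u v *\<^sub>R v) = 0"
      by (auto simp: dependent_finite)
    then have "(\<Sum>b\<in>UNIV. u (e b) *\<^sub>R e b) = 0"
      by (simp add: sum.reindex[OF inj])
    then have "g (\<Sum>b\<in>UNIV. u (e b) *\<^sub>R e b) (e a) = 0" by (simp add: g_simps)
    then have "(\<Sum>b\<in>UNIV. u (e b) * (if b = a then 1 else 0)) = 0"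
      by (simp add: g_simps orthonormalD[OF assms])
    then show False using u(1) by (simp add: if_distrib cong: if_cong)
  qed
  moreover have "dim (UNIV :: cvec set) \<le> card (range e)"
    by (simp add: card_image[OF inj])
  ultimately have "UNIV \<subseteq> span (range e)"
    by (intro card_ge_dim_independent) auto
  then have "v \<in> span (range e)" by auto
  then obtain u where "v = (\<Sum>w\<in>range e. u w *\<^sub>R w)"
    by (auto simp: span_finite)
  then have v: "v = (\<Sum>b\<in>UNIV. u (e b) *\<^sub>R e b)"
    by (simp add: sum.reindex[OF inj])
  have "g v (e a) = u (e a)" for a
  proof -
    have "g v (e a) = (\<Sum>b\<in>UNIV. u (e b) * (if b = a then 1 else 0))"
      unfolding v by (simp add: g_simps orthonormalD[OF assms])
    then show ?thesis by (simp add: if_distrib cong: if_cong)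
  qed
  then show ?thesis using v by simp
qed

lemma orthonormal_parseval:
  assumes "orthonormal e"
  shows "g v w = (\<Sum>a\<in>UNIV. g v (e a) * g w (e a))"
proof -
  have "g v w = g v (\<Sum>a\<in>UNIV. g w (e a) *\<^sub>R e a)"
    using orthonormal_expand[OF assms, of w] by simp
  then show ?thesis by (simp add: g_simps mult.commute)
qed

lemma sum_orthonormal_linear:
  assumes "orthonormal e" "linear L"
  shows "(\<Sum>a\<in>UNIV. g u (e a) *\<^sub>R L (e a)) = L u"
proof -
  have "L u = L (\<Sum>a\<in>UNIV. g u (e a) *\<^sub>R e a)"
    using orthonormal_expand[OF assms(1), of u] by simp
  then show ?thesis by (simp add: linear_sum[OF assms(2)] linear_scale[OF assms(2)])
qed

text \<open>As \<omega>(e, u) = - g(Ju, e), contraction with \<omega> is the frame expansion of Ju.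
  This is what removes the frame sums from the Hodge star and from the contraction.\<close>

lemma sum_orthonormal_\<omega>:
  assumes "orthonormal e" "linear L"
  shows "(\<Sum>a\<in>UNIV. \<omega> (e a) u *\<^sub>R L (e a)) = - L (Jmul u)"
    and "(\<Sum>a\<in>UNIV. \<omega> u (e a) *\<^sub>R L (e a)) = L (Jmul u)"
proof -
  show "(\<Sum>a\<in>UNIV. \<omega> (e a) u *\<^sub>R L (e a)) = - L (Jmul u)"
    using sum_orthonormal_linear[OF assms, of "Jmul u"] by (simp add: \<omega>_eq_g sum_negf)
  then show "(\<Sum>a\<in>UNIV. \<omega> u (e a) *\<^sub>R L (e a)) = L (Jmul u)"
    by (simp add: swap[of u] sum_negf)
qed

text \<open>Both arguments are expanded in e'; the sum over e is carried out by Parseval and leaves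
  the Gram matrix of e', the identity. This makes traces independent of the choice in
  \<open>onb\<close>.\<close>

lemma orthonormal_trace_unique:
  assumes e: "orthonormal e" and e': "orthonormal e'" and B: "bilinear B"
  shows "(\<Sum>a\<in>UNIV. B (e a) (e a)) = (\<Sum>a\<in>UNIV. B (e' a) (e' a))"
proof -
  have "B (e a) (e a) = (\<Sum>i\<in>UNIV. \<Sum>j\<in>UNIV. (g (e' i) (e a) * g (e' j) (e a)) *\<^sub>R B (e' i) (e' j))" for a
  proof -
    have "B (e a) (e a) = (\<Sum>i\<in>UNIV. g (e' i) (e a) *\<^sub>R B (e' i) (e a))"
      using sum_orthonormal_linear[OF e', of "\<lambda>v. B v (e a)" "e a"] B by (simp add: bilinear_def g_sym)
    moreover have "B w (e a) = (\<Sum>i\<in>UNIV. g (e' i) (e a) *\<^sub>R B w (e' i))" for w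
      using sum_orthonormal_linear[OF e', of "B w" "e a"] B by (simp add: bilinear_def g_sym)
    ultimately show ?thesis
      by (simp only: scaleR_sum_right scaleR_scaleR)
  qed
  then have "(\<Sum>a\<in>UNIV. B (e a) (e a)) =
      (\<Sum>a\<in>UNIV. \<Sum>i\<in>UNIV. \<Sum>j\<in>UNIV. (g (e' i) (e a) * g (e' j) (e a)) *\<^sub>R B (e' i) (e' j))"
    by simp
  also have "\<dots> = (\<Sum>i\<in>UNIV. \<Sum>a\<in>UNIV. \<Sum>j\<in>UNIV. (g (e' i) (e a) * g (e' j) (e a)) *\<^sub>R B (e' i) (e' j))"
    by (rule sum.swap)
  also have "\<dots> = (\<Sum>i\<in>UNIV. \<Sum>j\<in>UNIV. \<Sum>a\<in>UNIV. (g (e' i) (e a) * g (e' j) (e a)) *\<^sub>R B (e' i) (e' j))"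
    by (intro sum.cong refl sum.swap)
  also have "\<dots> = (\<Sum>i\<in>UNIV. \<Sum>j\<in>UNIV. g (e' i) (e' j) *\<^sub>R B (e' i) (e' j))"
    by (simp only: scaleR_sum_left[symmetric] orthonormal_parseval[OF e, symmetric])
  also have "\<dots> = (\<Sum>i\<in>UNIV. \<Sum>j\<in>UNIV. if i = j then B (e' i) (e' j) else 0)"
    by (intro sum.cong refl) (simp add: orthonormalD[OF e'])
  finally show ?thesis by simp
qed

definition unitary_frame :: "cvec \<Rightarrow> cvec \<Rightarrow> 4 \<Rightarrow> cvec" where
  "unitary_frame p q k = (if k = 1 then p else if k = 2 then Jmul p else if k = 3 then q else Jmul q)"

lemma unitary_frame_simps:
  "unitary_frame p q 1 = p" "unitary_frame p q 2 = Jmul p"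
  "unitary_frame p q 3 = q" "unitary_frame p q 4 = Jmul q"
  by (simp_all add: unitary_frame_def)

lemma orthonormal_unitary_frame:
  assumes p: "g p p = 1" and q: "g q q = 1" and qp: "g q p = 0" "g q (Jmul p) = 0"
  shows "orthonormal (unitary_frame p q)"
proof -
  have Jqp: "g (Jmul q) p = 0" "g (Jmul q) (Jmul p) = 0"
    using qp g_J_J[of "q" "Jmul p"] by (simp_all add: g_J_J g_simps)
  have pq: "g p q = 0" "g (Jmul p) q = 0" "g p (Jmul q) = 0" "g (Jmul p) (Jmul q) = 0"
    using qp Jqp g_sym by metis+
  show ?thesis
    unfolding orthonormal_def forall_4 unitary_frame_simps
    using qp Jqp pq p q by (simp add: g_J_J g_J_self)
qed

text \<open>Complex Gram-Schmidt: the span of p and Jp has real dimension at most two, so a vector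
  outside it remains. That the frame starts along a prescribed u is needed for
  \<open>hodge3_eq_0_imp\<close>.\<close>

lemma unitary_frame_exists:
  assumes "u \<noteq> 0"
  shows "\<exists>e r. orthonormal e \<and> r > 0 \<and> u = r *\<^sub>R e 1 \<and> e 2 = Jmul (e 1) \<and> e 4 = Jmul (e 3)"
proof -
  define r where "r = sqrt (g u u)"
  have r: "r > 0" "r * r = g u u" using g_pos[OF assms] by (auto simp: r_def)
  define p where "p = (1 / r) *\<^sub>R u"
  have p: "g p p = 1" using r(1) by (simp add: p_def g_simps r(2)[symmetric])
  have "dim (span {p, Jmul p}) \<le> card {p, Jmul p}"
    by (metis dim_le_card' dim_span finite.emptyI finite.insertI)
  also have "\<dots> < dim (UNIV :: cvec set)"
    by (auto simp: card_insert_if)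
  finally have "span {p, Jmul p} \<noteq> UNIV" by (metis order_less_irrefl)
  then obtain w where w: "w \<notin> span {p, Jmul p}" by auto
  define w' where "w' = w - g w p *\<^sub>R p - g w (Jmul p) *\<^sub>R Jmul p"
  have "w' \<noteq> 0"
  proof
    assume "w' = 0"
    then have "w = g w p *\<^sub>R p + g w (Jmul p) *\<^sub>R Jmul p" by (simp add: w'_def algebra_simps)
    also have "\<dots> \<in> span {p, Jmul p}"
      by (intro span_add span_scale span_base) auto
    finally show False using w by simp
  qed
  have orth: "g w' p = 0" "g w' (Jmul p) = 0"
    by (simp_all add: w'_def g_simps p g_J_self g_J_J)
  define s where "s = sqrt (g w' w')"
  have s: "s > 0" "s * s = g w' w'" using g_pos[OF \<open>w' \<noteq> 0\<close>] by (auto simp: s_def)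
  define q where "q = (1 / s) *\<^sub>R w'"
  have q: "g q q = 1" using s(1) by (simp add: q_def g_simps s(2)[symmetric])
  have qp: "g q p = 0" "g q (Jmul p) = 0" using orth by (simp_all add: q_def g_simps)
  have "orthonormal (unitary_frame p q)"
    by (rule orthonormal_unitary_frame[OF p q qp])
  moreover have "u = r *\<^sub>R unitary_frame p q 1" using r by (simp add: unitary_frame_simps p_def)
  ultimately show ?thesis using r unitary_frame_simps[of p q] by metis
qed

lemma orthonormal_onb: "orthonormal (onb g)"
proof -
  have "axis 1 1 \<noteq> (0::cvec)" by simp
  from unitary_frame_exists[OF this] obtain e where "orthonormal e" by blast
  then show ?thesis
    unfolding onb_def orthonormal_def by (rule someI[of "\<lambda>e. \<forall>a b. g (e a) (e b) = (if a = b then 1 else 0)"])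
qed

text \<open>The left side is half of \<omega> \<and> \<omega> on (v, Jv, w, Jw). It equals g(v, v)
  g(w', w'), where w' is the component of w orthogonal to the complex line of v.\<close>

lemma volume_form_pos:
  assumes "v \<noteq> 0" "\<And>a b. w \<noteq> a *\<^sub>R v + b *\<^sub>R Jmul v"
  shows "\<omega> v (Jmul v) * \<omega> w (Jmul w) - \<omega> v w * \<omega> (Jmul v) (Jmul w) + \<omega> v (Jmul w) * \<omega> (Jmul v) w > 0"
proof -
  define n where "n = g v v"
  have n: "n > 0" using g_pos[OF assms(1)] by (simp add: n_def)
  define w' where "w' = w - (g w v / n) *\<^sub>R v - (g w (Jmul v) / n) *\<^sub>R Jmul v"
  have "w' \<noteq> 0" using assms(2)[of "g w v / n" "g w (Jmul v) / n"] by (auto simp: w'_def algebra_simps)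
  have "g w' w' = g w w - g w v * g w v / n - g w (Jmul v) * g w (Jmul v) / n"
    using n by (simp add: w'_def g_simps g_J_self g_J_J g_sym[of v w] g_sym[of "Jmul v" w] n_def[symmetric]
        field_simps)
  then have "0 < n * (g w w - g w v * g w v / n - g w (Jmul v) * g w (Jmul v) / n)"
    using g_pos[OF \<open>w' \<noteq> 0\<close>] n by simp
  then have *: "0 < n * g w w - g w v * g w v - g w (Jmul v) * g w (Jmul v)"
    using n by (simp add: algebra_simps)
  have "g w (Jmul v) = \<omega> v w" using g_J_right[of w v] swap[of v w] by simp
  moreover have "\<omega> (Jmul v) w = - g w v" using swap[of "Jmul v" w] by (simp add: g_def)
  moreover have "\<omega> v (Jmul w) = g w v" "\<omega> v (Jmul v) = n" "\<omega> w (Jmul w) = g w w"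
    by (simp_all add: n_def g_def g_sym[of w v, unfolded g_def])
  ultimately show ?thesis
    using * by (simp add: J_invariant)
qed

lemma metric_volume_standard_pos:
  "\<omega> (axis 1 1) (axis 1 \<i>) * \<omega> (axis 2 1) (axis 2 \<i>) - \<omega> (axis 1 1) (axis 2 1) * \<omega> (axis 1 \<i>) (axis 2 \<i>)
    + \<omega> (axis 1 1) (axis 2 \<i>) * \<omega> (axis 1 \<i>) (axis 2 1) > 0"
  using volume_form_pos[OF _ axis_independent] by (simp add: Jmul_axis)

end

section \<open>Contraction and Hodge star at a point of a Kaehler chart\<close>

locale hermitian_point = hermitian_form "\<omega>c x" "metric \<omega>c x" for \<omega>c x
begin

text \<open>The sum over the second index collapses to J; the remaining trace does not depend on the
  frame, so \<open>onb\<close> may be exchanged for any orthonormal e.\<close>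

lemma Lambda2_eq:
  assumes \<beta>: "bilinear \<beta>" and e: "orthonormal e"
  shows "Lambda2 \<omega>c x \<beta> = (1/2) *\<^sub>R (\<Sum>a\<in>UNIV. \<beta> (e a) (Jmul (e a)))"
proof -
  have "linear (\<beta> u)" for u using \<beta> by (simp add: bilinear_def)
  from sum_orthonormal_\<omega>(2)[OF orthonormal_onb this]
  have "Lambda2 \<omega>c x \<beta> = (1/2) *\<^sub>R (\<Sum>a\<in>UNIV. \<beta> (onb (metric \<omega>c x) a) (Jmul (onb (metric \<omega>c x) a)))"
    by (simp add: Lambda2_def Let_def)
  moreover have "bilinear (\<lambda>u v. \<beta> u (Jmul v))"
    unfolding bilinear_def by (auto intro!: linearI simp: Jmul_simps bilinear_simps[OF \<beta>])
  ultimately show ?thesis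
    using orthonormal_trace_unique[OF orthonormal_onb e, of "\<lambda>u v. \<beta> u (Jmul v)"] by simp
qed

text \<open>
  Gram-Schmidt applied to the standard basis computes the trace without the choice made in
  \<open>onb\<close>, and hence shows that it depends continuously on the base point.
\<close>

lemma Lambda2_gram_schmidt:
  assumes \<beta>: "bilinear \<beta>" "\<And>v. \<beta> v v = 0"
  defines "u \<equiv> axis 1 1 :: cvec" and "n \<equiv> \<omega>c x (axis 1 1) (Jmul (axis 1 1))"
  defines "w \<equiv> axis 2 1 - (\<omega>c x (axis 2 1) (Jmul u) / n) *\<^sub>R u + (\<omega>c x (axis 2 1) u / n) *\<^sub>R Jmul u"
  shows "n > 0" "\<omega>c x w (Jmul w) > 0"
    and "Lambda2 \<omega>c x \<beta> = (1 / n) *\<^sub>R \<beta> u (Jmul u) + (1 / \<omega>c x w (Jmul w)) *\<^sub>R \<beta> w (Jmul w)"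
proof -
  define m where "m = metric \<omega>c x w w"
  have n: "n = metric \<omega>c x u u" by (simp add: n_def u_def metric_def)
  have u: "u \<noteq> 0" by (simp add: u_def)
  then show npos: "n > 0" using g_pos n by simp
  have w: "w = axis 2 1 - (metric \<omega>c x (axis 2 1) u / n) *\<^sub>R u - (metric \<omega>c x (axis 2 1) (Jmul u) / n) *\<^sub>R Jmul u"
    by (simp add: w_def metric_def \<omega>_simps)
  have "w \<noteq> 0"
    using axis_independent[of "metric \<omega>c x (axis 2 1) u / n" "metric \<omega>c x (axis 2 1) (Jmul u) / n"]
    unfolding w u_def by (auto simp: algebra_simps)
  then have mpos: "m > 0" using g_pos by (simp add: m_def)
  then show "\<omega>c x w (Jmul w) > 0" by (simp add: m_def metric_def)
  have orth: "metric \<omega>c x w u = 0" "metric \<omega>c x w (Jmul u) = 0"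
    using npos by (simp_all add: w g_simps g_J_self g_J_J n[symmetric])
  define p where "p = (1 / sqrt n) *\<^sub>R u"
  define q where "q = (1 / sqrt m) *\<^sub>R w"
  have "orthonormal (unitary_frame p q)"
  proof (rule orthonormal_unitary_frame)
    show "metric \<omega>c x p p = 1" using npos by (simp add: p_def g_simps n[symmetric])
    show "metric \<omega>c x q q = 1" using mpos by (simp add: q_def g_simps m_def[symmetric])
    show "metric \<omega>c x q p = 0" "metric \<omega>c x q (Jmul p) = 0"
      by (simp_all add: p_def q_def g_simps orth Jmul_simps)
  qed
  from Lambda2_eq[OF \<beta>(1) this]
  have "Lambda2 \<omega>c x \<beta> = (1/2) *\<^sub>R (\<beta> p (Jmul p) + - \<beta> (Jmul p) p + \<beta> q (Jmul q) + - \<beta> (Jmul q) q)"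
    by (simp add: sum_4 unitary_frame_simps bilinear_simps[OF \<beta>(1)])
  also have "\<dots> = (1/2) *\<^sub>R (2 *\<^sub>R (\<beta> p (Jmul p) + \<beta> q (Jmul q)))"
    unfolding alternating_swap[OF \<beta>, of "Jmul p" p] alternating_swap[OF \<beta>, of "Jmul q" q]
    by (simp add: scaleR_2 algebra_simps)
  finally have "Lambda2 \<omega>c x \<beta> = \<beta> p (Jmul p) + \<beta> q (Jmul q)" by simp
  moreover have "\<beta> p (Jmul p) = (1 / n) *\<^sub>R \<beta> u (Jmul u)"
    using npos by (simp add: p_def Jmul_simps bilinear_simps[OF \<beta>(1)])
  moreover have "\<beta> q (Jmul q) = (1 / m) *\<^sub>R \<beta> w (Jmul w)"
    using mpos by (simp add: q_def Jmul_simps bilinear_simps[OF \<beta>(1)])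
  ultimately show "Lambda2 \<omega>c x \<beta> = (1 / n) *\<^sub>R \<beta> u (Jmul u) + (1 / \<omega>c x w (Jmul w)) *\<^sub>R \<beta> w (Jmul w)"
    by (simp add: m_def metric_def)
qed

text \<open>Of the three products in the volume form, one produces the contraction and each of the
  other two produces - \<beta>(Ju, Jv), by antisymmetry of \<beta>.\<close>

lemma hodge2_eq:
  assumes \<beta>: "bilinear \<beta>" "\<And>v. \<beta> v v = 0"
  shows "hodge2 \<omega>c x \<beta> u v = \<omega>c x u v *\<^sub>R Lambda2 \<omega>c x \<beta> - \<beta> (Jmul u) (Jmul v)"
proof -
  define e where "e = onb (metric \<omega>c x)"
  have e: "orthonormal e" by (simp add: e_def orthonormal_onb)
  have l: "linear (\<beta> u)" "linear (\<lambda>u. \<beta> u v)" for u v using \<beta> by (auto simp: bilinear_def)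
  have 2: "(\<Sum>a\<in>UNIV. \<Sum>b\<in>UNIV. (\<omega>c x (e a) u * \<omega>c x (e b) v) *\<^sub>R \<beta> (e a) (e b)) = \<beta> (Jmul u) (Jmul v)" for u v
  proof -
    have "(\<Sum>a\<in>UNIV. \<Sum>b\<in>UNIV. (\<omega>c x (e a) u * \<omega>c x (e b) v) *\<^sub>R \<beta> (e a) (e b)) =
        (\<Sum>a\<in>UNIV. \<omega>c x (e a) u *\<^sub>R (\<Sum>b\<in>UNIV. \<omega>c x (e b) v *\<^sub>R \<beta> (e a) (e b)))"
      by (simp add: scaleR_sum_right)
    also have "\<dots> = - (\<Sum>a\<in>UNIV. \<omega>c x (e a) u *\<^sub>R \<beta> (e a) (Jmul v))"
      by (simp add: sum_orthonormal_\<omega>(1)[OF e l(1)] sum_negf)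
    also have "\<dots> = \<beta> (Jmul u) (Jmul v)"
      by (simp add: sum_orthonormal_\<omega>(1)[OF e l(2)])
    finally show ?thesis .
  qed
  have 1: "(\<Sum>a\<in>UNIV. \<Sum>b\<in>UNIV. (\<omega>c x (e a) (e b) * \<omega>c x u v) *\<^sub>R \<beta> (e a) (e b)) =
      (2 * \<omega>c x u v) *\<^sub>R Lambda2 \<omega>c x \<beta>"
    by (simp add: Lambda2_def Let_def e_def[symmetric] scaleR_sum_right mult.commute)
  have "hodge2 \<omega>c x \<beta> u v = (1/2) *\<^sub>R
     ((\<Sum>a\<in>UNIV. \<Sum>b\<in>UNIV. (\<omega>c x (e a) (e b) * \<omega>c x u v) *\<^sub>R \<beta> (e a) (e b))
      - (\<Sum>a\<in>UNIV. \<Sum>b\<in>UNIV. (\<omega>c x (e a) u * \<omega>c x (e b) v) *\<^sub>R \<beta> (e a) (e b))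
      + (\<Sum>a\<in>UNIV. \<Sum>b\<in>UNIV. (\<omega>c x (e a) v * \<omega>c x (e b) u) *\<^sub>R \<beta> (e a) (e b)))"
    by (simp add: hodge2_def Let_def e_def[symmetric] vol_form_expand scaleR_left_diff_distrib
        scaleR_left_distrib sum.distrib sum_subtractf)
  also have "\<dots> = (1/2) *\<^sub>R ((2 * \<omega>c x u v) *\<^sub>R Lambda2 \<omega>c x \<beta> - \<beta> (Jmul u) (Jmul v) - \<beta> (Jmul u) (Jmul v))"
    unfolding 1 2 using alternating_swap[OF \<beta>, of "Jmul v" "Jmul u"] by simp
  also have "\<dots> = \<omega>c x u v *\<^sub>R Lambda2 \<omega>c x \<beta> - \<beta> (Jmul u) (Jmul v)"
    by (simp add: scaleR_diff_right flip: scaleR_add_left) (simp add: algebra_simps flip: scaleR_2)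
  finally show ?thesis .
qed

lemma alternating3_linear:
  assumes lin: "\<And>u v. linear (\<beta> u v)"
    and swap12: "\<And>u v w. \<beta> u v w = - \<beta> v u w" and swap23: "\<And>u v w. \<beta> u v w = - \<beta> u w v"
  shows "linear (\<lambda>u. \<beta> u v w)" and "linear (\<lambda>v. \<beta> u v w)"
proof -
  have 1: "linear (\<lambda>v. \<beta> u v w)" for u w
  proof -
    have "(\<lambda>v. \<beta> u v w) = (\<lambda>v. - \<beta> u w v)" by (rule ext) (rule swap23)
    then show ?thesis using linear_compose_neg[OF lin] by simp
  qed
  then show "linear (\<lambda>v. \<beta> u v w)" .
  have "(\<lambda>u. \<beta> u v w) = (\<lambda>u. - \<beta> v u w)" by (rule ext) (rule swap12)
  then show "linear (\<lambda>u. \<beta> u v w)" using linear_compose_neg[OF 1] by simp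
qed

text \<open>By antisymmetry of \<beta> the three products in the volume form contribute equally,
  which turns the factor 1/6 into 1/2. Up to J, the star is thus contraction with \<omega>.\<close>

lemma hodge3_eq:
  assumes lin: "\<And>u v. linear (\<beta> u v)"
    and swap12: "\<And>u v w. \<beta> u v w = - \<beta> v u w" and swap23: "\<And>u v w. \<beta> u v w = - \<beta> u w v"
    and e: "orthonormal e"
  shows "hodge3 \<omega>c x \<beta> u = - (1/2) *\<^sub>R (\<Sum>a\<in>UNIV. \<beta> (e a) (Jmul (e a)) (Jmul u))"
proof -
  define f where "f = onb (metric \<omega>c x)"
  have f: "orthonormal f" by (simp add: f_def orthonormal_onb)
  note lin1 = alternating3_linear(1)[OF lin swap12 swap23]
    and lin2 = alternating3_linear(2)[OF lin swap12 swap23]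
  define R where "R = (\<Sum>a\<in>UNIV. \<beta> (f a) (Jmul (f a)) (Jmul u))"
  have R: "(\<Sum>a\<in>UNIV. \<Sum>b\<in>UNIV. \<omega>c x (f a) (f b) *\<^sub>R \<beta> (f a) (f b) (Jmul u)) = R"
    by (simp add: R_def sum_orthonormal_\<omega>(2)[OF f lin2])
  have T1: "(\<Sum>a\<in>UNIV. \<Sum>b\<in>UNIV. \<Sum>k\<in>UNIV. (\<omega>c x (f a) (f b) * \<omega>c x (f k) u) *\<^sub>R \<beta> (f a) (f b) (f k)) = - R"
  proof -
    have "(\<Sum>k\<in>UNIV. (\<omega>c x (f a) (f b) * \<omega>c x (f k) u) *\<^sub>R \<beta> (f a) (f b) (f k)) =
        - (\<omega>c x (f a) (f b) *\<^sub>R \<beta> (f a) (f b) (Jmul u))" for a b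
      using sum_orthonormal_\<omega>(1)[OF f lin, of u] by (simp flip: scaleR_scaleR scaleR_sum_right)
    then show ?thesis using R by (simp add: sum_negf)
  qed
  have T2: "(\<Sum>a\<in>UNIV. \<Sum>b\<in>UNIV. \<Sum>k\<in>UNIV. (\<omega>c x (f a) (f k) * \<omega>c x (f b) u) *\<^sub>R \<beta> (f a) (f b) (f k)) = R"
  proof -
    have "(\<Sum>a\<in>UNIV. \<Sum>b\<in>UNIV. \<Sum>k\<in>UNIV. (\<omega>c x (f a) (f k) * \<omega>c x (f b) u) *\<^sub>R \<beta> (f a) (f b) (f k)) =
        (\<Sum>a\<in>UNIV. \<Sum>k\<in>UNIV. \<Sum>b\<in>UNIV. (\<omega>c x (f a) (f k) * \<omega>c x (f b) u) *\<^sub>R \<beta> (f a) (f b) (f k))"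
      by (intro sum.cong refl sum.swap)
    also have "\<dots> = (\<Sum>a\<in>UNIV. \<Sum>k\<in>UNIV. \<Sum>b\<in>UNIV. - ((\<omega>c x (f a) (f k) * \<omega>c x (f b) u) *\<^sub>R \<beta> (f a) (f k) (f b)))"
      by (intro sum.cong refl) (subst swap23, simp)
    finally show ?thesis using T1 by (simp add: sum_negf)
  qed
  have cyc: "\<beta> p q v = \<beta> q v p" for p q v
    using swap12[of p q v] swap23[of q p v] by simp
  have T3: "(\<Sum>a\<in>UNIV. \<Sum>b\<in>UNIV. \<Sum>k\<in>UNIV. (\<omega>c x (f a) u * \<omega>c x (f b) (f k)) *\<^sub>R \<beta> (f a) (f b) (f k)) = - R"
  proof -
    have "(\<Sum>a\<in>UNIV. \<Sum>b\<in>UNIV. \<Sum>k\<in>UNIV. (\<omega>c x (f a) u * \<omega>c x (f b) (f k)) *\<^sub>R \<beta> (f a) (f b) (f k)) =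
        (\<Sum>b\<in>UNIV. \<Sum>a\<in>UNIV. \<Sum>k\<in>UNIV. (\<omega>c x (f a) u * \<omega>c x (f b) (f k)) *\<^sub>R \<beta> (f a) (f b) (f k))"
      by (rule sum.swap)
    also have "\<dots> = (\<Sum>b\<in>UNIV. \<Sum>k\<in>UNIV. \<Sum>a\<in>UNIV. (\<omega>c x (f a) u * \<omega>c x (f b) (f k)) *\<^sub>R \<beta> (f a) (f b) (f k))"
      by (intro sum.cong refl sum.swap)
    also have "\<dots> = (\<Sum>b\<in>UNIV. \<Sum>k\<in>UNIV. \<Sum>a\<in>UNIV. (\<omega>c x (f b) (f k) * \<omega>c x (f a) u) *\<^sub>R \<beta> (f b) (f k) (f a))"
      by (intro sum.cong refl arg_cong2[where f=scaleR] mult.commute cyc)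
    finally show ?thesis using T1 by simp
  qed
  have "hodge3 \<omega>c x \<beta> u = (1/6) *\<^sub>R
     ((\<Sum>a\<in>UNIV. \<Sum>b\<in>UNIV. \<Sum>k\<in>UNIV. (\<omega>c x (f a) (f b) * \<omega>c x (f k) u) *\<^sub>R \<beta> (f a) (f b) (f k))
      - (\<Sum>a\<in>UNIV. \<Sum>b\<in>UNIV. \<Sum>k\<in>UNIV. (\<omega>c x (f a) (f k) * \<omega>c x (f b) u) *\<^sub>R \<beta> (f a) (f b) (f k))
      + (\<Sum>a\<in>UNIV. \<Sum>b\<in>UNIV. \<Sum>k\<in>UNIV. (\<omega>c x (f a) u * \<omega>c x (f b) (f k)) *\<^sub>R \<beta> (f a) (f b) (f k)))"
    by (simp add: hodge3_def Let_def f_def[symmetric] vol_form_expand scaleR_left_diff_distrib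
        scaleR_left_distrib sum.distrib sum_subtractf)
  also have "\<dots> = (1/6) *\<^sub>R (- R - R - R)" unfolding T1 T2 T3 by simp
  also have "\<dots> = - (1/2) *\<^sub>R R"
  proof -
    have "- R - R - R = (- 3) *\<^sub>R R" using scaleR_add_left[of "1" "2" R] by (simp add: scaleR_2)
    then show ?thesis by simp
  qed
  also have "R = (\<Sum>a\<in>UNIV. \<beta> (e a) (Jmul (e a)) (Jmul u))"
    unfolding R_def
    by (rule orthonormal_trace_unique[OF f e, of "\<lambda>v w. \<beta> v (Jmul w) (Jmul u)"])
      (use lin1 lin2 in \<open>auto simp: bilinear_def Jmul_simps linear_iff\<close>)
  finally show ?thesis .
qed

text \<open>The Lefschetz map is injective on 3-forms of a surface.\<close>

lemma hodge3_eq_0_imp: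
  assumes lin: "\<And>u v. linear (\<beta> u v)"
    and swap12: "\<And>u v w. \<beta> u v w = - \<beta> v u w" and swap23: "\<And>u v w. \<beta> u v w = - \<beta> u w v"
    and 0: "\<And>u. hodge3 \<omega>c x \<beta> u = 0"
  shows "\<beta> u (Jmul u) w = 0"
proof (cases "u = 0")
  case True
  have "\<beta> 0 0 w = - \<beta> 0 w 0" by (rule swap23)
  then show ?thesis using True linear_0[OF lin] by (simp add: Jmul_simps)
next
  case False
  note lin1 = alternating3_linear(1)[OF lin swap12 swap23]
    and lin2 = alternating3_linear(2)[OF lin swap12 swap23]
  \<comment> \<open>A frame along u reduces the claim to the vector e_1.\<close>
  obtain e r where e: "orthonormal e" and r: "u = r *\<^sub>R e 1" and J: "e 2 = Jmul (e 1)" "e 4 = Jmul (e 3)"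
    using unitary_frame_exists[OF False] by blast
  \<comment> \<open>The star is evaluated at - Jv because J(- Jv) = v.\<close>
  have tr: "(\<Sum>a\<in>UNIV. \<beta> (e a) (Jmul (e a)) v) = 0" for v
  proof -
    have "(\<Sum>a\<in>UNIV. \<beta> (e a) (Jmul (e a)) (Jmul (- Jmul v))) = 0"
      using hodge3_eq[OF lin swap12 swap23 e, of "- Jmul v"] 0 by simp
    then show ?thesis by (simp add: Jmul_simps)
  qed
  have vv: "\<beta> p q q = 0" "\<beta> q p q = 0" "\<beta> q q p = 0" for p q
  proof -
    show 1: "\<beta> p q q = 0" for p q using swap23[of p q q] by (simp add: eq_minus_self_iff)
    show "\<beta> q q p = 0" using swap12[of q q p] by (simp add: eq_minus_self_iff)
    show "\<beta> q p q = 0" using swap12[of q p q] 1 by simp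
  qed
  have Jterm: "\<beta> (Jmul p) (Jmul (Jmul p)) v = \<beta> p (Jmul p) v" for p v
    using swap12[of "Jmul p" p v] linear_neg[OF lin2] by simp
  have s: "\<beta> (e 1) (Jmul (e 1)) v + \<beta> (e 3) (Jmul (e 3)) v = 0" for v
  proof -
    have "2 *\<^sub>R (\<beta> (e 1) (Jmul (e 1)) v + \<beta> (e 3) (Jmul (e 3)) v) = 0"
      using tr[of v] unfolding sum_4 J Jterm by (simp add: scaleR_2 algebra_simps)
    then show ?thesis by simp
  qed
  have "\<beta> (e 1) (Jmul (e 1)) (e a) = 0" for a
  proof -
    \<comment> \<open>On e_3 and e_4 = J e_3 the other summand of \<open>s\<close> has a repeated
      argument, so this one vanishes as well; on e_1 and e_2 it repeats an argument itself.\<close>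
    have "\<beta> (e 1) (Jmul (e 1)) (e 3) = 0" "\<beta> (e 1) (Jmul (e 1)) (e 4) = 0"
      using s[of "e 3"] s[of "e 4"] vv J by auto
    moreover have "\<beta> (e 1) (Jmul (e 1)) (e 1) = 0" "\<beta> (e 1) (Jmul (e 1)) (e 2) = 0"
      using vv J by auto
    ultimately show ?thesis using exhaust_4[of a] by auto
  qed
  then have "\<beta> (e 1) (Jmul (e 1)) w = 0"
    using sum_orthonormal_linear[OF e lin[of "e 1" "Jmul (e 1)"], of w] by simp
  then show ?thesis
    by (simp add: r Jmul_simps linear_scale[OF lin1] linear_scale[OF lin2])
qed

end

text \<open>The bounds come from the extrema of the metric on K times the unit sphere, hence do not
  see how \<open>onb\<close> varies. The upper one holds since each e_a is a unit vector; for the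
  lower one, expand one factor of \<xi> \<bullet> \<xi> in the frame and apply
  Cauchy-Schwarz.\<close>

lemma uniformly_elliptic:
  fixes h :: "cvec \<Rightarrow> cvec \<Rightarrow> cvec \<Rightarrow> real"
  assumes herm: "\<And>x. x \<in> K \<Longrightarrow> hermitian_point h x"
    and cont: "\<And>u v. continuous_on K (\<lambda>x. h x u v)" and K: "compact K"
  shows "\<exists>m>0. \<exists>B. \<forall>x\<in>K. (\<forall>\<xi>. m * (\<xi> \<bullet> \<xi>) \<le> (\<Sum>a\<in>UNIV. (\<xi> \<bullet> onb (metric h x) a)\<^sup>2)) \<and>
    (\<Sum>a\<in>UNIV. onb (metric h x) a \<bullet> onb (metric h x) a) \<le> B"
proof (cases "K = {}")
  case True
  then show ?thesis by (auto intro: exI[of _ 1])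
next
  case False
  define Q where "Q = (\<lambda>p. metric h (fst p) (snd p) (snd p))"
  define T where "T = K \<times> sphere (0::cvec) 1"
  have "compact T" "T \<noteq> {}"
    using K False by (auto simp: T_def compact_Times)
  have Q_expand: "Q (x, v) = (\<Sum>i\<in>Basis. \<Sum>j\<in>Basis. (v \<bullet> i) * (v \<bullet> j) * h x i (Jmul j))" if "x \<in> K" for x v
  proof -
    interpret hermitian_point h x by (rule herm[OF that])
    have "metric h x v v = metric h x (\<Sum>i\<in>Basis. (v \<bullet> i) *\<^sub>R i) (\<Sum>i\<in>Basis. (v \<bullet> i) *\<^sub>R i)"
      by (simp add: euclidean_representation)
    also have "\<dots> = (\<Sum>i\<in>Basis. \<Sum>j\<in>Basis. (v \<bullet> i) * (v \<bullet> j) * metric h x i j)"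
      unfolding g_simps
      by (simp add: sum_distrib_left mult.assoc) (subst sum.swap, simp add: mult.left_commute)
    finally show ?thesis by (simp add: Q_def metric_def)
  qed
  have "continuous_on T (\<lambda>p. \<Sum>i\<in>Basis. \<Sum>j\<in>Basis. (snd p \<bullet> i) * (snd p \<bullet> j) * h (fst p) i (Jmul j))"
    by (intro continuous_intros continuous_on_compose2[OF cont]) (auto simp: T_def)
  moreover have "(\<Sum>i\<in>Basis. \<Sum>j\<in>Basis. (snd p \<bullet> i) * (snd p \<bullet> j) * h (fst p) i (Jmul j)) = Q p" if "p \<in> T" for p
    using Q_expand[of "fst p" "snd p"] that by (auto simp: T_def)
  ultimately have "continuous_on T Q" by (rule continuous_on_eq)
  then obtain p q where p: "p \<in> T" "\<And>y. y \<in> T \<Longrightarrow> Q p \<le> Q y" and q: "q \<in> T" "\<And>y. y \<in> T \<Longrightarrow> Q y \<le> Q q"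
    using continuous_attains_inf[OF \<open>compact T\<close> \<open>T \<noteq> {}\<close>]
      continuous_attains_sup[OF \<open>compact T\<close> \<open>T \<noteq> {}\<close>] by metis
  have posT: "Q y > 0" if "y \<in> T" for y
  proof -
    interpret hermitian_point h "fst y" by (rule herm) (use that in \<open>auto simp: T_def\<close>)
    have "snd y \<noteq> 0" using that by (auto simp: T_def)
    then show ?thesis using g_pos[of "snd y"] by (simp add: Q_def)
  qed
  have bounds: "Q p * (v \<bullet> v) \<le> metric h x v v \<and> metric h x v v \<le> Q q * (v \<bullet> v)" if "x \<in> K" for x v
  proof (cases "v = 0")
    case True
    interpret hermitian_point h x by (rule herm[OF that])
    show ?thesis using True by (simp add: g_simps)
  next
    case False
    interpret hermitian_point h x by (rule herm[OF that])
    define w where "w = (1 / norm v) *\<^sub>R v"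
    have "(x, w) \<in> T" using that False by (simp add: T_def w_def)
    moreover have "metric h x v v = (v \<bullet> v) * Q (x, w)"
      using False by (simp add: Q_def w_def g_simps flip: power2_norm_eq_inner) (simp add: power2_eq_square)
    ultimately show ?thesis
      using p(2)[of "(x, w)"] q(2)[of "(x, w)"]
      by (simp add: mult.commute[of "v \<bullet> v"] mult_right_mono)
  qed
  have Qp: "Q p > 0" and Qq: "Q q > 0" using posT p q by auto
  show ?thesis
  proof (rule exI[of _ "1 / Q q"], intro conjI exI[of _ "4 / Q p"] ballI allI)
    show "1 / Q q > 0" using Qq by simp
    fix x assume x: "x \<in> K"
    interpret hermitian_point h x by (rule herm[OF x])
    define e where "e = onb (metric h x)"
    have e: "orthonormal e" unfolding e_def by (rule orthonormal_onb)
    have "e a \<bullet> e a \<le> 1 / Q p" for a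
      using bounds[OF x, of "e a"] orthonormalD[OF e, of a a] Qp by (simp add: field_simps)
    then have "(\<Sum>a\<in>UNIV. e a \<bullet> e a) \<le> (\<Sum>a\<in>(UNIV::4 set). 1 / Q p)" by (intro sum_mono) auto
    then show "(\<Sum>a\<in>UNIV. onb (metric h x) a \<bullet> onb (metric h x) a) \<le> 4 / Q p" by (simp add: e_def)
    fix \<xi> :: cvec
    define n where "n = \<xi> \<bullet> \<xi>"
    define R where "R = (\<Sum>a\<in>UNIV. (\<xi> \<bullet> e a)\<^sup>2)"
    have "n = (\<Sum>a\<in>UNIV. metric h x \<xi> (e a) * (\<xi> \<bullet> e a))"
    proof -
      have "n = \<xi> \<bullet> (\<Sum>a\<in>UNIV. metric h x \<xi> (e a) *\<^sub>R e a)"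
        using orthonormal_expand[OF e, of \<xi>] by (simp add: n_def)
      then show ?thesis by (simp add: inner_sum_right)
    qed
    then have "n\<^sup>2 \<le> (\<Sum>a\<in>UNIV. (metric h x \<xi> (e a))\<^sup>2) * R"
      unfolding R_def using Cauchy_Schwarz_ineq_sum by metis
    also have "(\<Sum>a\<in>UNIV. (metric h x \<xi> (e a))\<^sup>2) = metric h x \<xi> \<xi>"
      by (simp add: orthonormal_parseval[OF e, of \<xi> \<xi>] power2_eq_square)
    also have "metric h x \<xi> \<xi> * R \<le> (Q q * n) * R"
      using bounds[OF x, of \<xi>] by (intro mult_right_mono) (auto simp: R_def n_def intro: sum_nonneg)
    finally have "n * n \<le> n * (Q q * R)" by (simp add: power2_eq_square mult_ac)
    moreover have "0 \<le> n" "0 \<le> R" by (auto simp: n_def R_def intro: sum_nonneg)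
    ultimately have "n \<le> Q q * R" using Qq by (cases "n = 0") auto
    then show "1 / Q q * (\<xi> \<bullet> \<xi>) \<le> (\<Sum>a\<in>UNIV. (\<xi> \<bullet> onb (metric h x) a)\<^sup>2)"
      using Qq by (simp add: n_def R_def e_def field_simps)
  qed
qed

text \<open>Antisymmetry carries J-linearity to the second slot. The form is then complex bilinear
  and alternating on a two-dimensional space, hence a multiple of the determinant.\<close>

lemma complex_volume_expand:
  fixes \<Theta> :: "cvec \<Rightarrow> cvec \<Rightarrow> complex"
  assumes \<Theta>: "bilinear \<Theta>" "\<And>v. \<Theta> v v = 0" "\<And>u v. \<Theta> (Jmul u) v = \<i> * \<Theta> u v"
  shows "\<Theta> u v = \<Theta> (axis 1 1) (axis 2 1) * (u $ 1 * v $ 2 - u $ 2 * v $ 1)"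
proof -
  note sw = alternating_swap[OF \<Theta>(1,2)]
  have right: "\<Theta> u (Jmul v) = \<i> * \<Theta> u v" for u v
    using sw[of u "Jmul v"] sw[of v u] by (simp add: \<Theta>(3))
  have c1: "\<Theta> (cscale z u) v = z * \<Theta> u v" for z u v
    by (simp add: cscale_def bilinear_simps[OF \<Theta>(1)] \<Theta>(3) complex_eq_iff)
  have c2: "\<Theta> u (cscale z v) = z * \<Theta> u v" for z u v
    using sw[of u "cscale z v"] sw[of v u] by (simp add: c1)
  have "\<Theta> u v = \<Theta> (cscale (u $ 1) (axis 1 1) + cscale (u $ 2) (axis 2 1))
      (cscale (v $ 1) (axis 1 1) + cscale (v $ 2) (axis 2 1))"
    using cvec_decompose by metis
  also have "\<dots> = \<Theta> (axis 1 1) (axis 2 1) * (u $ 1 * v $ 2 - u $ 2 * v $ 1)"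
    by (simp add: bilinear_simps[OF \<Theta>(1)] c1 c2 \<Theta>(2) sw[of "axis 2 1" "axis 1 1"] algebra_simps)
  finally show ?thesis .
qed

text \<open>Anti-invariance lets J move from one argument to the other, so the form vanishes on
  pairs (u, Ju) and two values determine it: it is a combination of the real and imaginary parts of
  the determinant.\<close>

lemma J_anti_invariant_form_expand:
  fixes \<Phi> :: "cvec \<Rightarrow> cvec \<Rightarrow> 'w::real_vector"
  assumes \<Phi>: "bilinear \<Phi>" "\<And>v. \<Phi> v v = 0" "\<And>u v. \<Phi> (Jmul u) (Jmul v) = - \<Phi> u v"
  defines "X \<equiv> \<Phi> (axis 1 1) (axis 2 1)" and "Y \<equiv> \<Phi> (axis 1 1) (Jmul (axis 2 1))"
  shows "\<Phi> u v = Re (u $ 1 * v $ 2 - u $ 2 * v $ 1) *\<^sub>R X + Im (u $ 1 * v $ 2 - u $ 2 * v $ 1) *\<^sub>R Y"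
proof -
  note sw = alternating_swap[OF \<Phi>(1,2)]
  have l: "\<Phi> (Jmul u) v = \<Phi> u (Jmul v)" for u v
    using \<Phi>(3)[of u "- Jmul v"] by (simp add: Jmul_simps bilinear_simps[OF \<Phi>(1)])
  have z: "\<Phi> u (Jmul u) = 0" for u
    using l[of u u] sw[of "Jmul u" u] eq_minus_self_iff by metis
  have a: "\<Phi> (axis 2 1) (axis 1 1) = - X" by (simp add: X_def sw[of "axis 2 1"])
  have b: "\<Phi> (axis 2 1) (Jmul (axis 1 1)) = - Y" by (simp add: Y_def sw[of "axis 2 1"] l)
  have "\<Phi> u v = \<Phi> (cscale (u $ 1) (axis 1 1) + cscale (u $ 2) (axis 2 1))
      (cscale (v $ 1) (axis 1 1) + cscale (v $ 2) (axis 2 1))"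
    using cvec_decompose by metis
  also have "\<dots> = Re (u $ 1 * v $ 2 - u $ 2 * v $ 1) *\<^sub>R X + Im (u $ 1 * v $ 2 - u $ 2 * v $ 1) *\<^sub>R Y"
    by (simp add: cscale_def bilinear_simps[OF \<Phi>(1)] \<Phi>(2,3) l z a b X_def[symmetric] Y_def[symmetric]
        algebra_simps)
  finally show ?thesis .
qed

section \<open>Matrix groups and their Lie algebras\<close>

lemma bilinear_matrix_mult: "bilinear ((**) :: 'n::finite cmat \<Rightarrow> 'n cmat \<Rightarrow> 'n cmat)"
  unfolding bilinear_def
  by (auto intro!: linearI simp: matrix_matrix_mult_def vec_eq_iff algebra_simps sum.distrib scaleR_sum_right)

lemmas matrix_mult_simps = bilinear_simps[OF bilinear_matrix_mult]

lemma bounded_bilinear_matrix_mult: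
  "bounded_bilinear ((**) :: 'n::finite cmat \<Rightarrow> 'n cmat \<Rightarrow> 'n cmat)"
  using bilinear_matrix_mult by (simp add: bilinear_conv_bounded_bilinear)

lemma bilinear_lie_bracket: "bilinear (lie_bracket :: 'n::finite cmat \<Rightarrow> 'n cmat \<Rightarrow> 'n cmat)"
  unfolding bilinear_def
  by (auto intro!: linearI simp: lie_bracket_def matrix_mult_simps scaleR_diff_right)

lemmas lie_bracket_simps = bilinear_simps[OF bilinear_lie_bracket]

lemma bounded_bilinear_lie_bracket:
  "bounded_bilinear (lie_bracket :: 'n::finite cmat \<Rightarrow> 'n cmat \<Rightarrow> 'n cmat)"
  using bilinear_lie_bracket by (simp add: bilinear_conv_bounded_bilinear)

lemma lie_bracket_self [simp]: "lie_bracket X X = 0"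
  by (simp add: lie_bracket_def)

lemma lie_bracket_swap: "lie_bracket X Y = - lie_bracket Y X"
  by (simp add: lie_bracket_def)

lemma jacobi:
  "lie_bracket X (lie_bracket Y Z) = lie_bracket (lie_bracket X Y) Z + lie_bracket Y (lie_bracket X Z)"
  by (simp add: lie_bracket_def matrix_mult_simps matrix_mul_assoc)

lemma linear_conj_transpose: "linear conj_transpose"
  by (rule linearI) (simp_all add: conj_transpose_def vec_eq_iff)

lemma bounded_linear_conj_transpose: "bounded_linear (conj_transpose :: 'n::finite cmat \<Rightarrow> 'n cmat)"
  using linear_conj_transpose by (simp add: linear_conv_bounded_linear)

lemma conj_transpose_conj_transpose [simp]: "conj_transpose (conj_transpose X) = X"
  by (simp add: conj_transpose_def vec_eq_iff)

lemma conj_transpose_mat_1 [simp]: "conj_transpose (mat 1) = mat 1"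
  by (simp add: conj_transpose_def mat_def vec_eq_iff)

lemma conj_transpose_mult: "conj_transpose (X ** Y) = conj_transpose Y ** conj_transpose X"
  by (simp add: conj_transpose_def matrix_matrix_mult_def vec_eq_iff mult.commute)

lemma inner_cmat: "X \<bullet> Y = Re (trace (X ** conj_transpose Y))" for X Y :: "'n::finite cmat"
  by (simp add: inner_vec_def inner_complex_def trace_def matrix_matrix_mult_def conj_transpose_def)

lemma inner_mult_left: "(A ** X) \<bullet> Y = X \<bullet> (conj_transpose A ** Y)" for X Y :: "'n::finite cmat"
  by (simp add: inner_cmat conj_transpose_mult) (metis matrix_mul_assoc trace_mul_sym)

lemma inner_mult_right: "(X ** A) \<bullet> Y = X \<bullet> (Y ** conj_transpose A)" for X Y :: "'n::finite cmat"
  by (simp add: inner_cmat conj_transpose_mult matrix_mul_assoc)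

text \<open>Ad-invariance of the trace inner product; it makes the covariant derivative
  metric.\<close>

lemma inner_lie_bracket:
  fixes X Y :: "'n::finite cmat"
  assumes "conj_transpose A = - A"
  shows "lie_bracket A X \<bullet> Y = - (X \<bullet> lie_bracket A Y)"
  by (simp add: lie_bracket_def inner_diff_left inner_diff_right inner_mult_left[of A X Y]
      inner_mult_right[of X A Y] assms matrix_mult_simps)

lemma trace_inner_eq_inner:
  "conj_transpose Y = - Y \<Longrightarrow> trace_inner X Y = X \<bullet> Y"
  by (simp add: trace_inner_def inner_cmat matrix_mult_simps)
    (simp add: trace_def sum_negf)

text \<open>Pair f with the component q of f' v orthogonal to L: the pairing is constantly zero,
  hence so is its derivative, q \<bullet> q.\<close>

lemma derivative_in_subspace:
  fixes f :: "'a::real_normed_vector \<Rightarrow> 'b::euclidean_space"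
  assumes L: "subspace L" and S: "open S" "x \<in> S" and f: "\<And>y. y \<in> S \<Longrightarrow> f y \<in> L"
    and d: "(f has_derivative f') (at x)"
  shows "f' v \<in> L"
proof -
  obtain p q where p: "p \<in> span L" and q: "\<And>w. w \<in> span L \<Longrightarrow> orthogonal q w" and v: "f' v = p + q"
    using orthogonal_subspace_decomp_exists[of L "f' v"] by metis
  have sL: "span L = L" using L by (simp add: span_eq_iff)
  have q0: "w \<bullet> q = 0" if "w \<in> L" for w
    using q[of w] that sL by (simp add: orthogonal_def inner_commute)
  have "((\<lambda>y. f y \<bullet> q) has_derivative (\<lambda>v. f' v \<bullet> q)) (at x)"
    by (intro derivative_intros d)
  moreover have "((\<lambda>y. f y \<bullet> q) has_derivative (\<lambda>v. 0)) (at x)"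
    by (rule has_derivative_transform_within_open[OF has_derivative_const[of 0] S]) (simp add: q0 f)
  ultimately have "f' v \<bullet> q = 0"
    using has_derivative_unique by metis
  then have "q \<bullet> q = 0" using v q0[of p] p sL by (simp add: inner_add_left)
  then show ?thesis using v p sL by simp
qed

section \<open>Compact subgroups of the unitary group and their tangent space at the
  identity\<close>

locale unitary_group =
  fixes G :: "'n::finite cmat set"
  assumes G: "compact_unitary_group G"
begin

lemma one_mem: "mat 1 \<in> G" and mult_mem: "g \<in> G \<Longrightarrow> h \<in> G \<Longrightarrow> g ** h \<in> G"
  and inv_mem: "g \<in> G \<Longrightarrow> matrix_inv g \<in> G"
  and mult_conj_transpose: "g \<in> G \<Longrightarrow> g ** conj_transpose g = mat 1"
  using G by (auto simp: compact_unitary_group_def)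

lemma conj_transpose_mult_self: "g \<in> G \<Longrightarrow> conj_transpose g ** g = mat 1"
  using mult_conj_transpose matrix_left_right_inverse by blast

lemma matrix_inv_eq: "g \<in> G \<Longrightarrow> matrix_inv g = conj_transpose g"
proof -
  assume g: "g \<in> G"
  have "g ** matrix_inv g = mat 1 \<and> matrix_inv g ** g = mat 1"
    unfolding matrix_inv_def
    by (rule someI[of _ "conj_transpose g"]) (simp add: g mult_conj_transpose conj_transpose_mult_self)
  then show ?thesis
    using conj_transpose_mult_self[OF g] by (metis matrix_mul_assoc matrix_mul_lid matrix_mul_rid)
qed

lemma mult_matrix_inv: "g \<in> G \<Longrightarrow> g ** matrix_inv g = mat 1"
  and matrix_inv_mult: "g \<in> G \<Longrightarrow> matrix_inv g ** g = mat 1"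
  by (simp_all add: matrix_inv_eq mult_conj_transpose conj_transpose_mult_self)

lemma inner_conjugate:
  assumes "g \<in> G"
  shows "(matrix_inv g ** X ** g) \<bullet> (matrix_inv g ** Y ** g) = X \<bullet> Y"
proof -
  have "(matrix_inv g ** X ** g) \<bullet> Z = X \<bullet> (conj_transpose (matrix_inv g) ** (Z ** conj_transpose g))" for Z
    using inner_mult_right[of "matrix_inv g ** X" g Z] inner_mult_left[of "matrix_inv g" X] by simp
  then have "(matrix_inv g ** X ** g) \<bullet> (matrix_inv g ** Y ** g) =
      X \<bullet> ((g ** matrix_inv g) ** Y ** (g ** matrix_inv g))"
    by (simp add: matrix_inv_eq[OF assms] matrix_mul_assoc)
  then show ?thesis by (simp add: mult_matrix_inv[OF assms])
qed

lemma conjugate_eqI: "g \<in> G \<Longrightarrow> g ** Y = X ** g \<Longrightarrow> Y = matrix_inv g ** X ** g"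
  by (metis matrix_inv_mult matrix_mul_assoc matrix_mul_lid)

lemma lie_algebraI:
  "(\<And>t::real. \<gamma> t \<in> G) \<Longrightarrow> \<gamma> 0 = mat 1 \<Longrightarrow> (\<gamma> has_derivative (\<lambda>t. t *\<^sub>R X)) (at 0) \<Longrightarrow>
    X \<in> lie_algebra G"
  unfolding lie_algebra_def has_vector_derivative_def by blast

lemma lie_algebraE:
  assumes "X \<in> lie_algebra G"
  obtains \<gamma> where "\<And>t::real. \<gamma> t \<in> G" "\<gamma> 0 = mat 1" "(\<gamma> has_derivative (\<lambda>t. t *\<^sub>R X)) (at 0)"
  using assms unfolding lie_algebra_def has_vector_derivative_def by blast

text \<open>Sums are the velocities of products of curves, multiples those of reparametrised
  curves.\<close>

lemma subspace_lie_algebra: "subspace (lie_algebra G)"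
proof (rule subspaceI)
  show "0 \<in> lie_algebra G"
    by (rule lie_algebraI[of "\<lambda>t. mat 1"]) (auto simp: one_mem)
next
  fix X Y assume "X \<in> lie_algebra G" "Y \<in> lie_algebra G"
  then obtain \<gamma> \<delta> where
    \<gamma>: "\<And>t::real. \<gamma> t \<in> G" "\<gamma> 0 = mat 1" "(\<gamma> has_derivative (\<lambda>t. t *\<^sub>R X)) (at 0)" and
    \<delta>: "\<And>t::real. \<delta> t \<in> G" "\<delta> 0 = mat 1" "(\<delta> has_derivative (\<lambda>t. t *\<^sub>R Y)) (at 0)"
    using lie_algebraE by metis
  have "((\<lambda>t. \<gamma> t ** \<delta> t) has_derivative (\<lambda>t. \<gamma> 0 ** (t *\<^sub>R Y) + (t *\<^sub>R X) ** \<delta> 0)) (at 0)"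
    by (rule bounded_bilinear.FDERIV[OF bounded_bilinear_matrix_mult \<gamma>(3) \<delta>(3)])
  then have "((\<lambda>t. \<gamma> t ** \<delta> t) has_derivative (\<lambda>t. t *\<^sub>R (X + Y))) (at 0)"
    by (simp add: \<gamma> \<delta> scaleR_add_right add.commute)
  then show "X + Y \<in> lie_algebra G"
    by (rule lie_algebraI[rotated 2]) (auto simp: \<gamma> \<delta> mult_mem)
next
  fix c :: real and X assume "X \<in> lie_algebra G"
  then obtain \<gamma> where \<gamma>: "\<And>t::real. \<gamma> t \<in> G" "\<gamma> 0 = mat 1" "(\<gamma> has_derivative (\<lambda>t. t *\<^sub>R X)) (at 0)"
    by (rule lie_algebraE) blast
  have "((\<lambda>t. c * t) has_derivative (\<lambda>t. c * t)) (at (0::real))"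
    by (auto intro!: derivative_eq_intros)
  from has_derivative_compose[OF this, of \<gamma>, simplified, OF \<gamma>(3)]
  have "((\<lambda>t. \<gamma> (c * t)) has_derivative (\<lambda>t. t *\<^sub>R (c *\<^sub>R X))) (at 0)"
    by (simp add: mult.commute)
  then show "c *\<^sub>R X \<in> lie_algebra G"
    by (rule lie_algebraI[rotated 2]) (auto simp: \<gamma>)
qed

lemma conjugate_mem_lie_algebra:
  assumes "X \<in> lie_algebra G" "g \<in> G"
  shows "matrix_inv g ** X ** g \<in> lie_algebra G"
proof -
  obtain \<gamma> where \<gamma>: "\<And>t::real. \<gamma> t \<in> G" "\<gamma> 0 = mat 1" "(\<gamma> has_derivative (\<lambda>t. t *\<^sub>R X)) (at 0)"
    using assms(1) by (rule lie_algebraE) blast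
  have "bounded_linear (\<lambda>Z. matrix_inv g ** Z ** g)"
    by (intro bounded_linear_compose[OF bounded_bilinear.bounded_linear_left[OF bounded_bilinear_matrix_mult]]
        bounded_bilinear.bounded_linear_right[OF bounded_bilinear_matrix_mult])
  from bounded_linear.has_derivative[OF this \<gamma>(3)]
  have "((\<lambda>t. matrix_inv g ** \<gamma> t ** g) has_derivative (\<lambda>t. t *\<^sub>R (matrix_inv g ** X ** g))) (at 0)"
    by (simp add: matrix_mult_simps)
  then show ?thesis
    by (rule lie_algebraI[rotated 2]) (auto simp: \<gamma> mult_mem inv_mem assms(2) matrix_inv_mult)
qed

text \<open>Differentiate the relation \<gamma> \<gamma>* = 1 along a curve \<gamma> in the
  group.\<close>

lemma lie_algebra_skew:
  assumes "X \<in> lie_algebra G"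
  shows "conj_transpose X = - X"
proof -
  obtain \<gamma> where \<gamma>: "\<And>t::real. \<gamma> t \<in> G" "\<gamma> 0 = mat 1" "(\<gamma> has_derivative (\<lambda>t. t *\<^sub>R X)) (at 0)"
    using assms by (rule lie_algebraE) blast
  have "((\<lambda>t. conj_transpose (\<gamma> t)) has_derivative (\<lambda>t. conj_transpose (t *\<^sub>R X))) (at 0)"
    by (rule bounded_linear.has_derivative[OF bounded_linear_conj_transpose \<gamma>(3)])
  from bounded_bilinear.FDERIV[OF bounded_bilinear_matrix_mult \<gamma>(3) this]
  have "((\<lambda>t. mat 1) has_derivative (\<lambda>t. t *\<^sub>R (conj_transpose X + X))) (at (0::real))"
    by (simp add: \<gamma> mult_conj_transpose linear_scale[OF linear_conj_transpose] scaleR_add_right)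
  from has_derivative_unique[OF this has_derivative_const]
  have "1 *\<^sub>R (conj_transpose X + X) = 0" by metis
  then show ?thesis by (simp add: eq_neg_iff_add_eq_0)
qed

text \<open>The bracket is the derivative at 0 of the curve \<gamma>* X \<gamma>, which stays in a
  linear subspace.\<close>

lemma lie_bracket_mem_lie_algebra:
  assumes "X \<in> lie_algebra G" "Y \<in> lie_algebra G"
  shows "lie_bracket X Y \<in> lie_algebra G"
proof -
  obtain \<gamma> where \<gamma>: "\<And>t::real. \<gamma> t \<in> G" "\<gamma> 0 = mat 1" "(\<gamma> has_derivative (\<lambda>t. t *\<^sub>R Y)) (at 0)"
    using assms(2) by (rule lie_algebraE) blast
  have "((\<lambda>t. conj_transpose (\<gamma> t)) has_derivative (\<lambda>t. conj_transpose (t *\<^sub>R Y))) (at 0)"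
    by (rule bounded_linear.has_derivative[OF bounded_linear_conj_transpose \<gamma>(3)])
  then have "((\<lambda>t. conj_transpose (\<gamma> t) ** X) has_derivative (\<lambda>t. conj_transpose (t *\<^sub>R Y) ** X)) (at 0)"
    by (rule bounded_linear.has_derivative[OF bounded_bilinear.bounded_linear_left[OF bounded_bilinear_matrix_mult]])
  from bounded_bilinear.FDERIV[OF bounded_bilinear_matrix_mult this \<gamma>(3)]
  have d: "((\<lambda>t. conj_transpose (\<gamma> t) ** X ** \<gamma> t) has_derivative (\<lambda>t. t *\<^sub>R lie_bracket X Y)) (at 0)"
    by (simp add: \<gamma> matrix_mult_simps lie_bracket_def linear_scale[OF linear_conj_transpose]
        lie_algebra_skew[OF assms(2)] scaleR_diff_right)
  have "conj_transpose (\<gamma> t) ** X ** \<gamma> t \<in> lie_algebra G" for t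
    using conjugate_mem_lie_algebra[OF assms(1) \<gamma>(1)] matrix_inv_eq[OF \<gamma>(1)] by simp
  from derivative_in_subspace[OF subspace_lie_algebra open_UNIV UNIV_I this d, of 1]
  show ?thesis by simp
qed

end

section \<open>Covariant derivatives in a local trivialisation\<close>

lemma smooth_on_lie_bracket:
  "open S \<Longrightarrow> smooth_on S f \<Longrightarrow> smooth_on S h \<Longrightarrow> smooth_on S (\<lambda>x. lie_bracket (f x) (h x))"
  by (rule smooth_on_prod[OF bounded_bilinear_lie_bracket])

lemmas dir_deriv_lie_bracket = bounded_bilinear.dir_deriv_prod[OF bounded_bilinear_lie_bracket]
lemmas differentiable_lie_bracket = bounded_bilinear.differentiable_prod[OF bounded_bilinear_lie_bracket]
lemmas dir_deriv_matrix_mult = bounded_bilinear.dir_deriv_prod[OF bounded_bilinear_matrix_mult]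
lemmas differentiable_matrix_mult = bounded_bilinear.differentiable_prod[OF bounded_bilinear_matrix_mult]

lemma dA0_cong:
  assumes "open S" "x \<in> S" "\<And>y. y \<in> S \<Longrightarrow> f y = h y"
  shows "dA0 a f x v = dA0 a h x v"
  using dir_deriv_cong[OF assms] assms(2,3) by (simp add: dA0_def)

lemma dA0_add:
  assumes "f differentiable (at x)" "h differentiable (at x)"
  shows "dA0 a (\<lambda>y. f y + h y) x v = dA0 a f x v + dA0 a h x v"
  by (simp add: dA0_def dir_deriv_add[OF assms] lie_bracket_simps)

lemma dA0_minus:
  assumes "f differentiable (at x)"
  shows "dA0 a (\<lambda>y. - f y) x v = - dA0 a f x v"
  by (simp add: dA0_def dir_deriv_minus[OF assms] lie_bracket_simps)

lemma dA0_scaleR: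
  assumes "r differentiable (at x)" "f differentiable (at x)"
  shows "dA0 a (\<lambda>y. r y *\<^sub>R f y) x v = dir_deriv r x v *\<^sub>R f x + r x *\<^sub>R dA0 a f x v"
  by (simp add: dA0_def bounded_bilinear.dir_deriv_prod[OF bounded_bilinear_scaleR assms]
      lie_bracket_simps scaleR_add_right)

lemma dA2_eq_dA0:
  "dA2 a \<beta> x u v w = dA0 a (\<lambda>y. \<beta> y v w) x u + dA0 a (\<lambda>y. \<beta> y w u) x v + dA0 a (\<lambda>y. \<beta> y u v) x w"
  by (simp add: dA2_def dA0_def)

locale local_connection =
  fixes S :: "cvec set" and a :: "cvec \<Rightarrow> cvec \<Rightarrow> 'n::finite cmat"
  assumes S: "open S" and linear_a: "\<And>x. x \<in> S \<Longrightarrow> linear (a x)"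
    and smooth_a: "\<And>v. smooth_on S (\<lambda>x. a x v)"
    and skew_a: "\<And>x v. x \<in> S \<Longrightarrow> conj_transpose (a x v) = - a x v"
begin

lemma differentiable_a: "x \<in> S \<Longrightarrow> (\<lambda>y. a y v) differentiable (at x)"
  by (rule smooth_on_differentiable[OF smooth_a])

lemma dir_deriv_a_linear:
  assumes "x \<in> S"
  shows "linear (\<lambda>w. dir_deriv (\<lambda>y. a y w) x v)"
proof (rule linearI)
  fix p q :: cvec and r :: real
  have "dir_deriv (\<lambda>y. a y (p + q)) x v = dir_deriv (\<lambda>y. a y p + a y q) x v"
    by (rule dir_deriv_cong[OF S assms]) (simp add: linear_add[OF linear_a])
  then show "dir_deriv (\<lambda>y. a y (p + q)) x v = dir_deriv (\<lambda>y. a y p) x v + dir_deriv (\<lambda>y. a y q) x v"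
    by (simp add: dir_deriv_add differentiable_a assms)
  have "dir_deriv (\<lambda>y. a y (r *\<^sub>R p)) x v = dir_deriv (\<lambda>y. r *\<^sub>R a y p) x v"
    by (rule dir_deriv_cong[OF S assms]) (simp add: linear_scale[OF linear_a])
  then show "dir_deriv (\<lambda>y. a y (r *\<^sub>R p)) x v = r *\<^sub>R dir_deriv (\<lambda>y. a y p) x v"
    by (simp add: bounded_linear.dir_deriv_image[OF bounded_linear_scaleR_right] differentiable_a assms)
qed

lemma bilinear_curvature: "x \<in> S \<Longrightarrow> bilinear (curvature a x)"
  unfolding bilinear_def curvature_def
  by (auto intro!: linearI simp: linear_add[OF dir_deriv_a_linear] linear_scale[OF dir_deriv_a_linear]
      linear_add[OF linear_a] linear_scale[OF linear_a] lie_bracket_simps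
      dir_deriv_add_right dir_deriv_scaleR_right differentiable_a scaleR_diff_right scaleR_add_right)

lemma curvature_self: "curvature a x v v = 0"
  by (simp add: curvature_def)

lemma smooth_curvature: "smooth_on S (\<lambda>x. curvature a x u v)"
  unfolding curvature_def
  by (intro smooth_on_add smooth_on_diff smooth_on_dir_deriv smooth_on_lie_bracket smooth_a S)

lemma smooth_dA0: "smooth_on S f \<Longrightarrow> smooth_on S (\<lambda>x. dA0 a f x v)"
  unfolding dA0_def
  by (intro smooth_on_add smooth_on_dir_deriv smooth_on_lie_bracket smooth_a S)

lemma dA0_linear:
  assumes "x \<in> S" "f differentiable (at x)"
  shows "linear (dA0 a f x)"
  unfolding dA0_def
  by (auto intro!: linearI simp: dir_deriv_add_right dir_deriv_scaleR_right assms lie_bracket_simps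
      linear_add[OF linear_a] linear_scale[OF linear_a] scaleR_add_right)

text \<open>The bracket terms on the right cancel by ad-invariance.\<close>

lemma dA0_metric_compatible:
  assumes "x \<in> S" "f differentiable (at x)" "h differentiable (at x)"
  shows "dir_deriv (\<lambda>y. f y \<bullet> h y) x v = dA0 a f x v \<bullet> h x + f x \<bullet> dA0 a h x v"
proof -
  have "dir_deriv (\<lambda>y. f y \<bullet> h y) x v = f x \<bullet> dir_deriv h x v + dir_deriv f x v \<bullet> h x"
    by (rule bounded_bilinear.dir_deriv_prod[OF bounded_bilinear_inner assms(2,3)])
  then show ?thesis
    using inner_lie_bracket[OF skew_a[OF assms(1)], of v "f x" "h x"]
    by (simp add: dA0_def inner_add_left inner_add_right)
qed

lemma dA0_dA0:
  assumes x: "x \<in> S" and f: "smooth_on S f"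
  shows "dA0 a (\<lambda>y. dA0 a f y w) x v =
    dir_deriv (\<lambda>y. dir_deriv f y w) x v + lie_bracket (a x w) (dir_deriv f x v)
    + lie_bracket (dir_deriv (\<lambda>y. a y w) x v) (f x)
    + lie_bracket (a x v) (dir_deriv f x w) + lie_bracket (a x v) (lie_bracket (a x w) (f x))"
proof -
  note d = smooth_on_differentiable[OF f x] smooth_on_dir_deriv_differentiable[OF f x] differentiable_a[OF x]
  show ?thesis
    unfolding dA0_def
    by (simp add: dir_deriv_add dir_deriv_lie_bracket d differentiable_lie_bracket lie_bracket_simps)
qed

text \<open>Ricci identity for constant coordinate vectors: second derivatives cancel by symmetry,
  double brackets combine by the Jacobi identity.\<close>

lemma dA0_commutator:
  assumes x: "x \<in> S" and f: "smooth_on S f"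
  shows "dA0 a (\<lambda>y. dA0 a f y w) x v - dA0 a (\<lambda>y. dA0 a f y v) x w =
    lie_bracket (curvature a x v w) (f x)"
  unfolding dA0_dA0[OF x f] second_deriv_symmetric[OF S x f, of v w] curvature_def
  by (simp add: lie_bracket_simps jacobi[of "a x v" "a x w"] algebra_simps)

text \<open>Bianchi identity: in the cyclic sum second derivatives cancel by symmetry, brackets with
  first derivatives cancel in pairs, and triple brackets cancel by Jacobi.\<close>

lemma dA2_curvature:
  assumes x: "x \<in> S"
  shows "dA2 a (curvature a) x u v w = 0"
proof -
  have D: "dir_deriv (\<lambda>y. curvature a y v w) x u =
    dir_deriv (\<lambda>y. dir_deriv (\<lambda>y. a y w) y v) x u - dir_deriv (\<lambda>y. dir_deriv (\<lambda>y. a y v) y w) x u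
    + (lie_bracket (a x v) (dir_deriv (\<lambda>y. a y w) x u) + lie_bracket (dir_deriv (\<lambda>y. a y v) x u) (a x w))" for u v w
    unfolding curvature_def
    by (simp add: dir_deriv_add dir_deriv_diff dir_deriv_lie_bracket differentiable_lie_bracket differentiable_a[OF x]
        smooth_on_dir_deriv_differentiable[OF smooth_a x])
  note sym = second_deriv_symmetric[OF S x smooth_a]
  show ?thesis
    unfolding dA2_def D
    unfolding curvature_def sym[where u=u and v=v] sym[where u=v and v=w] sym[where u=w and v=u]
    unfolding lie_bracket_simps jacobi[of "a x u" "a x v" "a x w"]
      lie_bracket_swap[of "a x w" "lie_bracket (a x u) (a x v)"]
      lie_bracket_swap[of "a x w" "a x u"]
      lie_bracket_swap[of "dir_deriv _ x _" "a x _"]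
    by (simp add: lie_bracket_simps)
qed

end

text \<open>The gauge law is used in the form g b = a g + dg, which avoids differentiating an
  inverse. After antisymmetrisation the second derivatives of g cancel.\<close>

lemma curvature_gauge:
  fixes a b :: "cvec \<Rightarrow> cvec \<Rightarrow> 'n::finite cmat"
  assumes S: "open S" "x \<in> S" and a: "\<And>v. smooth_on S (\<lambda>x. a x v)" and b: "\<And>v. smooth_on S (\<lambda>x. b x v)"
    and g: "smooth_on S g"
    and eq: "\<And>y v. y \<in> S \<Longrightarrow> g y ** b y v = a y v ** g y + dir_deriv g y v"
  shows "g x ** curvature b x u v = curvature a x u v ** g x"
proof -
  note dg = smooth_on_differentiable[OF g S(2)] and da = smooth_on_differentiable[OF a S(2)]
    and db = smooth_on_differentiable[OF b S(2)] and d2g = smooth_on_dir_deriv_differentiable[OF g S(2)]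
  have D: "g x ** dir_deriv (\<lambda>y. b y v) x u =
      a x v ** dir_deriv g x u + dir_deriv (\<lambda>y. a y v) x u ** g x
      + dir_deriv (\<lambda>y. dir_deriv g y v) x u - dir_deriv g x u ** b x v" for u v
  proof -
    have "dir_deriv (\<lambda>y. g y ** b y v) x u = dir_deriv (\<lambda>y. a y v ** g y + dir_deriv g y v) x u"
      by (rule dir_deriv_cong[OF S eq])
    then show ?thesis
      by (simp add: dir_deriv_add dir_deriv_matrix_mult dg da db d2g differentiable_matrix_mult algebra_simps)
  qed
  have dgx: "dir_deriv g x v = g x ** b x v - a x v ** g x" for v
    using eq[OF S(2), of v] by simp
  show ?thesis
    unfolding curvature_def lie_bracket_def matrix_mult_simps D second_deriv_symmetric[OF S g, of u v] dgx
    by (simp add: matrix_mult_simps matrix_mul_assoc)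
qed

text \<open>Differentiating the pulled-back potential adds b applied to the second derivative of
  \<tau>; this term is symmetric and drops out of the curvature.\<close>

lemma curvature_chart_change:
  fixes a b :: "cvec \<Rightarrow> cvec \<Rightarrow> 'n::finite cmat"
  assumes xS: "open S" "x \<in> S" and \<tau>: "smooth_on S \<tau>" "\<And>y. y \<in> S \<Longrightarrow> \<tau> y \<in> T"
    and b: "local_connection T b"
    and eq: "\<And>y v. y \<in> S \<Longrightarrow> a y v = b (\<tau> y) (dir_deriv \<tau> y v)"
  shows "curvature a x u v = curvature b (\<tau> x) (dir_deriv \<tau> x u) (dir_deriv \<tau> x v)"
proof -
  interpret local_connection T b by (rule b)
  have \<tau>x: "\<tau> x \<in> T" using \<tau>(2)[OF xS(2)] .
  note d\<tau> = smooth_on_differentiable[OF \<tau>(1) xS(2)] and d2\<tau> = smooth_on_dir_deriv_differentiable[OF \<tau>(1) xS(2)]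
  have lin_exp: "L w = (\<Sum>i\<in>Basis. (w \<bullet> i) *\<^sub>R L i)" if "linear L" for L :: "cvec \<Rightarrow> 'n cmat" and w
    using linear_sum[OF that, of "\<lambda>i. (w \<bullet> i) *\<^sub>R i" Basis] linear_scale[OF that]
    by (simp add: euclidean_representation)
  have D: "dir_deriv (\<lambda>y. a y v) x u = b (\<tau> x) (dir_deriv (\<lambda>y. dir_deriv \<tau> y v) x u)
      + dir_deriv (\<lambda>z. b z (dir_deriv \<tau> x v)) (\<tau> x) (dir_deriv \<tau> x u)" for u v
  proof -
    \<comment> \<open>The potential is differentiated in its base point and in its vector argument
      at once; the expansion over \<open>Basis\<close> turns this into the product rule.\<close>
    have "((\<lambda>y. \<Sum>i\<in>Basis. (dir_deriv \<tau> y v \<bullet> i) *\<^sub>R b (\<tau> y) i) has_derivative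
      (\<lambda>u. \<Sum>i\<in>Basis. (dir_deriv \<tau> x v \<bullet> i) *\<^sub>R dir_deriv (\<lambda>z. b z i) (\<tau> x) (dir_deriv \<tau> x u) +
        (dir_deriv (\<lambda>y. dir_deriv \<tau> y v) x u \<bullet> i) *\<^sub>R b (\<tau> x) i)) (at x)"
    proof (rule has_derivative_sum)
      fix i :: cvec
      have "((\<lambda>y. b (\<tau> y) i) has_derivative (\<lambda>u. dir_deriv (\<lambda>z. b z i) (\<tau> x) (dir_deriv \<tau> x u))) (at x)"
        using diff_chain_at[OF has_derivative_dir_deriv[OF d\<tau>] has_derivative_dir_deriv[OF differentiable_a[OF \<tau>x]]]
        by (simp add: o_def)
      moreover have "((\<lambda>y. dir_deriv \<tau> y v \<bullet> i) has_derivative (\<lambda>u. dir_deriv (\<lambda>y. dir_deriv \<tau> y v) x u \<bullet> i)) (at x)"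
        by (intro has_derivative_inner_left has_derivative_dir_deriv d2\<tau>)
      ultimately show "((\<lambda>y. (dir_deriv \<tau> y v \<bullet> i) *\<^sub>R b (\<tau> y) i) has_derivative
        (\<lambda>u. (dir_deriv \<tau> x v \<bullet> i) *\<^sub>R dir_deriv (\<lambda>z. b z i) (\<tau> x) (dir_deriv \<tau> x u) +
        (dir_deriv (\<lambda>y. dir_deriv \<tau> y v) x u \<bullet> i) *\<^sub>R b (\<tau> x) i)) (at x)"
        by (intro has_derivative_scaleR)
    qed
    note 1 = dir_deriv_eqI[OF this, of u]
    have "dir_deriv (\<lambda>y. a y v) x u = dir_deriv (\<lambda>y. \<Sum>i\<in>Basis. (dir_deriv \<tau> y v \<bullet> i) *\<^sub>R b (\<tau> y) i) x u"
      by (rule dir_deriv_cong[OF xS]) (simp add: eq lin_exp[OF linear_a[OF \<tau>(2)], symmetric])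
    then show ?thesis
      unfolding 1 sum.distrib lin_exp[OF linear_a[OF \<tau>x], symmetric]
        lin_exp[OF dir_deriv_a_linear[OF \<tau>x], symmetric] by (simp add: add.commute)
  qed
  show ?thesis
    unfolding curvature_def D second_deriv_symmetric[OF xS \<tau>(1), of u v]
    by (simp add: eq[OF xS(2)])
qed

section \<open>The self-dual part of the curvature\<close>

text \<open>For a two-form with vanishing contraction this is \<beta> + star \<beta>, twice the
  self-dual part, by \<open>hodge2_eq\<close>.\<close>

definition J_anti :: "(cvec \<Rightarrow> cvec \<Rightarrow> 'w::real_vector) \<Rightarrow> cvec \<Rightarrow> cvec \<Rightarrow> 'w" where
  "J_anti \<beta> u v = \<beta> u v - \<beta> (Jmul u) (Jmul v)"

text \<open>
  If \<open>\<Theta>\<close> is a complex volume form, then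
  \<open>J_anti \<beta> = Re \<Theta> \<otimes> theta_coeff 1 \<Theta> \<beta> + Im \<Theta> \<otimes> theta_coeff \<i> \<Theta> \<beta>\<close>.
\<close>

definition theta_coeff ::
    "complex \<Rightarrow> (cvec \<Rightarrow> cvec \<Rightarrow> complex) \<Rightarrow> (cvec \<Rightarrow> cvec \<Rightarrow> 'w::real_vector) \<Rightarrow> 'w" where
  "theta_coeff z \<Theta> \<beta> =
     Re (z / \<Theta> (axis 1 1) (axis 2 1)) *\<^sub>R J_anti \<beta> (axis 1 1) (axis 2 1)
     + Im (z / \<Theta> (axis 1 1) (axis 2 1)) *\<^sub>R J_anti \<beta> (axis 1 1) (Jmul (axis 2 1))"

definition complex_volume :: "(cvec \<Rightarrow> cvec \<Rightarrow> complex) \<Rightarrow> bool" where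
  "complex_volume \<Theta> \<longleftrightarrow> bilinear \<Theta> \<and> (\<forall>v. \<Theta> v v = 0) \<and> (\<forall>u v. \<Theta> (Jmul u) v = \<i> * \<Theta> u v) \<and>
     \<Theta> (axis 1 1) (axis 2 1) \<noteq> 0"

lemma complex_volume_formula:
  "complex_volume \<Theta> \<Longrightarrow> \<Theta> u v = \<Theta> (axis 1 1) (axis 2 1) * (u $ 1 * v $ 2 - u $ 2 * v $ 1)"
  unfolding complex_volume_def using complex_volume_expand by blast

text \<open>This isolates coefficients: an identity in Re and Im of \<Theta>(u, w), valid for all w,
  is tested where \<Theta>(u, w) is 1 or \<i>.\<close>

lemma complex_volume_surj:
  assumes "complex_volume \<Theta>" "u \<noteq> 0"
  shows "\<exists>w. \<Theta> u w = z"
proof -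
  define t where "t = \<Theta> (axis 1 1) (axis 2 1)"
  have t: "t \<noteq> 0" using assms by (simp add: complex_volume_def t_def)
  have *: "\<Theta> u w = t * (u $ 1 * w $ 2 - u $ 2 * w $ 1)" for w
    unfolding t_def by (rule complex_volume_formula[OF assms(1)])
  show ?thesis
  proof (cases "u $ 1 = 0")
    case True
    then have "u $ 2 \<noteq> 0" using assms(2) by (auto simp: vec_eq_iff forall_2)
    then show ?thesis
      using t True by (intro exI[of _ "axis 1 (- z / (t * u $ 2))"]) (simp add: * axis_def)
  next
    case False
    then show ?thesis
      using t by (intro exI[of _ "axis 2 (z / (t * u $ 1))"]) (simp add: * axis_def)
  qed
qed

lemma bilinear_J_anti: "bilinear \<beta> \<Longrightarrow> bilinear (J_anti \<beta>)"
  unfolding bilinear_def[of "J_anti \<beta>"] J_anti_def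
  by (auto intro!: linearI simp: bilinear_simps Jmul_simps algebra_simps)

text \<open>\<open>J_anti \<beta>\<close> depends on u and v only through their determinant, hence
  only through \<Theta>(u, v). This gives \<open>theta_coeff\<close> a meaning independent of the
  standard basis in its definition.\<close>

lemma J_anti_eq_theta_coeff:
  assumes \<beta>: "bilinear \<beta>" "\<And>v. \<beta> v v = 0" and \<Theta>: "complex_volume \<Theta>" and z: "\<Theta> u v = z"
  shows "J_anti \<beta> u v = theta_coeff z \<Theta> \<beta>"
proof -
  have "J_anti \<beta> (Jmul u) (Jmul v) = - J_anti \<beta> u v" for u v
    by (simp add: J_anti_def bilinear_simps[OF \<beta>(1)])
  moreover have "J_anti \<beta> v v = 0" for v by (simp add: J_anti_def \<beta>(2))
  moreover have "u $ 1 * v $ 2 - u $ 2 * v $ 1 = z / \<Theta> (axis 1 1) (axis 2 1)"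
    using complex_volume_formula[OF \<Theta>, of u v] \<Theta> z by (simp add: complex_volume_def field_simps)
  ultimately show ?thesis
    using J_anti_invariant_form_expand[OF bilinear_J_anti[OF \<beta>(1)], of u v]
    by (simp add: theta_coeff_def)
qed

lemma J_anti_decompose:
  assumes \<beta>: "bilinear \<beta>" "\<And>v. \<beta> v v = 0" and \<Theta>: "complex_volume \<Theta>"
  shows "J_anti \<beta> u v = Re (\<Theta> u v) *\<^sub>R theta_coeff 1 \<Theta> \<beta> + Im (\<Theta> u v) *\<^sub>R theta_coeff \<i> \<Theta> \<beta>"
proof -
  define t where "t = \<Theta> (axis 1 1) (axis 2 1)"
  define w where "w = 1 / t"
  have zt: "z / t = z * w" for z by (simp add: w_def)
  show ?thesis
    unfolding J_anti_eq_theta_coeff[OF \<beta> \<Theta> refl]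
    unfolding theta_coeff_def t_def[symmetric] zt by (simp add: algebra_simps)
qed

text \<open>Take a pair with \<Theta>-value z: its image under L has \<Theta>'-value z and the same
  value of \<open>J_anti\<close>, as L commutes with J.\<close>

lemma theta_coeff_pullback:
  assumes \<beta>: "bilinear \<beta>" "\<And>v. \<beta> v v = 0" and \<Theta>: "complex_volume \<Theta>"
    and \<beta>': "bilinear \<beta>'" "\<And>v. \<beta>' v v = 0" and \<Theta>': "complex_volume \<Theta>'"
    and J: "\<And>v. L (Jmul v) = Jmul (L v)"
    and pb: "\<And>u v. \<beta> u v = \<beta>' (L u) (L v)" "\<And>u v. \<Theta> u v = \<Theta>' (L u) (L v)"
  shows "theta_coeff z \<Theta> \<beta> = theta_coeff z \<Theta>' \<beta>'"
proof -
  obtain w where w: "\<Theta> (axis 1 1) w = z"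
    using complex_volume_surj[OF \<Theta>, of "axis 1 1"] by auto
  then have w': "\<Theta>' (L (axis 1 1)) (L w) = z" by (simp add: pb)
  have "theta_coeff z \<Theta> \<beta> = J_anti \<beta> (axis 1 1) w"
    using J_anti_eq_theta_coeff[OF \<beta> \<Theta> w] by simp
  also have "\<dots> = J_anti \<beta>' (L (axis 1 1)) (L w)" by (simp add: J_anti_def pb J)
  also have "\<dots> = theta_coeff z \<Theta>' \<beta>'" by (rule J_anti_eq_theta_coeff[OF \<beta>' \<Theta>' w'])
  finally show ?thesis .
qed

lemma theta_coeff_linear:
  assumes "linear L"
  shows "theta_coeff z \<Theta> (\<lambda>u v. L (\<beta> u v)) = L (theta_coeff z \<Theta> \<beta>)"
  by (simp add: theta_coeff_def J_anti_def linear_diff[OF assms] linear_add[OF assms] linear_scale[OF assms])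

context local_connection
begin

lemma dA2_add:
  assumes "x \<in> S" and \<beta>: "\<And>u v. smooth_on S (\<lambda>y. \<beta> y u v)" and \<gamma>: "\<And>u v. smooth_on S (\<lambda>y. \<gamma> y u v)"
  shows "dA2 a (\<lambda>y u v. \<beta> y u v + \<gamma> y u v) x u v w = dA2 a \<beta> x u v w + dA2 a \<gamma> x u v w"
  unfolding dA2_eq_dA0
  by (simp add: dA0_add smooth_on_differentiable[OF \<beta> assms(1)] smooth_on_differentiable[OF \<gamma> assms(1)])

text \<open>These are the hypotheses under which \<open>hodge3_eq_0_imp\<close> applies to a
  covariant derivative.\<close>

lemma dA2_alternating:
  assumes x: "x \<in> S" and \<beta>: "\<And>y. y \<in> S \<Longrightarrow> bilinear (\<beta> y)" "\<And>y v. y \<in> S \<Longrightarrow> \<beta> y v v = 0"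
    and sm: "\<And>u v. smooth_on S (\<lambda>y. \<beta> y u v)"
  shows "linear (dA2 a \<beta> x u v)" and "dA2 a \<beta> x u v w = - dA2 a \<beta> x v u w"
    and "dA2 a \<beta> x u v w = - dA2 a \<beta> x u w v"
proof -
  note d = smooth_on_differentiable[OF sm x]
  have lin1: "linear (\<lambda>w. dA0 a (\<lambda>y. \<beta> y v w) x u)" for u v
  proof (rule linearI)
    fix p q :: cvec and r :: real
    have "dA0 a (\<lambda>y. \<beta> y v (p + q)) x u = dA0 a (\<lambda>y. \<beta> y v p + \<beta> y v q) x u"
      by (rule dA0_cong[OF S x]) (simp add: bilinear_simps[OF \<beta>(1)])
    then show "dA0 a (\<lambda>y. \<beta> y v (p + q)) x u = dA0 a (\<lambda>y. \<beta> y v p) x u + dA0 a (\<lambda>y. \<beta> y v q) x u"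
      by (simp add: dA0_add d)
    have "dA0 a (\<lambda>y. \<beta> y v (r *\<^sub>R p)) x u = dA0 a (\<lambda>y. r *\<^sub>R \<beta> y v p) x u"
      by (rule dA0_cong[OF S x]) (simp add: bilinear_simps[OF \<beta>(1)])
    then show "dA0 a (\<lambda>y. \<beta> y v (r *\<^sub>R p)) x u = r *\<^sub>R dA0 a (\<lambda>y. \<beta> y v p) x u"
      by (simp add: dA0_scaleR d)
  qed
  have sw: "dA0 a (\<lambda>y. \<beta> y v w) x u = - dA0 a (\<lambda>y. \<beta> y w v) x u" for u v w
  proof -
    have "dA0 a (\<lambda>y. \<beta> y v w) x u = dA0 a (\<lambda>y. - \<beta> y w v) x u"
      by (rule dA0_cong[OF S x]) (rule alternating_swap[OF \<beta>])
    then show ?thesis by (simp add: dA0_minus d)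
  qed
  have lin2: "linear (\<lambda>w. dA0 a (\<lambda>y. \<beta> y w v) x u)" for u v
    unfolding sw[of _ v] by (rule linear_compose_neg[OF lin1])
  show "linear (dA2 a \<beta> x u v)"
    unfolding dA2_eq_dA0
    by (intro linear_compose_add lin1 lin2 dA0_linear x d)
  show "dA2 a \<beta> x u v w = - dA2 a \<beta> x v u w"
    unfolding dA2_eq_dA0 using sw[of v w u] sw[of u w v] sw[of u v w] by simp
  show "dA2 a \<beta> x u v w = - dA2 a \<beta> x u w v"
    unfolding dA2_eq_dA0 using sw[of v w u] sw[of u w v] sw[of u v w] by simp
qed

end

text \<open>The analytic situation in one chart and one local section. \<open>trace_free\<close> is
  the pointwise form of a vanishing contracted curvature.\<close>

locale local_yang_mills = local_connection S a
  for S :: "cvec set" and a :: "cvec \<Rightarrow> cvec \<Rightarrow> 'n::finite cmat" +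
  fixes h :: "cvec \<Rightarrow> cvec \<Rightarrow> cvec \<Rightarrow> real" and \<theta> :: "cvec \<Rightarrow> cvec \<Rightarrow> cvec \<Rightarrow> complex"
  assumes hermitian: "\<And>x. x \<in> S \<Longrightarrow> hermitian_point h x"
    and smooth_h: "\<And>u v. smooth_on S (\<lambda>x. h x u v)"
    and volume: "\<And>x. x \<in> S \<Longrightarrow> complex_volume (\<theta> x)"
    and smooth_\<theta>: "\<And>u v. smooth_on S (\<lambda>x. \<theta> x u v)"
    and closed_\<theta>: "\<And>x u v w. x \<in> S \<Longrightarrow> dir_deriv (\<lambda>y. \<theta> y v w) x u + dir_deriv (\<lambda>y. \<theta> y w u) x v
        + dir_deriv (\<lambda>y. \<theta> y u v) x w = 0"
    and yang_mills_eq: "\<And>x u. x \<in> S \<Longrightarrow> dA_adj2 h a (curvature a) x u = 0"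
    and trace_free: "\<And>x. x \<in> S \<Longrightarrow> Lambda2 h x (curvature a x) = 0"
begin

text \<open>With \<phi> = \<open>f 1\<close> - \<i> \<open>f \<i>\<close>, read in the complexified
  algebra, \<open>J_anti\<close> of the curvature is Re(\<phi> \<theta>). Two real fields are kept
  so that irreducibility can be applied to each.\<close>

abbreviation f :: "complex \<Rightarrow> cvec \<Rightarrow> 'n cmat" where
  "f z \<equiv> \<lambda>x. theta_coeff z (\<theta> x) (curvature a x)"

lemma smooth_J_anti: "smooth_on S (\<lambda>y. J_anti (curvature a y) u v)"
  unfolding J_anti_def by (intro smooth_on_diff S smooth_curvature)

lemma smooth_f: "smooth_on S (f z)"
proof -
  have "smooth_on S (\<lambda>x. z * inverse (\<theta> x (axis 1 1) (axis 2 1)))"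
    using volume by (intro smooth_on_linear[OF bounded_linear_mult_right] smooth_on_inverse S smooth_\<theta>)
      (simp add: complex_volume_def)
  then have 1: "smooth_on S (\<lambda>x. z / \<theta> x (axis 1 1) (axis 2 1))"
    by (simp add: divide_inverse)
  show ?thesis
    unfolding theta_coeff_def
    by (intro smooth_on_add smooth_on_prod[OF bounded_bilinear_scaleR] smooth_J_anti S
        smooth_on_linear[OF bounded_linear_Re S 1] smooth_on_linear[OF bounded_linear_Im S 1])
qed

lemmas differentiable_f = smooth_on_differentiable[OF smooth_f]

lemma hodge2_curvature:
  assumes "x \<in> S"
  shows "hodge2 h x (curvature a x) u v = - curvature a x (Jmul u) (Jmul v)"
proof -
  interpret hermitian_point h x by (rule hermitian[OF assms])
  show ?thesis
    using hodge2_eq[OF bilinear_curvature[OF assms] curvature_self] trace_free[OF assms] by simp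
qed

text \<open>\<open>J_anti\<close> of the curvature is F + star F, where \<beta> spells out star F.
  The Yang-Mills equation kills the star of d_A \<beta>, and \<open>hodge3_eq_0_imp\<close> turns
  this into vanishing on (u, Ju, w), the triples that the Cauchy-Riemann equations use.\<close>

lemma dA2_J_anti_curvature:
  assumes x: "x \<in> S"
  shows "dA2 a (\<lambda>y. J_anti (curvature a y)) x u (Jmul u) w = 0"
proof -
  interpret hermitian_point h x by (rule hermitian[OF x])
  define \<beta> where "\<beta> = (\<lambda>y u v. - curvature a y (Jmul u) (Jmul v))"
  have \<beta>: "bilinear (\<beta> y)" "\<beta> y v v = 0" if "y \<in> S" for y v
    unfolding \<beta>_def bilinear_def
    by (auto intro!: linearI simp: Jmul_simps bilinear_simps[OF bilinear_curvature[OF that]] curvature_self)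
  have sm: "smooth_on S (\<lambda>y. \<beta> y u v)" for u v
    unfolding \<beta>_def by (intro smooth_on_minus S smooth_curvature)
  have "dA2 a (\<lambda>y. hodge2 h y (curvature a y)) x = dA2 a \<beta> x"
    unfolding dA2_eq_dA0 \<beta>_def
    by (intro ext arg_cong2[where f="(+)"] dA0_cong[OF S x] hodge2_curvature)
  then have "hodge3 h x (dA2 a \<beta> x) u = 0" for u
    using yang_mills_eq[OF x, of u] by (simp add: dA_adj2_def)
  from hodge3_eq_0_imp[OF dA2_alternating[OF x \<beta> sm] this]
  have "dA2 a \<beta> x u (Jmul u) w = 0" .
  moreover have "dA2 a (\<lambda>y u v. curvature a y u v + \<beta> y u v) x u (Jmul u) w = 0 + dA2 a \<beta> x u (Jmul u) w"
    by (simp add: dA2_add[OF x smooth_curvature sm] dA2_curvature[OF x])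
  ultimately show ?thesis
    by (simp add: \<beta>_def J_anti_def[abs_def])
qed

text \<open>Together the equations say D_Ju \<phi> = \<i> D_u \<phi> for \<phi> = \<open>f 1\<close>
  - \<i> \<open>f \<i>\<close>. They come from d_A Re(\<phi> \<theta>) on (u, Ju, w), where
  closedness of \<theta> removes all derivatives of \<theta>.\<close>

lemma cauchy_riemann:
  assumes x: "x \<in> S"
  shows "dA0 a (f 1) x (Jmul u) = dA0 a (f \<i>) x u"
    and "dA0 a (f \<i>) x (Jmul u) = - dA0 a (f 1) x u"
proof -
  note df = differentiable_f[OF x] and d\<theta> = smooth_on_differentiable[OF smooth_\<theta> x]
  have dRe: "(\<lambda>y. Re (\<theta> y v w)) differentiable (at x)"
    "dir_deriv (\<lambda>y. Re (\<theta> y v w)) x u = Re (dir_deriv (\<lambda>y. \<theta> y v w) x u)" for u v w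
    using d\<theta> by (auto intro!: bounded_linear.differentiable_image[OF bounded_linear_Re]
      bounded_linear.dir_deriv_image[OF bounded_linear_Re])
  have dIm: "(\<lambda>y. Im (\<theta> y v w)) differentiable (at x)"
    "dir_deriv (\<lambda>y. Im (\<theta> y v w)) x u = Im (dir_deriv (\<lambda>y. \<theta> y v w) x u)" for u v w
    using d\<theta> by (auto intro!: bounded_linear.differentiable_image[OF bounded_linear_Im]
      bounded_linear.dir_deriv_image[OF bounded_linear_Im])
  have D: "dA0 a (\<lambda>y. J_anti (curvature a y) v w) x u =
      Re (dir_deriv (\<lambda>y. \<theta> y v w) x u) *\<^sub>R f 1 x + Re (\<theta> x v w) *\<^sub>R dA0 a (f 1) x u
      + (Im (dir_deriv (\<lambda>y. \<theta> y v w) x u) *\<^sub>R f \<i> x + Im (\<theta> x v w) *\<^sub>R dA0 a (f \<i>) x u)" for u v w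
  proof -
    have "dA0 a (\<lambda>y. J_anti (curvature a y) v w) x u =
        dA0 a (\<lambda>y. Re (\<theta> y v w) *\<^sub>R f 1 y + Im (\<theta> y v w) *\<^sub>R f \<i> y) x u"
      by (rule dA0_cong[OF S x]) (rule J_anti_decompose[OF bilinear_curvature curvature_self volume])
    also have "\<dots> = dA0 a (\<lambda>y. Re (\<theta> y v w) *\<^sub>R f 1 y) x u + dA0 a (\<lambda>y. Im (\<theta> y v w) *\<^sub>R f \<i> y) x u"
      by (intro dA0_add bounded_bilinear.differentiable_prod[OF bounded_bilinear_scaleR] dRe dIm df)
    finally show ?thesis
      by (simp only: dA0_scaleR[OF dRe(1) df] dA0_scaleR[OF dIm(1) df] dRe(2) dIm(2))
  qed
  have vol: "\<theta> x (Jmul p) q = \<i> * \<theta> x p q" "\<theta> x p q = - \<theta> x q p" "\<theta> x p p = 0" for p q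
    using volume[OF x] alternating_swap[of "\<theta> x" p q] by (auto simp: complex_volume_def)
  have E: "Re (\<i> * \<theta> x u w) *\<^sub>R dA0 a (f 1) x u + Im (\<i> * \<theta> x u w) *\<^sub>R dA0 a (f \<i>) x u
      - Re (\<theta> x u w) *\<^sub>R dA0 a (f 1) x (Jmul u) - Im (\<theta> x u w) *\<^sub>R dA0 a (f \<i>) x (Jmul u) = 0" for w
  proof -
    define R where "R = dir_deriv (\<lambda>y. \<theta> y (Jmul u) w) x u + dir_deriv (\<lambda>y. \<theta> y w u) x (Jmul u)
        + dir_deriv (\<lambda>y. \<theta> y u (Jmul u)) x w"
    have "R = 0" unfolding R_def by (rule closed_\<theta>[OF x])
    \<comment> \<open>This removes the derivatives of the coefficients along w, leaving those along
      u and Ju.\<close>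
    have 1: "\<theta> x u (Jmul u) = 0" using vol(2)[of u "Jmul u"] by (simp add: vol(1,3))
    have 2: "\<theta> x w u = - \<theta> x u w" by (rule vol(2))
    have "0 = Re R *\<^sub>R f 1 x + Im R *\<^sub>R f \<i> x +
      (Re (\<i> * \<theta> x u w) *\<^sub>R dA0 a (f 1) x u + Im (\<i> * \<theta> x u w) *\<^sub>R dA0 a (f \<i>) x u
      - Re (\<theta> x u w) *\<^sub>R dA0 a (f 1) x (Jmul u) - Im (\<theta> x u w) *\<^sub>R dA0 a (f \<i>) x (Jmul u))"
      using dA2_J_anti_curvature[OF x, of u w]
      unfolding dA2_eq_dA0 D vol(1) 1 2 R_def
      by (simp add: scaleR_add_left algebra_simps)
    then show ?thesis using \<open>R = 0\<close> by simp
  qed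
  have "dA0 a (f 1) x (Jmul u) = dA0 a (f \<i>) x u \<and> dA0 a (f \<i>) x (Jmul u) = - dA0 a (f 1) x u"
  proof (cases "u = 0")
    case True
    then show ?thesis using linear_0[OF dA0_linear[OF x df]] by (simp add: Jmul_simps)
  next
    case False
    \<comment> \<open>At w the equation \<open>E\<close> reduces to the first of the two claims, at
      w' to the second.\<close>
    then obtain w w' where w: "\<theta> x u w = 1" "\<theta> x u w' = \<i>"
      using complex_volume_surj[OF volume[OF x]] by metis
    show ?thesis using E[of w] E[of w'] unfolding w
      by (simp add: algebra_simps)
  qed
  then show "dA0 a (f 1) x (Jmul u) = dA0 a (f \<i>) x u"
    and "dA0 a (f \<i>) x (Jmul u) = - dA0 a (f 1) x u" by auto
qed

section \<open>The energy density and its Laplacian\<close>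

definition energy :: "cvec \<Rightarrow> real" where
  "energy x = f 1 x \<bullet> f 1 x + f \<i> x \<bullet> f \<i> x"

lemma smooth_energy: "smooth_on S energy"
  unfolding energy_def[abs_def]
  by (intro smooth_on_add smooth_on_prod[OF bounded_bilinear_inner] S smooth_f)

lemma dir_deriv_energy:
  assumes "x \<in> S"
  shows "dir_deriv energy x v = 2 * (f 1 x \<bullet> dA0 a (f 1) x v) + 2 * (f \<i> x \<bullet> dA0 a (f \<i>) x v)"
proof -
  note d = differentiable_f[OF assms]
  have "dir_deriv energy x v = dir_deriv (\<lambda>x. f 1 x \<bullet> f 1 x) x v + dir_deriv (\<lambda>x. f \<i> x \<bullet> f \<i> x) x v"
    unfolding energy_def[abs_def]
    by (intro dir_deriv_add bounded_bilinear.differentiable_prod[OF bounded_bilinear_inner] d)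
  then show ?thesis
    by (simp add: dA0_metric_compatible[OF assms d d] inner_commute)
qed

lemma second_dir_deriv_energy:
  assumes x: "x \<in> S"
  shows "dir_deriv (\<lambda>y. dir_deriv energy y v) x v =
    2 * (dA0 a (f 1) x v \<bullet> dA0 a (f 1) x v + dA0 a (f \<i>) x v \<bullet> dA0 a (f \<i>) x v)
    + 2 * (f 1 x \<bullet> dA0 a (\<lambda>y. dA0 a (f 1) y v) x v + f \<i> x \<bullet> dA0 a (\<lambda>y. dA0 a (f \<i>) y v) x v)"
proof -
  note d = differentiable_f[OF x] smooth_on_differentiable[OF smooth_dA0[OF smooth_f] x]
  have dp: "(\<lambda>y. f z y \<bullet> dA0 a (f z) y v) differentiable (at x)" for z
    by (intro bounded_bilinear.differentiable_prod[OF bounded_bilinear_inner] d)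
  have dp2: "(\<lambda>y. 2 * (f z y \<bullet> dA0 a (f z) y v)) differentiable (at x)"
    "dir_deriv (\<lambda>y. 2 * (f z y \<bullet> dA0 a (f z) y v)) x v = 2 * dir_deriv (\<lambda>y. f z y \<bullet> dA0 a (f z) y v) x v" for z
    by (rule bounded_linear.differentiable_image[OF bounded_linear_mult_right dp]
      bounded_linear.dir_deriv_image[OF bounded_linear_mult_right dp])+
  have "dir_deriv (\<lambda>y. dir_deriv energy y v) x v =
      dir_deriv (\<lambda>y. 2 * (f 1 y \<bullet> dA0 a (f 1) y v) + 2 * (f \<i> y \<bullet> dA0 a (f \<i>) y v)) x v"
    by (rule dir_deriv_cong[OF S x]) (rule dir_deriv_energy)
  also have "\<dots> = dir_deriv (\<lambda>y. 2 * (f 1 y \<bullet> dA0 a (f 1) y v)) x v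
      + dir_deriv (\<lambda>y. 2 * (f \<i> y \<bullet> dA0 a (f \<i>) y v)) x v"
    by (rule dir_deriv_add[OF dp2(1) dp2(1)])
  finally show ?thesis
    unfolding dp2(2) dA0_metric_compatible[OF x d] by simp
qed

text \<open>By Cauchy-Riemann, D_Jv D_Jv \<open>f 1\<close> = D_Jv D_v \<open>f \<i>\<close> and D_v
  D_v \<open>f 1\<close> = - D_v D_Jv \<open>f \<i>\<close>. The sum is therefore minus a commutator
  on \<open>f \<i>\<close>, which is curvature; likewise with the roles exchanged.\<close>

lemma second_covariant_derivatives:
  assumes x: "x \<in> S"
  shows "dA0 a (\<lambda>y. dA0 a (f 1) y v) x v + dA0 a (\<lambda>y. dA0 a (f 1) y (Jmul v)) x (Jmul v) =
      - lie_bracket (curvature a x v (Jmul v)) (f \<i> x)"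
    and "dA0 a (\<lambda>y. dA0 a (f \<i>) y v) x v + dA0 a (\<lambda>y. dA0 a (f \<i>) y (Jmul v)) x (Jmul v) =
      lie_bracket (curvature a x v (Jmul v)) (f 1 x)"
proof -
  have 1: "dA0 a (\<lambda>y. dA0 a (f 1) y (Jmul v)) x w = dA0 a (\<lambda>y. dA0 a (f \<i>) y v) x w" for w
    by (rule dA0_cong[OF S x]) (rule cauchy_riemann)
  have "dA0 a (\<lambda>y. dA0 a (f \<i>) y (Jmul v)) x w = dA0 a (\<lambda>y. - dA0 a (f 1) y v) x w" for w
    by (rule dA0_cong[OF S x]) (rule cauchy_riemann)
  then have 2: "dA0 a (\<lambda>y. dA0 a (f \<i>) y (Jmul v)) x w = - dA0 a (\<lambda>y. dA0 a (f 1) y v) x w" for w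
    by (simp add: dA0_minus smooth_on_differentiable[OF smooth_dA0[OF smooth_f] x])
  have "- dA0 a (\<lambda>y. dA0 a (f 1) y v) x v - dA0 a (\<lambda>y. dA0 a (f 1) y (Jmul v)) x (Jmul v) =
      lie_bracket (curvature a x v (Jmul v)) (f \<i> x)"
    using dA0_commutator[OF x smooth_f[of \<i>], where v=v and w="Jmul v"] unfolding 1 2 .
  from this[symmetric] show "dA0 a (\<lambda>y. dA0 a (f 1) y v) x v + dA0 a (\<lambda>y. dA0 a (f 1) y (Jmul v)) x (Jmul v) =
      - lie_bracket (curvature a x v (Jmul v)) (f \<i> x)"
    by (simp add: add.commute)
  show "dA0 a (\<lambda>y. dA0 a (f \<i>) y v) x v + dA0 a (\<lambda>y. dA0 a (f \<i>) y (Jmul v)) x (Jmul v) =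
      lie_bracket (curvature a x v (Jmul v)) (f 1 x)"
    using dA0_commutator[OF x smooth_f[of 1], where v=v and w="Jmul v"] unfolding 1 2 by simp
qed

text \<open>\<open>onb\<close> need not be adapted to J, so the vectors J e_k are added to make the
  pairs v, Jv available. As J is an isometry, the sum over these eight vectors is twice the metric
  trace.\<close>

definition frame :: "cvec \<Rightarrow> 4 \<times> bool \<Rightarrow> cvec" where
  "frame x i = (if snd i then Jmul (onb (metric h x) (fst i)) else onb (metric h x) (fst i))"

lemma sum_frame:
  "(\<Sum>i\<in>UNIV. q (frame x i)) = (\<Sum>k\<in>UNIV. q (onb (metric h x) k) + q (Jmul (onb (metric h x) k)))"
proof -
  have "(\<Sum>i\<in>UNIV. q (frame x i)) = (\<Sum>k\<in>UNIV. \<Sum>b\<in>UNIV. q (frame x (k, b)))"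
    by (simp add: sum.cartesian_product split_def)
  then show ?thesis by (simp add: frame_def UNIV_bool add.commute)
qed

text \<open>The Weitzenboeck formula: the curvature enters only through its trace, which vanishes.\<close>

lemma laplacian_energy:
  assumes x: "x \<in> S"
  shows "(\<Sum>i\<in>UNIV. dir_deriv (\<lambda>y. dir_deriv energy y (frame x i)) x (frame x i)) =
    (\<Sum>i\<in>UNIV. 2 * (dA0 a (f 1) x (frame x i) \<bullet> dA0 a (f 1) x (frame x i)
      + dA0 a (f \<i>) x (frame x i) \<bullet> dA0 a (f \<i>) x (frame x i)))"
proof -
  interpret hermitian_point h x by (rule hermitian[OF x])
  define e where "e = onb (metric h x)"
  define F where "F = (\<lambda>v. curvature a x v (Jmul v))"
  have F0: "(\<Sum>k\<in>UNIV. F (e k)) = 0"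
    using Lambda2_eq[OF bilinear_curvature[OF x] orthonormal_onb] trace_free[OF x]
    by (simp add: F_def e_def)
  \<comment> \<open>C is the part of the second derivative of the energy that has no sign; over a
    pair v, Jv it adds up to brackets with F(v, Jv).\<close>
  define C where "C = (\<lambda>v. 2 * (f 1 x \<bullet> dA0 a (\<lambda>y. dA0 a (f 1) y v) x v + f \<i> x \<bullet> dA0 a (\<lambda>y. dA0 a (f \<i>) y v) x v))"
  have "C v + C (Jmul v) = 2 * (f \<i> x \<bullet> lie_bracket (F v) (f 1 x) - f 1 x \<bullet> lie_bracket (F v) (f \<i> x))" for v
  proof -
    have "C v + C (Jmul v) =
      2 * (f 1 x \<bullet> (dA0 a (\<lambda>y. dA0 a (f 1) y v) x v + dA0 a (\<lambda>y. dA0 a (f 1) y (Jmul v)) x (Jmul v)) +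
           f \<i> x \<bullet> (dA0 a (\<lambda>y. dA0 a (f \<i>) y v) x v + dA0 a (\<lambda>y. dA0 a (f \<i>) y (Jmul v)) x (Jmul v)))"
      by (simp add: C_def inner_add_right algebra_simps)
    then show ?thesis
      unfolding second_covariant_derivatives[OF x] by (simp add: F_def)
  qed
  then have "(\<Sum>k\<in>UNIV. C (e k) + C (Jmul (e k))) =
      2 * (f \<i> x \<bullet> lie_bracket (\<Sum>k\<in>UNIV. F (e k)) (f 1 x) - f 1 x \<bullet> lie_bracket (\<Sum>k\<in>UNIV. F (e k)) (f \<i> x))"
    by (simp add: lie_bracket_simps inner_sum_right sum_subtractf flip: sum_distrib_left)
  then have "(\<Sum>k\<in>UNIV. C (e k) + C (Jmul (e k))) = 0" by (simp add: F0 lie_bracket_simps)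
  then have "(\<Sum>i\<in>UNIV. C (frame x i)) = 0" unfolding sum_frame e_def .
  then show ?thesis
    unfolding second_dir_deriv_energy[OF x] sum.distrib C_def by simp
qed

lemma energy_strong_maximum:
  assumes x: "x0 \<in> S" and max: "\<And>x. x \<in> S \<Longrightarrow> energy x \<le> energy x0"
  shows "\<exists>r>0. \<forall>x\<in>ball x0 r. energy x = energy x0"
proof (rule strong_maximum_principle[where S=S and e=frame and I=UNIV])
  show "open S" "x0 \<in> S" by (rule S x)+
  show "energy x \<le> energy x0" if "x \<in> S" for x by (rule max[OF that])
  show "Ck_on 2 S energy" using smooth_energy by (simp add: smooth_on_def)
  show "0 \<le> (\<Sum>i\<in>UNIV. dir_deriv (\<lambda>y. dir_deriv energy y (frame x i)) x (frame x i))" if "x \<in> S" for x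
    unfolding laplacian_energy[OF that] by (intro sum_nonneg) simp
  fix K assume K: "compact K" "K \<subseteq> S"
  have "\<exists>m>0. \<exists>B. \<forall>x\<in>K. (\<forall>\<xi>. m * (\<xi> \<bullet> \<xi>) \<le> (\<Sum>k\<in>UNIV. (\<xi> \<bullet> onb (metric h x) k)\<^sup>2)) \<and>
    (\<Sum>k\<in>UNIV. onb (metric h x) k \<bullet> onb (metric h x) k) \<le> B"
    by (rule uniformly_elliptic)
      (use hermitian K continuous_on_subset[OF smooth_on_imp_continuous_on[OF smooth_h]] in auto)
  then obtain m B where m: "m > 0" and
    B: "\<And>x \<xi>. x \<in> K \<Longrightarrow> m * (\<xi> \<bullet> \<xi>) \<le> (\<Sum>k\<in>UNIV. (\<xi> \<bullet> onb (metric h x) k)\<^sup>2)"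
       "\<And>x. x \<in> K \<Longrightarrow> (\<Sum>k\<in>UNIV. onb (metric h x) k \<bullet> onb (metric h x) k) \<le> B"
    by blast
  show "\<exists>m>0. \<exists>B. \<forall>x\<in>K. (\<forall>\<xi>. m * (\<xi> \<bullet> \<xi>) \<le> (\<Sum>i\<in>UNIV. (\<xi> \<bullet> frame x i)\<^sup>2)) \<and>
      (\<Sum>i\<in>UNIV. frame x i \<bullet> frame x i) \<le> B"
  \<comment> \<open>The added vectors J e_k only increase the lower bound, and J preserves Euclidean
    length, whence 2B.\<close>
  proof (rule exI[of _ m], intro conjI exI[of _ "2 * B"] ballI allI m)
    fix x assume x: "x \<in> K"
    show "(\<Sum>i\<in>UNIV. frame x i \<bullet> frame x i) \<le> 2 * B"
      using B(2)[OF x] unfolding sum_frame[of "\<lambda>v. v \<bullet> v"] by (simp flip: sum_distrib_left)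
    fix \<xi>
    have "0 \<le> (\<Sum>k\<in>UNIV. (\<xi> \<bullet> Jmul (onb (metric h x) k))\<^sup>2)" by (intro sum_nonneg) simp
    then show "m * (\<xi> \<bullet> \<xi>) \<le> (\<Sum>i\<in>UNIV. (\<xi> \<bullet> frame x i)\<^sup>2)"
      using B(1)[OF x, of \<xi>] unfolding sum_frame[of "\<lambda>v. (\<xi> \<bullet> v)\<^sup>2"] by (simp add: sum.distrib)
  qed
qed

text \<open>Where the energy is locally constant its Laplacian vanishes, but
  \<open>laplacian_energy\<close> writes that as a sum of squares. All frame derivatives vanish, and
  the frame spans.\<close>

lemma constant_energy_imp_parallel:
  assumes U: "open U" "U \<subseteq> S" "x \<in> U" and const: "\<And>y. y \<in> U \<Longrightarrow> energy y = c"
  shows "dA0 a (f 1) x v = 0" and "dA0 a (f \<i>) x v = 0"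
proof -
  have x: "x \<in> S" using U by auto
  interpret hermitian_point h x by (rule hermitian[OF x])
  have "dir_deriv energy y v = 0" if "y \<in> U" for y v
    using dir_deriv_cong[OF U(1) that, of energy "\<lambda>_. c"] const by simp
  then have "dir_deriv (\<lambda>y. dir_deriv energy y w) x v = 0" for v w
    using dir_deriv_cong[OF U(1,3), of "\<lambda>y. dir_deriv energy y w" "\<lambda>_. 0"] by simp
  then have "(\<Sum>i\<in>UNIV. 2 * (dA0 a (f 1) x (frame x i) \<bullet> dA0 a (f 1) x (frame x i)
      + dA0 a (f \<i>) x (frame x i) \<bullet> dA0 a (f \<i>) x (frame x i))) = 0"
    using laplacian_energy[OF x] by simp
  then have "\<forall>i\<in>UNIV. 2 * (dA0 a (f 1) x (frame x i) \<bullet> dA0 a (f 1) x (frame x i)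
      + dA0 a (f \<i>) x (frame x i) \<bullet> dA0 a (f \<i>) x (frame x i)) = 0"
    by (subst (asm) sum_nonneg_eq_0_iff) auto
  then have "dA0 a (f 1) x (frame x i) = 0 \<and> dA0 a (f \<i>) x (frame x i) = 0" for i
    by (cases i) (simp add: add_nonneg_eq_0_iff)
  from this[of "(k, False)" for k]
  have 0: "dA0 a (f 1) x (onb (metric h x) k) = 0" "dA0 a (f \<i>) x (onb (metric h x) k) = 0" for k
    by (simp_all add: frame_def)
  have "(\<Sum>k\<in>UNIV. metric h x v (onb (metric h x) k) *\<^sub>R dA0 a (f z) x (onb (metric h x) k)) = dA0 a (f z) x v" for z
    by (rule sum_orthonormal_linear[OF orthonormal_onb dA0_linear[OF x differentiable_f[OF x]]])
  from this[of 1] this[of \<i>] show "dA0 a (f 1) x v = 0" "dA0 a (f \<i>) x v = 0"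
    by (simp_all add: 0)
qed

text \<open>Both coefficients being zero, the curvature is J-invariant, and star F = - F(J, J)
  becomes - F.\<close>

lemma anti_self_dual_of_f_zero:
  assumes x: "x \<in> S" and "f 1 x = 0" "f \<i> x = 0"
  shows "hodge2 h x (curvature a x) u v = - curvature a x u v"
  using J_anti_decompose[OF bilinear_curvature[OF x] curvature_self volume[OF x], of u v] assms(2,3)
  by (simp add: hodge2_curvature[OF x] J_anti_def)

end

section \<open>Globalisation\<close>

lemma continuous_on_bilinear_family:
  fixes \<beta> :: "'z::topological_space \<Rightarrow> 'a::euclidean_space \<Rightarrow> 'a \<Rightarrow> 'c::real_normed_vector"
  assumes bil: "\<And>x. x \<in> S \<Longrightarrow> bilinear (\<beta> x)" and cont: "\<And>u v. continuous_on S (\<lambda>x. \<beta> x u v)"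
    and y: "continuous_on S y" and z: "continuous_on S z"
  shows "continuous_on S (\<lambda>x. \<beta> x (y x) (z x))"
proof -
  have "continuous_on S (\<lambda>x. \<Sum>i\<in>Basis. \<Sum>j\<in>Basis. (y x \<bullet> i) *\<^sub>R ((z x \<bullet> j) *\<^sub>R \<beta> x i j))"
    by (intro continuous_intros cont y z)
  moreover have "(\<Sum>i\<in>Basis. \<Sum>j\<in>Basis. (y x \<bullet> i) *\<^sub>R ((z x \<bullet> j) *\<^sub>R \<beta> x i j)) = \<beta> x (y x) (z x)"
    if "x \<in> S" for x
  proof -
    have 1: "\<beta> x (y x) v = (\<Sum>i\<in>Basis. (y x \<bullet> i) *\<^sub>R \<beta> x i v)" for v
      by (subst euclidean_representation[symmetric, of "y x"])
        (simp only: bilinear_simps[OF bil[OF that]])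
    have 2: "\<beta> x v (z x) = (\<Sum>j\<in>Basis. (z x \<bullet> j) *\<^sub>R \<beta> x v j)" for v
      by (subst euclidean_representation[symmetric, of "z x"])
        (simp only: bilinear_simps[OF bil[OF that]])
    show ?thesis unfolding 1[of "z x"] unfolding 2 scaleR_sum_right ..
  qed
  ultimately show ?thesis by (rule continuous_on_eq)
qed

text \<open>Any two loops are freely homotopic, constant ones included; the track of the base point
  during such a homotopy is a path from a to b.\<close>

lemma simply_connected_UNIV_imp_connected:
  assumes "simply_connected (UNIV :: 'm::topological_space set)"
  shows "connected (UNIV :: 'm set)"
proof -
  have "path_connected (UNIV :: 'm set)"
    unfolding path_connected_def
  proof (intro ballI)
    fix a b :: 'm
    have "homotopic_loops UNIV (\<lambda>_. a) (\<lambda>_. b)"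
      using assms by (auto simp: simply_connected_def path_def pathstart_def pathfinish_def)
    then obtain h where h: "continuous_on ({0..1::real} \<times> {0..1::real}) h"
      "\<forall>x\<in>{0..1}. h (0, x) = a" "\<forall>x\<in>{0..1}. h (1, x) = b"
      unfolding homotopic_loops by blast
    have "continuous_on {0..1} (\<lambda>t. h (t, 0))"
      by (rule continuous_on_compose2[OF h(1)]) (auto intro!: continuous_intros)
    then show "\<exists>g. path g \<and> path_image g \<subseteq> UNIV \<and> pathstart g = a \<and> pathfinish g = b"
      using h by (intro exI[of _ "\<lambda>t. h (t, 0)"]) (auto simp: path_def pathstart_def pathfinish_def)
  qed
  then show ?thesis by (rule path_connected_imp_connected)
qed

lemma lborel_open_pos:
  fixes V :: "'a::euclidean_space set"
  assumes "open V" "V \<noteq> {}"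
  shows "emeasure lborel V \<noteq> 0"
proof
  assume "emeasure lborel V = 0"
  then have "V \<in> null_sets lborel" using assms by (simp add: null_sets_def)
  then have "negligible V" by (simp add: negligible_iff_null_sets null_sets_completionI)
  then show False using open_not_negligible[OF assms] by simp
qed

section \<open>Charts, the parallel form and the volume measure of the surface\<close>

locale calabi_yau_surface =
  fixes Atl :: "'m::t2_space chart set"
    and \<omega> :: "'m chart \<Rightarrow> cvec \<Rightarrow> cvec \<Rightarrow> cvec \<Rightarrow> real"
    and \<theta> :: "'m chart \<Rightarrow> cvec \<Rightarrow> cvec \<Rightarrow> cvec \<Rightarrow> complex"
  assumes calabi_yau: "calabi_yau_2fold Atl \<omega> \<theta>"
begin

lemma charts_cover: "\<exists>c\<in>Atl. p \<in> fst c"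
  using calabi_yau unfolding calabi_yau_2fold_def complex_surface_def by blast

lemma open_chart: "c \<in> Atl \<Longrightarrow> open (fst c)"
  and open_chart_image: "c \<in> Atl \<Longrightarrow> open (snd c ` fst c)"
  and chart_homeomorphism: "c \<in> Atl \<Longrightarrow> homeomorphism (fst c) (snd c ` fst c) (snd c) (chart_inv c)"
  using calabi_yau unfolding calabi_yau_2fold_def complex_surface_def by blast+

lemma chart_inv_chart: "c \<in> Atl \<Longrightarrow> p \<in> fst c \<Longrightarrow> chart_inv c (snd c p) = p"
  using chart_homeomorphism unfolding homeomorphism_def by blast

lemma chart_continuous: "c \<in> Atl \<Longrightarrow> continuous_on (fst c) (snd c)"
  and chart_inv_continuous: "c \<in> Atl \<Longrightarrow> continuous_on (snd c ` fst c) (chart_inv c)"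
  using chart_homeomorphism unfolding homeomorphism_def by blast+

lemma open_chart_image_Int:
  assumes "c \<in> Atl" "open U"
  shows "open (snd c ` (fst c \<inter> U))"
proof -
  have "open (chart_inv c -` U \<inter> snd c ` fst c)"
    using chart_inv_continuous[OF assms(1)] assms(2)
    by (simp add: continuous_on_open_vimage open_chart_image[OF assms(1)])
  moreover have "snd c ` (fst c \<inter> U) = chart_inv c -` U \<inter> snd c ` fst c"
    using chart_inv_chart[OF assms(1)] by auto
  ultimately show ?thesis by simp
qed

lemma open_chart_preimage:
  assumes "c \<in> Atl" "open V"
  shows "open (snd c -` V \<inter> fst c)"
  using chart_continuous[OF assms(1)] assms(2)
  by (simp add: continuous_on_open_vimage open_chart[OF assms(1)])

lemma chart_change_chart: "c \<in> Atl \<Longrightarrow> p \<in> fst c \<Longrightarrow> chart_change c d (snd c p) = snd d p"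
  by (simp add: chart_change_def chart_inv_chart)

lemma smooth_chart_change:
  "c \<in> Atl \<Longrightarrow> d \<in> Atl \<Longrightarrow> smooth_on (snd c ` (fst c \<inter> fst d)) (chart_change c d)"
  and chart_change_holomorphic: "c \<in> Atl \<Longrightarrow> d \<in> Atl \<Longrightarrow> p \<in> fst c \<inter> fst d \<Longrightarrow>
    dir_deriv (chart_change c d) (snd c p) (Jmul v) = Jmul (dir_deriv (chart_change c d) (snd c p) v)"
  using calabi_yau unfolding calabi_yau_2fold_def complex_surface_def by blast+

lemma kahler: "kahler_form Atl \<omega>" and two_form_\<theta>: "two_form Atl \<theta>"
  using calabi_yau unfolding calabi_yau_2fold_def by blast+

lemma two_form_\<omega>: "two_form Atl \<omega>"
  using kahler unfolding kahler_form_def by blast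

lemma two_formD:
  assumes "two_form Atl \<beta>" "c \<in> Atl"
  shows "x \<in> snd c ` fst c \<Longrightarrow> bilinear (\<beta> c x)" "x \<in> snd c ` fst c \<Longrightarrow> \<beta> c x v v = 0"
    "smooth_on (snd c ` fst c) (\<lambda>x. \<beta> c x u v)"
    "d \<in> Atl \<Longrightarrow> p \<in> fst c \<inter> fst d \<Longrightarrow> \<beta> c (snd c p) u v = \<beta> d (snd d p)
      (dir_deriv (chart_change c d) (snd c p) u) (dir_deriv (chart_change c d) (snd c p) v)"
proof -
  show "x \<in> snd c ` fst c \<Longrightarrow> bilinear (\<beta> c x)" "x \<in> snd c ` fst c \<Longrightarrow> \<beta> c x v v = 0"
    "smooth_on (snd c ` fst c) (\<lambda>x. \<beta> c x u v)"
    using assms unfolding two_form_def by blast+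
  assume "d \<in> Atl" and p: "p \<in> fst c \<inter> fst d"
  then have "\<beta> c (snd c p) u v = \<beta> d (chart_change c d (snd c p))
      (dir_deriv (chart_change c d) (snd c p) u) (dir_deriv (chart_change c d) (snd c p) v)"
    using assms unfolding two_form_def by blast
  then show "\<beta> c (snd c p) u v = \<beta> d (snd d p)
      (dir_deriv (chart_change c d) (snd c p) u) (dir_deriv (chart_change c d) (snd c p) v)"
    using p by (simp add: chart_change_chart[OF assms(2)])
qed

lemma hermitian:
  assumes "c \<in> Atl" "x \<in> snd c ` fst c"
  shows "hermitian_point (\<omega> c) x"
proof
  show "bilinear (\<omega> c x)" "\<omega> c x v v = 0" for v
    using two_formD[OF two_form_\<omega> assms(1)] assms(2) by auto
  show "\<omega> c x (Jmul v) (Jmul w) = \<omega> c x v w" "v \<noteq> 0 \<Longrightarrow> \<omega> c x v (Jmul v) > 0" for v w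
    using kahler assms unfolding kahler_form_def by blast+
  show "metric (\<omega> c) x = (\<lambda>v w. \<omega> c x v (Jmul w))"
    by (intro ext) (simp add: metric_def)
qed

lemma
  assumes "c \<in> Atl" "x \<in> snd c ` fst c"
  shows \<theta>_J: "\<theta> c x (Jmul u) v = \<i> * \<theta> c x u v"
    and \<theta>_parallel: "cov_deriv2 (\<omega> c) (\<theta> c) x u v w = 0"
    and \<theta>_norm: "wedge22 (\<theta> c x) (\<lambda>a b. cnj (\<theta> c x a b)) t u v w =
      complex_of_real (vol_form (\<omega> c) x t u v w)"
  using calabi_yau assms unfolding calabi_yau_2fold_def by blast+

lemma standard_volume_pos:
  assumes "c \<in> Atl" "x \<in> snd c ` fst c"
  shows "vol_form (\<omega> c) x (axis 1 1) (axis 1 \<i>) (axis 2 1) (axis 2 \<i>) > 0"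
proof -
  interpret hermitian_point "\<omega> c" x by (rule hermitian[OF assms])
  show ?thesis using metric_volume_standard_pos by (simp add: vol_form_expand)
qed

text \<open>A zero of \<theta> would make \<theta> \<and> cnj \<theta> vanish there, but by the
  normalisation this is the volume form, which is positive.\<close>

lemma volume:
  assumes "c \<in> Atl" "x \<in> snd c ` fst c"
  shows "complex_volume (\<theta> c x)"
proof -
  note \<Theta> = two_formD(1,2)[OF two_form_\<theta> assms] \<theta>_J[OF assms]
  have "\<theta> c x (axis 1 1) (axis 2 1) \<noteq> 0"
  proof
    assume "\<theta> c x (axis 1 1) (axis 2 1) = 0"
    then have "\<theta> c x u v = 0" for u v
      using complex_volume_expand[OF \<Theta>, of u v] by simp
    then have "complex_of_real (vol_form (\<omega> c) x (axis 1 1) (axis 1 \<i>) (axis 2 1) (axis 2 \<i>)) = 0"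
      unfolding \<theta>_norm[OF assms, symmetric] by (simp add: wedge22_def)
    then show False using standard_volume_pos[OF assms] by simp
  qed
  then show ?thesis using \<Theta> by (simp add: complex_volume_def)
qed

text \<open>The metric is symmetric, so Koszul's formula gives the same predicate under
  \<open>THE\<close> for (u, v) and (v, u).\<close>

lemma christoffel_sym:
  assumes "c \<in> Atl" "x \<in> snd c ` fst c"
  shows "christoffel (\<omega> c) x u v = christoffel (\<omega> c) x v u"
proof -
  have "dir_deriv (\<lambda>y. metric (\<omega> c) y u v) x w = dir_deriv (\<lambda>y. metric (\<omega> c) y v u) x w" for w
  proof (rule dir_deriv_cong[OF open_chart_image[OF assms(1)] assms(2)])
    fix y assume "y \<in> snd c ` fst c"
    then interpret hermitian_point "\<omega> c" y by (rule hermitian[OF assms(1)])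
    show "metric (\<omega> c) y u v = metric (\<omega> c) y v u" by (rule g_sym)
  qed
  then show ?thesis unfolding christoffel_def by (simp add: add.commute)
qed

text \<open>A parallel form is closed because the Levi-Civita connection is torsion free.\<close>

lemma closed_\<theta>:
  assumes "c \<in> Atl" "x \<in> snd c ` fst c"
  shows "dir_deriv (\<lambda>y. \<theta> c y v w) x u + dir_deriv (\<lambda>y. \<theta> c y w u) x v
    + dir_deriv (\<lambda>y. \<theta> c y u v) x w = 0"
proof -
  let ?\<Gamma> = "christoffel (\<omega> c) x"
  have D: "dir_deriv (\<lambda>y. \<theta> c y v w) x u = \<theta> c x (?\<Gamma> u v) w + \<theta> c x v (?\<Gamma> u w)" for u v w
    using \<theta>_parallel[OF assms, of u v w] by (simp add: cov_deriv2_def algebra_simps)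
  note sw = alternating_swap[OF two_formD(1,2)[OF two_form_\<theta> assms]]
  \<comment> \<open>The cyclic sum has six terms; symmetry of the Christoffel symbols and
    antisymmetry of \<theta> cancel them in pairs.\<close>
  show ?thesis
    unfolding D christoffel_sym[OF assms, of v u] christoffel_sym[OF assms, of w v]
      christoffel_sym[OF assms, of u w]
      sw[of w "?\<Gamma> u v"] sw[of u "?\<Gamma> v w"] sw[of v "?\<Gamma> w u"]
    by simp
qed

text \<open>The coordinate image of U is open and nonempty, hence of positive Lebesgue measure, and
  the density is positive everywhere.\<close>

lemma chart_measure_pos:
  assumes c: "c \<in> Atl" and U: "open U" "U \<subseteq> fst c" "U \<noteq> {}"
  shows "emeasure (chart_measure \<omega> c) U \<noteq> 0"
proof -
  define S where "S = snd c ` fst c"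
  define V where "V = snd c ` (fst c \<inter> U)"
  define \<rho> where "\<rho> = (\<lambda>x. ennreal (vol_form (\<omega> c) x (axis 1 1) (axis 1 \<i>) (axis 2 1) (axis 2 \<i>)))"
  define N where "N = restrict_space lborel S"
  have S: "open S" unfolding S_def by (rule open_chart_image[OF c])
  have V: "open V" "V \<noteq> {}" "V \<subseteq> S"
    using open_chart_image_Int[OF c U(1)] U by (auto simp: V_def S_def)
  have sets_N: "sets N = sets (restrict_space borel S)"
    unfolding N_def by (intro sets_restrict_space_cong) simp
  have space_N: "space N = S" using S by (simp add: N_def space_restrict_space)
  have "continuous_on S (\<lambda>x. \<omega> c x u v)" for u v
    using two_formD(3)[OF two_form_\<omega> c] unfolding S_def by (rule smooth_on_imp_continuous_on)
  then have "continuous_on S (\<lambda>x. vol_form (\<omega> c) x (axis 1 1) (axis 1 \<i>) (axis 2 1) (axis 2 \<i>))"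
    unfolding vol_form_expand by (intro continuous_intros)
  then have "(\<lambda>x. vol_form (\<omega> c) x (axis 1 1) (axis 1 \<i>) (axis 2 1) (axis 2 \<i>)) \<in> borel_measurable N"
    using borel_measurable_continuous_on_restrict measurable_cong_sets[OF sets_N refl] by blast
  then have \<rho>: "\<rho> \<in> borel_measurable N" unfolding \<rho>_def by simp
  have inv: "chart_inv c \<in> measurable (density N \<rho>) borel"
  proof -
    have "chart_inv c \<in> borel_measurable (restrict_space borel S)"
      using chart_inv_continuous[OF c] unfolding S_def by (rule borel_measurable_continuous_on_restrict)
    moreover have "sets (density N \<rho>) = sets (restrict_space borel S)" using sets_N by simp
    ultimately show ?thesis using measurable_cong_sets by blast
  qed
  have VN: "V \<in> sets N"
    using V S by (auto simp: sets_N sets_restrict_space_iff)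
  have "emeasure (chart_measure \<omega> c) U = emeasure (density N \<rho>) (chart_inv c -` U \<inter> space (density N \<rho>))"
    unfolding chart_measure_def S_def[symmetric] N_def[symmetric] \<rho>_def[symmetric]
    by (rule emeasure_distr[OF inv]) (use U in simp)
  also have "chart_inv c -` U \<inter> space (density N \<rho>) = V"
    using chart_inv_chart[OF c] by (auto simp: space_N S_def V_def)
  also have "emeasure (density N \<rho>) V = (\<integral>\<^sup>+x. \<rho> x * indicator V x \<partial>N)"
    by (rule emeasure_density[OF \<rho> VN])
  also have "\<dots> \<noteq> 0"
  proof
    assume "(\<integral>\<^sup>+x. \<rho> x * indicator V x \<partial>N) = 0"
    moreover have "(\<lambda>x. \<rho> x * indicator V x) \<in> borel_measurable N"
      using \<rho> VN by simp
    ultimately have "emeasure N {x \<in> space N. \<rho> x * indicator V x \<noteq> 0} = 0"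
      by (simp add: nn_integral_0_iff)
    moreover have "{x \<in> space N. \<rho> x * indicator V x \<noteq> 0} = V"
    proof -
      have "\<rho> x \<noteq> 0" if "x \<in> V" for x
        using standard_volume_pos[OF c, of x] that V(3) by (auto simp: \<rho>_def S_def ennreal_eq_0_iff)
      then show ?thesis using V(3) by (auto simp: space_N indicator_def)
    qed
    ultimately have "emeasure N V = 0" by simp
    then have "emeasure lborel V = 0"
      using V S by (simp add: N_def emeasure_restrict_space)
    then show False using lborel_open_pos[OF V(1,2)] by simp
  qed
  finally show ?thesis .
qed

lemma sets_vol_measure: "sets (vol_measure Atl \<omega>) = sets borel"
  unfolding vol_measure_def
  \<comment> \<open>The atlas is nonempty because it covers the manifold; a supremum over an empty
    family would have the wrong sigma-algebra.\<close>
  by (rule sets_SUP) (use charts_cover in \<open>auto simp: chart_measure_def\<close>)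

text \<open>The supremum dominates each chart measure, and between measures on the same
  sigma-algebra this order is setwise.\<close>

lemma vol_measure_pos:
  assumes c: "c \<in> Atl" and U: "open U" "U \<subseteq> fst c" "U \<noteq> {}"
  shows "emeasure (vol_measure Atl \<omega>) U \<noteq> 0"
proof -
  have "chart_measure \<omega> c \<le> vol_measure Atl \<omega>"
    unfolding vol_measure_def using c by (rule SUP_upper)
  moreover have "sets (chart_measure \<omega> c) = sets (vol_measure Atl \<omega>)"
    by (simp add: sets_vol_measure) (simp add: chart_measure_def)
  ultimately have "emeasure (chart_measure \<omega> c) U \<le> emeasure (vol_measure Atl \<omega>) U"
    using le_measure U(1) by (metis borel_open sets_vol_measure)
  then show ?thesis using chart_measure_pos[OF assms] by auto
qed

end

section \<open>Local representatives of bundle data and their transformation laws\<close>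

locale bundle_connection = calabi_yau_surface Atl \<omega> \<theta> + unitary_group G
  for Atl :: "'m::t2_space chart set" and \<omega> \<theta> and G :: "'n::finite cmat set" +
  fixes P :: "('m, 'p, 'n) pbundle" and A :: "('m, 'p, 'n) gauge_pot"
  assumes principal: "principal_bundle Atl G P" and connection: "connection Atl G P A"
begin

lemma sections_cover: "\<exists>s\<in>secs P. p \<in> fst s"
  and open_section: "s \<in> secs P \<Longrightarrow> open (fst s)"
  and proj_section: "s \<in> secs P \<Longrightarrow> p \<in> fst s \<Longrightarrow> proj P (snd s p) = p"
  and act_one: "act P q (mat 1) = q"
  and act_act: "g \<in> G \<Longrightarrow> h \<in> G \<Longrightarrow> act P (act P q g) h = act P q (g ** h)"
  and proj_act: "g \<in> G \<Longrightarrow> proj P (act P q g) = proj P q"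
  and fibre_torsor: "proj P q = proj P r \<Longrightarrow> \<exists>!g. g \<in> G \<and> r = act P q g"
  and smooth_transition: "s \<in> secs P \<Longrightarrow> t \<in> secs P \<Longrightarrow> c \<in> Atl \<Longrightarrow>
    smooth_on (snd c ` (fst c \<inter> fst s \<inter> fst t)) (transition G P s t \<circ> chart_inv c)"
  using principal unfolding principal_bundle_def by blast+

lemma local_data_exist: "\<exists>c\<in>Atl. \<exists>s\<in>secs P. p \<in> fst c \<inter> fst s"
  using charts_cover sections_cover by blast

lemma transition:
  assumes "s \<in> secs P" "t \<in> secs P" "p \<in> fst s \<inter> fst t"
  shows "transition G P s t p \<in> G" "snd t p = act P (snd s p) (transition G P s t p)"
proof -
  have "proj P (snd s p) = proj P (snd t p)" using assms by (simp add: proj_section)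
  from theI'[OF fibre_torsor[OF this]]
  show "transition G P s t p \<in> G" "snd t p = act P (snd s p) (transition G P s t p)"
    unfolding transition_def by auto
qed

lemma open_cdom: "c \<in> Atl \<Longrightarrow> s \<in> secs P \<Longrightarrow> open (cdom c s)"
  unfolding cdom_def by (intro open_chart_image_Int open_section)

lemma cdom_subset: "cdom c s \<subseteq> snd c ` fst c"
  by (auto simp: cdom_def)

lemma A_mem_lie_algebra: "c \<in> Atl \<Longrightarrow> s \<in> secs P \<Longrightarrow> x \<in> cdom c s \<Longrightarrow> A c s x v \<in> lie_algebra G"
  using connection unfolding connection_def by blast

lemma A_chart_change:
  "c \<in> Atl \<Longrightarrow> d \<in> Atl \<Longrightarrow> s \<in> secs P \<Longrightarrow> x \<in> snd c ` (fst c \<inter> fst d \<inter> fst s) \<Longrightarrow>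
    A c s x v = A d s (chart_change c d x) (dir_deriv (chart_change c d) x v)"
  using connection unfolding connection_def by blast

lemma A_gauge:
  "c \<in> Atl \<Longrightarrow> s \<in> secs P \<Longrightarrow> t \<in> secs P \<Longrightarrow> x \<in> snd c ` (fst c \<inter> fst s \<inter> fst t) \<Longrightarrow>
    g = transition G P s t \<circ> chart_inv c \<Longrightarrow>
    A c t x v = matrix_inv (g x) ** A c s x v ** g x + matrix_inv (g x) ** dir_deriv g x v"
  using connection unfolding connection_def Let_def by blast

lemma local_connection:
  assumes "c \<in> Atl" "s \<in> secs P"
  shows "local_connection (cdom c s) (A c s)"
proof (rule local_connection.intro)
  show "open (cdom c s)" by (rule open_cdom[OF assms])
  show "linear (A c s x)" if "x \<in> cdom c s" for x
    using connection assms that unfolding connection_def by blast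
  show "smooth_on (cdom c s) (\<lambda>x. A c s x v)" for v
    using connection assms unfolding connection_def by blast
  show "conj_transpose (A c s x v) = - A c s x v" if "x \<in> cdom c s" for x v
    by (rule lie_algebra_skew[OF A_mem_lie_algebra[OF assms that]])
qed

lemma curvature_mem_lie_algebra:
  assumes c: "c \<in> Atl" "s \<in> secs P" and x: "x \<in> cdom c s"
  shows "curvature (A c s) x u v \<in> lie_algebra G"
proof -
  interpret local_connection "cdom c s" "A c s" by (rule local_connection[OF c])
  have "dir_deriv (\<lambda>y. A c s y w) x z \<in> lie_algebra G" for w z
    by (rule derivative_in_subspace[OF subspace_lie_algebra S x A_mem_lie_algebra[OF c]
          has_derivative_dir_deriv[OF differentiable_a[OF x]]])
  then show ?thesis
    unfolding curvature_def
    by (intro subspace_add subspace_diff subspace_lie_algebra lie_bracket_mem_lie_algebra A_mem_lie_algebra c x)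
qed

lemma curvature_chart:
  assumes c: "c \<in> Atl" "d \<in> Atl" "s \<in> secs P" and p: "p \<in> fst c \<inter> fst d \<inter> fst s"
  shows "curvature (A c s) (snd c p) u v = curvature (A d s) (snd d p)
    (dir_deriv (chart_change c d) (snd c p) u) (dir_deriv (chart_change c d) (snd c p) v)"
proof -
  define S where "S = snd c ` (fst c \<inter> (fst d \<inter> fst s))"
  have "curvature (A c s) (snd c p) u v = curvature (A d s) (chart_change c d (snd c p))
    (dir_deriv (chart_change c d) (snd c p) u) (dir_deriv (chart_change c d) (snd c p) v)"
  proof (rule curvature_chart_change)
    show "open S" unfolding S_def
      by (intro open_chart_image_Int open_Int open_chart open_section c)
    show "snd c p \<in> S" using p by (auto simp: S_def)
    show "smooth_on S (chart_change c d)"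
      by (rule smooth_on_subset[OF smooth_chart_change[OF c(1,2)]]) (auto simp: S_def)
    show "chart_change c d y \<in> cdom d s" if "y \<in> S" for y
      using that chart_change_chart[OF c(1), of _ d] by (auto simp: S_def cdom_def)
    show "local_connection (cdom d s) (A d s)" by (rule local_connection[OF c(2,3)])
    show "A c s y v = A d s (chart_change c d y) (dir_deriv (chart_change c d) y v)" if "y \<in> S" for y v
      using that by (intro A_chart_change c) (auto simp: S_def)
  qed
  then show ?thesis using p by (simp add: chart_change_chart[OF c(1)])
qed

lemma curvature_transition:
  assumes c: "c \<in> Atl" "s \<in> secs P" "t \<in> secs P" and p: "p \<in> fst c \<inter> fst s \<inter> fst t"
  shows "curvature (A c t) (snd c p) u v =
    matrix_inv (transition G P s t p) ** curvature (A c s) (snd c p) u v ** transition G P s t p"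
proof -
  define S where "S = snd c ` (fst c \<inter> fst s \<inter> fst t)"
  define g where "g = transition G P s t \<circ> chart_inv c"
  interpret s: local_connection "cdom c s" "A c s" by (rule local_connection[OF c(1,2)])
  interpret t: local_connection "cdom c t" "A c t" by (rule local_connection[OF c(1,3)])
  have gp: "g (snd c p) = transition G P s t p" using p by (simp add: g_def chart_inv_chart[OF c(1)])
  have gG: "g y \<in> G" if "y \<in> S" for y
    using that transition(1)[OF c(2,3)] chart_inv_chart[OF c(1)] by (auto simp: g_def S_def)
  have "g (snd c p) ** curvature (A c t) (snd c p) u v = curvature (A c s) (snd c p) u v ** g (snd c p)"
  proof (rule curvature_gauge)
    show "open S" unfolding S_def Int_assoc
      by (intro open_chart_image_Int open_Int open_section c)
    show "snd c p \<in> S" using p by (auto simp: S_def)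
    show "smooth_on S (\<lambda>x. A c s x v)" "smooth_on S (\<lambda>x. A c t x v)" for v
      by (rule smooth_on_subset[OF s.smooth_a] smooth_on_subset[OF t.smooth_a], force simp: S_def cdom_def)+
    show "smooth_on S g" unfolding S_def g_def by (rule smooth_transition[OF c(2,3,1)])
    fix y v assume y: "y \<in> S"
    have "A c t y v = matrix_inv (g y) ** A c s y v ** g y + matrix_inv (g y) ** dir_deriv g y v"
      using y unfolding S_def by (rule A_gauge[OF c _ g_def])
    then have "g y ** A c t y v = (g y ** matrix_inv (g y)) ** A c s y v ** g y
        + (g y ** matrix_inv (g y)) ** dir_deriv g y v"
      by (simp add: matrix_add_ldistrib matrix_mul_assoc)
    then show "g y ** A c t y v = A c s y v ** g y + dir_deriv g y v"
      by (simp add: mult_matrix_inv[OF gG[OF y]])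
  qed
  then show ?thesis
    unfolding gp by (rule conjugate_eqI[rotated]) (use p in \<open>auto intro: transition(1) c\<close>)
qed

text \<open>A section of the adjoint bundle given by local representatives, the form in which the
  contracted curvature and the \<theta>-coefficients arise.\<close>

definition adjoint_family :: "('m chart \<Rightarrow> ('m, 'p) lsec \<Rightarrow> cvec \<Rightarrow> 'n cmat) \<Rightarrow> bool" where
  "adjoint_family R \<longleftrightarrow>
    (\<forall>c\<in>Atl. \<forall>d\<in>Atl. \<forall>s\<in>secs P. \<forall>p\<in>fst c \<inter> fst d \<inter> fst s. R c s (snd c p) = R d s (snd d p)) \<and>
    (\<forall>c\<in>Atl. \<forall>s\<in>secs P. \<forall>t\<in>secs P. \<forall>p\<in>fst c \<inter> fst s \<inter> fst t.
      R c t (snd c p) = matrix_inv (transition G P s t p) ** R c s (snd c p) ** transition G P s t p)"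

lemma adjoint_family_change:
  assumes "adjoint_family R" "c \<in> Atl" "d \<in> Atl" "s \<in> secs P" "t \<in> secs P"
    "p \<in> fst c \<inter> fst s" "p \<in> fst d \<inter> fst t"
  shows "R d t (snd d p) = matrix_inv (transition G P s t p) ** R c s (snd c p) ** transition G P s t p"
proof -
  have "R d t (snd d p) = R c t (snd c p)"
    using assms unfolding adjoint_family_def by blast
  also have "\<dots> = matrix_inv (transition G P s t p) ** R c s (snd c p) ** transition G P s t p"
    using assms unfolding adjoint_family_def by blast
  finally show ?thesis .
qed

lemma linear_conjugate: "linear (\<lambda>X. matrix_inv g ** X ** g)" for g :: "'n cmat"
  by (rule linearI) (simp_all add: matrix_mult_simps)

text \<open>The differential of a chart change is a J-linear isometry and carries the frame chosen
  in one chart to an orthonormal frame of the other; \<open>Lambda2_eq\<close> accepts any such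
  frame. Under a change of section, conjugation is linear and passes through the
  contraction.\<close>

lemma adjoint_family_F_hat: "adjoint_family (F_hat \<omega> A)"
  unfolding adjoint_family_def
proof (intro conjI ballI)
  fix c d s p assume c: "c \<in> Atl" "d \<in> Atl" "s \<in> secs P" and p: "p \<in> fst c \<inter> fst d \<inter> fst s"
  define L where "L = dir_deriv (chart_change c d) (snd c p)"
  interpret c: hermitian_point "\<omega> c" "snd c p" using p by (intro hermitian[OF c(1)]) auto
  interpret d: hermitian_point "\<omega> d" "snd d p" using p by (intro hermitian[OF c(2)]) auto
  interpret sc: local_connection "cdom c s" "A c s" by (rule local_connection[OF c(1,3)])
  interpret sd: local_connection "cdom d s" "A d s" by (rule local_connection[OF c(2,3)])
  have x: "snd c p \<in> cdom c s" "snd d p \<in> cdom d s" using p by (auto simp: cdom_def)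
  have J: "Jmul (L v) = L (Jmul v)" for v
    unfolding L_def using chart_change_holomorphic[OF c(1,2)] p by simp
  have "metric (\<omega> d) (snd d p) (L u) (L v) = metric (\<omega> c) (snd c p) u v" for u v
    using two_formD(4)[OF two_form_\<omega> c(1) c(2), of p u "Jmul v"] p by (simp add: metric_def J[unfolded L_def] L_def)
  then have "d.orthonormal (\<lambda>a. L (onb (metric (\<omega> c) (snd c p)) a))"
    using c.orthonormal_onb by (simp add: c.orthonormal_def d.orthonormal_def)
  from d.Lambda2_eq[OF sd.bilinear_curvature[OF x(2)] this]
    c.Lambda2_eq[OF sc.bilinear_curvature[OF x(1)] c.orthonormal_onb]
  show "F_hat \<omega> A c s (snd c p) = F_hat \<omega> A d s (snd d p)"
    unfolding F_hat_def by (simp add: J curvature_chart[OF c p] L_def[symmetric])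
next
  fix c s t p assume c: "c \<in> Atl" "s \<in> secs P" "t \<in> secs P" and p: "p \<in> fst c \<inter> fst s \<inter> fst t"
  define g where "g = transition G P s t p"
  note lin = linear_conjugate[of g]
  show "F_hat \<omega> A c t (snd c p) =
      matrix_inv (transition G P s t p) ** F_hat \<omega> A c s (snd c p) ** transition G P s t p"
    unfolding g_def[symmetric] F_hat_def Lambda2_def Let_def curvature_transition[OF c p, folded g_def]
    by (simp only: linear_scale[OF lin] linear_sum[OF lin])
qed

lemma adjoint_family_theta_coeff:
  "adjoint_family (\<lambda>c s x. theta_coeff z (\<theta> c x) (curvature (A c s) x))"
  unfolding adjoint_family_def
proof (intro conjI ballI)
  fix c d s p assume c: "c \<in> Atl" "d \<in> Atl" "s \<in> secs P" and p: "p \<in> fst c \<inter> fst d \<inter> fst s"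
  interpret sc: local_connection "cdom c s" "A c s" by (rule local_connection[OF c(1,3)])
  interpret sd: local_connection "cdom d s" "A d s" by (rule local_connection[OF c(2,3)])
  have x: "snd c p \<in> cdom c s" "snd d p \<in> cdom d s" using p by (auto simp: cdom_def)
  show "theta_coeff z (\<theta> c (snd c p)) (curvature (A c s) (snd c p)) =
      theta_coeff z (\<theta> d (snd d p)) (curvature (A d s) (snd d p))"
  proof (rule theta_coeff_pullback)
    show "complex_volume (\<theta> c (snd c p))" "complex_volume (\<theta> d (snd d p))"
      using p volume c by auto
    show "dir_deriv (chart_change c d) (snd c p) (Jmul v) = Jmul (dir_deriv (chart_change c d) (snd c p) v)" for v
      using chart_change_holomorphic[OF c(1,2)] p by simp
    show "\<theta> c (snd c p) u v = \<theta> d (snd d p) (dir_deriv (chart_change c d) (snd c p) u)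
        (dir_deriv (chart_change c d) (snd c p) v)" for u v
      using two_formD(4)[OF two_form_\<theta> c(1) c(2)] p by simp
  qed (use x curvature_chart[OF c p] sc.bilinear_curvature sd.bilinear_curvature
      sc.curvature_self sd.curvature_self in auto)
next
  fix c s t p assume c: "c \<in> Atl" "s \<in> secs P" "t \<in> secs P" and p: "p \<in> fst c \<inter> fst s \<inter> fst t"
  show "theta_coeff z (\<theta> c (snd c p)) (curvature (A c t) (snd c p)) =
      matrix_inv (transition G P s t p) ** theta_coeff z (\<theta> c (snd c p)) (curvature (A c s) (snd c p)) **
        transition G P s t p"
    using theta_coeff_linear[OF linear_conjugate[of "transition G P s t p"],
        of z "\<theta> c (snd c p)" "curvature (A c s) (snd c p)"]
    by (simp flip: curvature_transition[OF c p])
qed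

text \<open>Shaped like \<open>F_hat_norm_sq\<close>, so that one proof of well-definedness serves
  the contracted curvature and both \<theta>-coefficients.\<close>

definition invariant_norm :: "('m chart \<Rightarrow> ('m, 'p) lsec \<Rightarrow> cvec \<Rightarrow> 'n cmat) \<Rightarrow> 'm \<Rightarrow> real" where
  "invariant_norm R p = (THE r. \<exists>c\<in>Atl. \<exists>s\<in>secs P. p \<in> fst c \<inter> fst s \<and>
     r = R c s (snd c p) \<bullet> R c s (snd c p))"

lemma inner_adjoint_family:
  assumes "adjoint_family R" "c \<in> Atl" "d \<in> Atl" "s \<in> secs P" "t \<in> secs P"
    "p \<in> fst c \<inter> fst s" "p \<in> fst d \<inter> fst t"
  shows "R d t (snd d p) \<bullet> R d t (snd d p) = R c s (snd c p) \<bullet> R c s (snd c p)"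
  unfolding adjoint_family_change[OF assms]
  using assms by (intro inner_conjugate transition(1)) auto

lemma invariant_norm_eq:
  assumes R: "adjoint_family R" and c: "c \<in> Atl" "s \<in> secs P" "p \<in> fst c \<inter> fst s"
  shows "invariant_norm R p = R c s (snd c p) \<bullet> R c s (snd c p)"
  unfolding invariant_norm_def
proof (rule the_equality)
  show "\<exists>d\<in>Atl. \<exists>t\<in>secs P. p \<in> fst d \<inter> fst t \<and> R c s (snd c p) \<bullet> R c s (snd c p) = R d t (snd d p) \<bullet> R d t (snd d p)"
    using c by blast
qed (use inner_adjoint_family[OF R c(1) _ c(2) _ c(3)] c in blast)

text \<open>The equivariant function on the total space that irreducibility speaks of.
  \<open>total_section_act\<close> shows that the admissible choices agree.\<close>

definition total_section :: "('m chart \<Rightarrow> ('m, 'p) lsec \<Rightarrow> cvec \<Rightarrow> 'n cmat) \<Rightarrow> 'p \<Rightarrow> 'n cmat" where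
  "total_section R q = (SOME X. \<exists>c\<in>Atl. \<exists>s\<in>secs P. \<exists>g\<in>G. proj P q \<in> fst c \<inter> fst s \<and>
     q = act P (snd s (proj P q)) g \<and> X = matrix_inv g ** R c s (snd c (proj P q)) ** g)"

text \<open>If q = s g = t h and t = s k, freeness of the action gives g = k h; conjugation by k is
  exactly the change of R from s to t.\<close>

lemma total_section_act:
  assumes R: "adjoint_family R" and c: "c \<in> Atl" "s \<in> secs P" "p \<in> fst c \<inter> fst s" and g: "g \<in> G"
  shows "total_section R (act P (snd s p) g) = matrix_inv g ** R c s (snd c p) ** g"
proof -
  define q where "q = act P (snd s p) g"
  have pq: "proj P q = p" using c by (simp add: q_def proj_act[OF g] proj_section)
  show ?thesis
    unfolding total_section_def q_def[symmetric] pq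
  proof (rule some_equality)
    show "\<exists>c'\<in>Atl. \<exists>s'\<in>secs P. \<exists>g'\<in>G. p \<in> fst c' \<inter> fst s' \<and> q = act P (snd s' p) g' \<and>
        matrix_inv g ** R c s (snd c p) ** g = matrix_inv g' ** R c' s' (snd c' p) ** g'"
      using c g q_def by blast
  next
    fix X assume "\<exists>d\<in>Atl. \<exists>t\<in>secs P. \<exists>h\<in>G. p \<in> fst d \<inter> fst t \<and> q = act P (snd t p) h \<and>
        X = matrix_inv h ** R d t (snd d p) ** h"
    then obtain d t h where d: "d \<in> Atl" "t \<in> secs P" "h \<in> G" "p \<in> fst d \<inter> fst t"
      and q: "q = act P (snd t p) h" and X: "X = matrix_inv h ** R d t (snd d p) ** h" by blast
    define k where "k = transition G P s t p"
    have k: "k \<in> G" "snd t p = act P (snd s p) k"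
      using transition[OF c(2) d(2)] c(3) d(4) by (auto simp: k_def)
    have "q = act P (snd s p) (k ** h)" using q k act_act[OF k(1) d(3)] by simp
    moreover have "\<exists>!g. g \<in> G \<and> q = act P (snd s p) g"
      by (rule fibre_torsor) (use pq c proj_section in auto)
    ultimately have gkh: "g = k ** h" using g mult_mem[OF k(1) d(3)] q_def by blast
    have inv: "matrix_inv (k ** h) = matrix_inv h ** matrix_inv k"
      by (simp add: matrix_inv_eq k(1) d(3) mult_mem conj_transpose_mult)
    show "X = matrix_inv g ** R c s (snd c p) ** g"
      unfolding X adjoint_family_change[OF R c(1) d(1) c(2) d(2) c(3) d(4)] k_def[symmetric] gkh inv
      by (simp add: matrix_mul_assoc)
  qed
qed

lemma adjoint_section_total_section:
  assumes R: "adjoint_family R"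
    and lie: "\<And>c s x. c \<in> Atl \<Longrightarrow> s \<in> secs P \<Longrightarrow> x \<in> cdom c s \<Longrightarrow> R c s x \<in> lie_algebra G"
    and smooth: "\<And>c s. c \<in> Atl \<Longrightarrow> s \<in> secs P \<Longrightarrow> smooth_on (cdom c s) (R c s)"
  shows "adjoint_section Atl G P (total_section R)"
    and "c \<in> Atl \<Longrightarrow> s \<in> secs P \<Longrightarrow> x \<in> cdom c s \<Longrightarrow> (total_section R \<circ> snd s \<circ> chart_inv c) x = R c s x"
proof -
  have loc: "(total_section R \<circ> snd s \<circ> chart_inv c) x = R c s x"
    if c: "c \<in> Atl" "s \<in> secs P" and x: "x \<in> cdom c s" for c s x
  proof -
    obtain p where p: "p \<in> fst c \<inter> fst s" "x = snd c p" using x by (auto simp: cdom_def)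
    have "matrix_inv (mat 1) = (mat 1 :: 'n cmat)" using matrix_inv_eq[OF one_mem] by simp
    then show ?thesis
      using total_section_act[OF R c p(1) one_mem] p chart_inv_chart[OF c(1)] by (simp add: act_one)
  qed
  then show "c \<in> Atl \<Longrightarrow> s \<in> secs P \<Longrightarrow> x \<in> cdom c s \<Longrightarrow> (total_section R \<circ> snd s \<circ> chart_inv c) x = R c s x" .
  have obt: "\<exists>c\<in>Atl. \<exists>s\<in>secs P. \<exists>p\<in>fst c \<inter> fst s. \<exists>g\<in>G. q = act P (snd s p) g" for q
  proof -
    obtain c s where c: "c \<in> Atl" "s \<in> secs P" "proj P q \<in> fst c \<inter> fst s"
      using local_data_exist by blast
    then have "\<exists>!g. g \<in> G \<and> q = act P (snd s (proj P q)) g"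
      by (intro fibre_torsor) (simp add: proj_section)
    then show ?thesis using c by blast
  qed
  show "adjoint_section Atl G P (total_section R)"
    unfolding adjoint_section_def
  proof (intro conjI allI ballI)
    fix q
    obtain c s p g where c: "c \<in> Atl" "s \<in> secs P" "p \<in> fst c \<inter> fst s" "g \<in> G" "q = act P (snd s p) g"
      using obt by blast
    have q: "total_section R q = matrix_inv g ** R c s (snd c p) ** g"
      unfolding c(5) by (rule total_section_act[OF R c(1-4)])
    show "total_section R q \<in> lie_algebra G"
      unfolding q by (rule conjugate_mem_lie_algebra[OF lie c(4)]) (use c in \<open>auto simp: cdom_def\<close>)
    fix h assume h: "h \<in> G"
    have "act P q h = act P (snd s p) (g ** h)" unfolding c(5) by (rule act_act[OF c(4) h])
    then have "total_section R (act P q h) = matrix_inv (g ** h) ** R c s (snd c p) ** (g ** h)"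
      using total_section_act[OF R c(1-3) mult_mem[OF c(4) h]] by simp
    also have "\<dots> = matrix_inv h ** total_section R q ** h"
      unfolding q by (simp add: matrix_inv_eq c(4) h mult_mem conj_transpose_mult matrix_mul_assoc)
    finally show "total_section R (act P q h) = matrix_inv h ** total_section R q ** h" .
  next
    fix c s assume c: "c \<in> Atl" "s \<in> secs P"
    show "smooth_on (cdom c s) (total_section R \<circ> snd s \<circ> chart_inv c)"
      by (rule smooth_on_cong[OF open_cdom[OF c] smooth[OF c]]) (rule loc[OF c, symmetric])
  qed
qed

section \<open>From a vanishing norm to a vanishing contracted curvature\<close>

lemma F_hat_mem_lie_algebra:
  "c \<in> Atl \<Longrightarrow> s \<in> secs P \<Longrightarrow> x \<in> cdom c s \<Longrightarrow> F_hat \<omega> A c s x \<in> lie_algebra G"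
  unfolding F_hat_def Lambda2_def Let_def
  by (intro subspace_scale subspace_sum subspace_lie_algebra curvature_mem_lie_algebra)

lemma F_hat_norm_sq_eq:
  assumes "c \<in> Atl" "s \<in> secs P" "p \<in> fst c \<inter> fst s"
  shows "F_hat_norm_sq Atl \<omega> P A p = F_hat \<omega> A c s (snd c p) \<bullet> F_hat \<omega> A c s (snd c p)"
proof -
  have "trace_inner (F_hat \<omega> A c s (snd c p)) (F_hat \<omega> A c s (snd c p)) =
      F_hat \<omega> A c s (snd c p) \<bullet> F_hat \<omega> A c s (snd c p)"
    if "c \<in> Atl" "s \<in> secs P" "p \<in> fst c \<inter> fst s" for c s
    by (intro trace_inner_eq_inner lie_algebra_skew F_hat_mem_lie_algebra that)
      (use that in \<open>auto simp: cdom_def\<close>)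
  then have "(\<exists>c\<in>Atl. \<exists>s\<in>secs P. p \<in> fst c \<inter> fst s \<and>
      r = trace_inner (F_hat \<omega> A c s (snd c p)) (F_hat \<omega> A c s (snd c p))) \<longleftrightarrow>
    (\<exists>c\<in>Atl. \<exists>s\<in>secs P. p \<in> fst c \<inter> fst s \<and>
      r = F_hat \<omega> A c s (snd c p) \<bullet> F_hat \<omega> A c s (snd c p))" for r
    by (intro bex_cong refl) auto
  then have "F_hat_norm_sq Atl \<omega> P A p = invariant_norm (F_hat \<omega> A) p"
    unfolding F_hat_norm_sq_def invariant_norm_def by simp
  then show ?thesis using invariant_norm_eq[OF adjoint_family_F_hat assms] by simp
qed

text \<open>\<open>onb\<close> could jump from point to point; \<open>Lambda2_gram_schmidt\<close>
  expresses the contraction by quantities that are visibly continuous, with positive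
  denominators.\<close>

lemma continuous_on_F_hat:
  assumes c: "c \<in> Atl" "s \<in> secs P"
  shows "continuous_on (cdom c s) (F_hat \<omega> A c s)"
proof -
  interpret local_connection "cdom c s" "A c s" by (rule local_connection[OF c])
  define u where "u = (axis 1 1 :: cvec)"
  define n where "n = (\<lambda>x. \<omega> c x u (Jmul u))"
  define w where "w = (\<lambda>x. axis 2 1 - (\<omega> c x (axis 2 1) (Jmul u) / n x) *\<^sub>R u
    + (\<omega> c x (axis 2 1) u / n x) *\<^sub>R Jmul u)"
  have herm: "hermitian_point (\<omega> c) x" if "x \<in> cdom c s" for x
    using that cdom_subset[of c s] by (intro hermitian[OF c(1)]) blast
  have gs: "n x > 0" "\<omega> c x (w x) (Jmul (w x)) > 0"
    "F_hat \<omega> A c s x = (1 / n x) *\<^sub>R curvature (A c s) x u (Jmul u)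
      + (1 / \<omega> c x (w x) (Jmul (w x))) *\<^sub>R curvature (A c s) x (w x) (Jmul (w x))"
    if "x \<in> cdom c s" for x
    using hermitian_point.Lambda2_gram_schmidt[OF herm[OF that] bilinear_curvature[OF that] curvature_self]
    unfolding F_hat_def u_def n_def w_def by blast+
  have \<omega>: "continuous_on (cdom c s) (\<lambda>x. \<omega> c x p q)" for p q
    using smooth_on_imp_continuous_on[OF two_formD(3)[OF two_form_\<omega> c(1)]] cdom_subset
    by (rule continuous_on_subset)
  then have n: "continuous_on (cdom c s) n" by (simp add: n_def)
  have n0: "\<forall>x\<in>cdom c s. n x \<noteq> 0" using gs(1) by force
  have w: "continuous_on (cdom c s) w"
    unfolding w_def by (intro continuous_intros \<omega> n n0)
  have "continuous_on (cdom c s) (\<lambda>x. Jmul (w x))"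
    using linear_continuous_on_compose[OF w linear_Jmul] by simp
  note wJw = w this
  have m: "continuous_on (cdom c s) (\<lambda>x. \<omega> c x (w x) (Jmul (w x)))"
    by (rule continuous_on_bilinear_family[OF _ \<omega> wJw])
      (use two_formD(1)[OF two_form_\<omega> c(1)] cdom_subset[of c s] in blast)
  have m0: "\<forall>x\<in>cdom c s. \<omega> c x (w x) (Jmul (w x)) \<noteq> 0" using gs(2) by force
  have "continuous_on (cdom c s) (\<lambda>x. curvature (A c s) x (w x) (Jmul (w x)))"
    by (rule continuous_on_bilinear_family[OF bilinear_curvature smooth_on_imp_continuous_on[OF smooth_curvature] wJw])
  then have "continuous_on (cdom c s) (\<lambda>x. (1 / n x) *\<^sub>R curvature (A c s) x u (Jmul u)
      + (1 / \<omega> c x (w x) (Jmul (w x))) *\<^sub>R curvature (A c s) x (w x) (Jmul (w x)))"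
    by (intro continuous_intros n n0 m m0 smooth_on_imp_continuous_on[OF smooth_curvature])
  then show ?thesis by (rule continuous_on_eq) (simp add: gs(3))
qed

text \<open>By continuity a nonzero value keeps the squared norm above \<epsilon> on a nonempty open
  set, which has positive measure. The comparison with \<epsilon> times an indicator avoids the
  question whether the norm is measurable.\<close>

lemma F_hat_eq_0:
  assumes L2: "F_hat_L2 Atl \<omega> P A = 0" and c: "c \<in> Atl" "s \<in> secs P" "x \<in> cdom c s"
  shows "F_hat \<omega> A c s x = 0"
proof (rule ccontr)
  assume nz: "F_hat \<omega> A c s x \<noteq> 0"
  define \<nu> where "\<nu> = (\<lambda>y. F_hat \<omega> A c s y \<bullet> F_hat \<omega> A c s y)"
  define \<epsilon> where "\<epsilon> = \<nu> x / 2"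
  have \<epsilon>: "\<epsilon> > 0" using nz by (simp add: \<epsilon>_def \<nu>_def)
  define V where "V = \<nu> -` {\<epsilon><..} \<inter> cdom c s"
  have "continuous_on (cdom c s) \<nu>"
    unfolding \<nu>_def by (intro continuous_intros continuous_on_F_hat c)
  then have V: "open V" unfolding V_def
    by (simp add: continuous_on_open_vimage[OF open_cdom[OF c(1,2)]])
  have "\<nu> x > \<epsilon>" using \<epsilon> by (simp add: \<epsilon>_def)
  then have xV: "x \<in> V" using c by (simp add: V_def)
  define U where "U = snd c -` V \<inter> fst c"
  have U: "open U" "U \<subseteq> fst c" "U \<noteq> {}"
    using open_chart_preimage[OF c(1) V] xV c by (auto simp: U_def V_def cdom_def)
  have lower: "ennreal \<epsilon> * indicator U p \<le> ennreal (F_hat_norm_sq Atl \<omega> P A p)" for p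
  proof (cases "p \<in> U")
    case True
    then have "snd c p \<in> V" and pc: "p \<in> fst c" by (auto simp: U_def)
    then obtain p' where "p' \<in> fst c" "p' \<in> fst s" "snd c p = snd c p'" by (auto simp: V_def cdom_def)
    then have "p \<in> fst c \<inter> fst s" using pc chart_inv_chart[OF c(1)] by (metis IntI)
    from F_hat_norm_sq_eq[OF c(1,2) this] \<open>snd c p \<in> V\<close> True show ?thesis
      by (auto simp: V_def \<nu>_def intro!: ennreal_leI)
  qed simp
  have "ennreal \<epsilon> * emeasure (vol_measure Atl \<omega>) U = (\<integral>\<^sup>+p. ennreal \<epsilon> * indicator U p \<partial>vol_measure Atl \<omega>)"
    using U(1) by (simp add: nn_integral_cmult_indicator sets_vol_measure)
  also have "\<dots> \<le> (\<integral>\<^sup>+p. ennreal (F_hat_norm_sq Atl \<omega> P A p) \<partial>vol_measure Atl \<omega>)"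
    by (rule nn_integral_mono) (rule lower)
  \<comment> \<open>A zero value of \<open>sqrt_integral\<close> excludes its infinite branch, so
    \<open>enn2real\<close> is faithful and the integral itself is zero.\<close>
  also have "\<dots> = 0"
    using L2 by (auto simp: F_hat_L2_def sqrt_integral_def Let_def enn2real_eq_0_iff split: if_splits)
  finally show False using vol_measure_pos[OF c(1) U] \<epsilon> by (simp add: ennreal_eq_0_iff)
qed

lemma local_yang_mills:
  assumes ym: "yang_mills Atl \<omega> P A" and L2: "F_hat_L2 Atl \<omega> P A = 0" and c: "c \<in> Atl" "s \<in> secs P"
  shows "local_yang_mills (cdom c s) (A c s) (\<omega> c) (\<theta> c)"
proof (intro local_yang_mills.intro local_connection[OF c] local_yang_mills_axioms.intro)
  fix x u v w assume x: "x \<in> cdom c s"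
  then have x': "x \<in> snd c ` fst c" using cdom_subset by blast
  show "hermitian_point (\<omega> c) x" by (rule hermitian[OF c(1) x'])
  show "complex_volume (\<theta> c x)" by (rule volume[OF c(1) x'])
  show "dir_deriv (\<lambda>y. \<theta> c y v w) x u + dir_deriv (\<lambda>y. \<theta> c y w u) x v + dir_deriv (\<lambda>y. \<theta> c y u v) x w = 0"
    by (rule closed_\<theta>[OF c(1) x'])
  show "dA_adj2 (\<omega> c) (A c s) (curvature (A c s)) x u = 0"
    using ym c x unfolding yang_mills_def by blast
  show "Lambda2 (\<omega> c) x (curvature (A c s) x) = 0"
    using F_hat_eq_0[OF L2 c x] by (simp add: F_hat_def)
next
  show "smooth_on (cdom c s) (\<lambda>x. \<omega> c x u v)" "smooth_on (cdom c s) (\<lambda>x. \<theta> c x u v)" for u v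
    by (rule smooth_on_subset[OF two_formD(3)[OF two_form_\<omega> c(1)] cdom_subset]
        smooth_on_subset[OF two_formD(3)[OF two_form_\<theta> c(1)] cdom_subset])+
qed

text \<open>Compactness supplies a global maximum of the energy, the local maximum principle makes
  the maximum set open, and connectedness spreads it over the whole manifold.\<close>

theorem anti_self_dual_of_trace_free:
  assumes compact: "compact (UNIV :: 'm set)" and connected: "connected (UNIV :: 'm set)"
    and irreducible: "irreducible_connection Atl G P A"
    and ym: "yang_mills Atl \<omega> P A" and L2: "F_hat_L2 Atl \<omega> P A = 0"
  shows "anti_self_dual Atl \<omega> P A"
proof -
  define R where "R = (\<lambda>z c s x. theta_coeff z (\<theta> c x) (curvature (A c s) x))"
  have R: "adjoint_family (R z)" for z
    unfolding R_def by (rule adjoint_family_theta_coeff)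
  note lym = local_yang_mills[OF ym L2]
  \<comment> \<open>The local energies glue to a function on the manifold because the inner product
    is invariant under conjugation.\<close>
  define E where "E = (\<lambda>p. invariant_norm (R 1) p + invariant_norm (R \<i>) p)"
  have E: "E p = local_yang_mills.energy (A c s) (\<theta> c) (snd c p)"
    if "c \<in> Atl" "s \<in> secs P" "p \<in> fst c \<inter> fst s" for c s p
    unfolding E_def local_yang_mills.energy_def[OF lym[OF that(1,2)]]
      invariant_norm_eq[OF R that]
    unfolding R_def ..
  have "continuous_on (fst c \<inter> fst s) E" if "c \<in> Atl" "s \<in> secs P" for c s
  proof -
    interpret local_yang_mills "cdom c s" "A c s" "\<omega> c" "\<theta> c" by (rule lym[OF that])
    have "continuous_on (fst c \<inter> fst s) (\<lambda>p. energy (snd c p))"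
      by (rule continuous_on_compose2[OF smooth_on_imp_continuous_on[OF smooth_energy]
            continuous_on_subset[OF chart_continuous[OF that(1)]]]) (auto simp: cdom_def)
    then show ?thesis by (rule continuous_on_eq) (simp add: E[OF that])
  qed
  then have "continuous_on (\<Union>{fst c \<inter> fst s |c s. c \<in> Atl \<and> s \<in> secs P}) E"
    by (intro continuous_on_open_Union) (blast intro: open_Int open_chart open_section)+
  moreover have "\<Union>{fst c \<inter> fst s |c s. c \<in> Atl \<and> s \<in> secs P} = UNIV"
    using local_data_exist by (intro equalityI subsetI UNIV_I) blast
  ultimately have contE: "continuous_on UNIV E" by simp
  then obtain p0 where p0: "\<And>p. E p \<le> E p0"
    using continuous_attains_sup[OF compact _ contE] by auto
  define K where "K = {p. E p = E p0}"
  have "closed K"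
    unfolding K_def using contE by (intro closed_Collect_eq continuous_intros) auto
  moreover have "open K"
  proof (subst open_subopen, intro ballI)
    fix p assume p: "p \<in> K"
    obtain c s where c: "c \<in> Atl" "s \<in> secs P" "p \<in> fst c \<inter> fst s" using local_data_exist by blast
    interpret local_yang_mills "cdom c s" "A c s" "\<omega> c" "\<theta> c" by (rule lym[OF c(1,2)])
    have "energy x \<le> energy (snd c p)" if x: "x \<in> cdom c s" for x
    proof -
      obtain q where q: "q \<in> fst c \<inter> fst s" "x = snd c q" using x by (auto simp: cdom_def)
      show ?thesis using p0[of q] p E[OF c] E[OF c(1,2) q(1)] q(2) by (simp add: K_def)
    qed
    moreover have xp: "snd c p \<in> cdom c s" using c by (auto simp: cdom_def)
    ultimately obtain r where r: "r > 0" "\<And>x. x \<in> ball (snd c p) r \<Longrightarrow> energy x = energy (snd c p)"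
      using energy_strong_maximum by blast
    define U where "U = snd c -` ball (snd c p) r \<inter> fst c \<inter> fst s"
    have "open U" unfolding U_def
      by (intro open_Int open_chart_preimage[OF c(1)] open_section[OF c(2)] open_ball)
    moreover have "p \<in> U" using c r by (simp add: U_def)
    moreover have "U \<subseteq> K"
      using r(2) E[OF c(1,2)] E[OF c] p by (auto simp: U_def K_def)
    ultimately show "\<exists>T. open T \<and> p \<in> T \<and> T \<subseteq> K" by blast
  qed
  ultimately have "K = UNIV"
    using connected p0 unfolding connected_clopen by (auto simp: K_def)
  then have const: "E p = E p0" for p by (auto simp: K_def)
  have parallel: "dA0 (A c s) (R z c s) x v = 0" if z: "z = 1 \<or> z = \<i>" and c: "c \<in> Atl" "s \<in> secs P" and x: "x \<in> cdom c s" for z c s x v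
  proof -
    interpret local_yang_mills "cdom c s" "A c s" "\<omega> c" "\<theta> c" by (rule lym[OF c])
    have "energy y = E p0" if "y \<in> cdom c s" for y
    proof -
      obtain q where q: "q \<in> fst c \<inter> fst s" "y = snd c q" using \<open>y \<in> cdom c s\<close> by (auto simp: cdom_def)
      then show ?thesis using E[OF c q(1)] const[of q] by simp
    qed
    from constant_energy_imp_parallel[OF S subset_refl x this] z
    show ?thesis by (auto simp: R_def)
  qed
  have zero: "R z c s x = 0" if z: "z = 1 \<or> z = \<i>" and c: "c \<in> Atl" "s \<in> secs P" and x: "x \<in> cdom c s" for z c s x
  proof -
    \<comment> \<open>The coefficients are real combinations of curvature values, so they stay in
      the Lie algebra.\<close>
    have lie: "R z c s x \<in> lie_algebra G" if "c \<in> Atl" "s \<in> secs P" "x \<in> cdom c s" for c s x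
      unfolding R_def theta_coeff_def J_anti_def
      by (intro subspace_add subspace_scale subspace_diff subspace_lie_algebra curvature_mem_lie_algebra that)
    have smooth: "smooth_on (cdom c s) (R z c s)" if "c \<in> Atl" "s \<in> secs P" for c s
      unfolding R_def by (rule local_yang_mills.smooth_f[OF lym[OF that]])
    have T1: "adjoint_section Atl G P (total_section (R z))"
      by (rule adjoint_section_total_section(1)[OF R]) (blast intro: lie smooth)+
    have T2: "(total_section (R z) \<circ> snd s \<circ> chart_inv c) x = R z c s x"
      if "c \<in> Atl" "s \<in> secs P" "x \<in> cdom c s" for c s x
      by (rule adjoint_section_total_section(2)[OF R]) (blast intro: lie smooth that)+
    have "dA0 (A c s) (total_section (R z) \<circ> snd s \<circ> chart_inv c) x v = 0"
      if "c \<in> Atl" "s \<in> secs P" "x \<in> cdom c s" for c s x v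
    proof -
      have "dA0 (A c s) (total_section (R z) \<circ> snd s \<circ> chart_inv c) x v = dA0 (A c s) (R z c s) x v"
        by (rule dA0_cong[OF open_cdom[OF that(1,2)] that(3)]) (rule T2[OF that(1,2)])
      then show ?thesis using parallel[OF z that] by simp
    qed
    then have "total_section (R z) q = 0" for q
      using irreducible T1 unfolding irreducible_connection_def by blast
    then show ?thesis using T2[OF c x] by simp
  qed
  show ?thesis
    unfolding anti_self_dual_def
  proof (intro ballI allI)
    fix c s x u v assume c: "c \<in> Atl" "s \<in> secs P" and x: "x \<in> cdom c s"
    interpret local_yang_mills "cdom c s" "A c s" "\<omega> c" "\<theta> c" by (rule lym[OF c])
    show "hodge2 (\<omega> c) x (curvature (A c s) x) u v = - curvature (A c s) x u v"
      by (rule anti_self_dual_of_f_zero[OF x]) (use zero[OF _ c x] in \<open>auto simp: R_def\<close>)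
  qed
qed

end

theorem theorem1p2:
  fixes Atl :: "'m::t2_space chart set"
    and \<omega> :: "'m chart \<Rightarrow> cvec \<Rightarrow> cvec \<Rightarrow> cvec \<Rightarrow> real"
    and \<theta> :: "'m chart \<Rightarrow> cvec \<Rightarrow> cvec \<Rightarrow> cvec \<Rightarrow> complex"
    and G :: "'n::finite cmat set"
    and P :: "('m, 'p, 'n) pbundle"
    and A :: "('m, 'p, 'n) gauge_pot"
  assumes "compact (UNIV :: 'm set)"
    and "simply_connected (UNIV :: 'm set)"
    and "calabi_yau_2fold Atl \<omega> \<theta>"
    and "compact_unitary_group G"
    and "semisimple_group G"
    and "principal_bundle Atl G P"
    and "connection Atl G P A"
    and "irreducible_connection Atl G P A"
    and "yang_mills Atl \<omega> P A"
  shows "\<exists>\<delta>>0. F_hat_L2 Atl \<omega> P A \<le> ennreal \<delta> \<longrightarrow> anti_self_dual Atl \<omega> P A"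
proof (cases "F_hat_L2 Atl \<omega> P A = 0")
  case True
  interpret bundle_connection Atl \<omega> \<theta> G P A
    by unfold_locales (fact assms)+
  have "anti_self_dual Atl \<omega> P A"
    by (rule anti_self_dual_of_trace_free[OF assms(1) simply_connected_UNIV_imp_connected[OF assms(2)]
          assms(8,9) True])
  \<comment> \<open>The conclusion already holds, so any positive constant serves.\<close>
  then show ?thesis by (intro exI[of _ 1]) simp
next
  case False
  \<comment> \<open>The norm is positive and possibly infinite. A constant strictly between 0 and
    the norm is finite and falsifies the premise.\<close>
  then obtain y where y: "0 < y" "y < F_hat_L2 Atl \<omega> P A"
    using dense[of 0 "F_hat_L2 Atl \<omega> P A"] by (auto simp: zero_less_iff_neq_zero)
  then have "y \<noteq> \<infinity>" by auto
  then have "ennreal (enn2real y) = y" "enn2real y > 0"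
    using y(1) by (auto simp: enn2real_positive_iff less_top)
  then show ?thesis using y(2) by (intro exI[of _ "enn2real y"]) auto
qed

end
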